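(* Let $\Psi\in\mathcal{S}_+^{m\times m}(\mathbb{T})$ and let $G(z)=(zI-A)^{-1}B$ with $A\in\mathbb{C}^{n\times n}$ having all its eigenvalues in the open unit disc, $B\in\mathbb{C}^{n\times m}$ of full column rank, and $(A,B)$ reachable. Assume that $$\mathrm{rank}\begin{pmatrix} I-AA^* & B\\ B^* & 0\end{pmatrix}=2m,$$ or, equivalently, that $(I-\Pi_B)(I-AA^* )(I-\Pi_B)=0$ where $\Pi_B=B(B^*B)^{-1}B^*$. Then there exists a unique $\hat\Lambda\in\mathcal{L}_\Gamma^H$ such that $$\int G(I+G^*\hat\Lambda G)^{-1}\Psi(I+G^*\hat\Lambda G)^{-1}G^*=I .$$ The unique solution of the constrained approximation problem $$\text{minimize } \tilde d_H^2(\Phi,\Psi)\quad\text{over }\Phi\in\mathcal{S}_+^{m\times m}(\mathbb{T})\text{ subject to }\int G\Phi G^*=I$$ is then given by $$\hat\Phi_H:=(I+G^*\hat\Lambda G)^{-1}\Psi(I+G^*\hat\Lambda G)^{-1}.$$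
   Context: $\mathbb{T}$ is the unit circle; a star denotes conjugate transposition (pointwise on $\mathbb{T}$); integrals are over $[-\pi,\pi]$ with respect to normalized Lebesgue measure $d\theta/2\pi$, functions on $\mathbb{T}$ being evaluated at $e^{i\theta}$. $\mathcal{S}_+^{m\times m}(\mathbb{T})$ is the family of measurable bounded functions $\Phi$ on $\mathbb{T}$ whose values are Hermitian non-negative definite $m\times m$ matrices and for which there is $c_\Phi>0$ with $\Phi(e^{i\theta})-c_\Phi I$ positive definite a.e. (functions equal a.e. are identified). The distance is $\tilde d_H(\Phi,\Psi)=[\inf\{\|W_\Psi-W_\Phi\|_2^2: W_\Psi,W_\Phi\in L^2_{m\times m},\ W_\Psi W_\Psi^*=\Psi,\ W_\Phi W_\Phi^*=\Phi\}]^{1/2}$, where $L^2_{m\times m}$ is the space of measurable $F:\mathbb{T}\to\mathbb{C}^{m\times m}$ with $\|F\|_2^2=\int\mathrm{tr}\,FF^*<\infty$. $\Gamma$ is the linear operator $\Gamma(\Phi)=\int G\Phi G^*$ defined on the set $\mathcal{C}_H(\mathbb{T})$ of continuous functions on $\mathbb{T}$ with Hermitian $m\times m$ values; $\mathrm{Range}(\Gamma)$ is its range, a real subspace of the Hermitian $n\times n$ matrices. $\mathcal{L}^H:=\{\Lambda\in\mathbb{C}^{n\times n}:\Lambda=\Lambda^*,\ I+G^*\Lambda G>0\ \text{at every } e^{i\theta}\in\mathbb{T}\}$ and $\mathcal{L}_\Gamma^H:=\mathcal{L}^H\cap\mathrm{Range}(\Gamma)$. *)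

theory Defs
  imports "HOL-Analysis.Analysis"
begin

section \<open>Complex matrices\<close>

definition ctransp :: "complex^'n^'m \<Rightarrow> complex^'m^'n" where
  "ctransp M = (\<chi> i j. cnj (M $ j $ i))"

definition hermitian :: "complex^'n^'n \<Rightarrow> bool" where
  "hermitian M \<longleftrightarrow> ctransp M = M"

text \<open>The quadratic form \<open>x\<^sup>* M x\<close>, which is real when \<open>M\<close> is Hermitian; hence the real parts below.\<close>

definition qform :: "complex^'n^'n \<Rightarrow> complex^'n \<Rightarrow> complex" where
  "qform M x = (\<Sum>i\<in>UNIV. cnj (x $ i) * (M *v x) $ i)"

definition psd :: "complex^'n^'n \<Rightarrow> bool" where
  "psd M \<longleftrightarrow> hermitian M \<and> (\<forall>x. 0 \<le> Re (qform M x))"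

definition posdef :: "complex^'n^'n \<Rightarrow> bool" where
  "posdef M \<longleftrightarrow> hermitian M \<and> (\<forall>x. x \<noteq> 0 \<longrightarrow> 0 < Re (qform M x))"

definition is_eigenvalue :: "complex^'n^'n \<Rightarrow> complex \<Rightarrow> bool" where
  "is_eigenvalue A k \<longleftrightarrow> (\<exists>v. v \<noteq> 0 \<and> A *v v = k *s v)"

text \<open>The \<open>k\<close>-th matrix power times \<open>B\<close> is written as an iterate of \<open>(**) A\<close>, since \<open>^\<close> on
  \<^typ>\<open>complex^'n^'n\<close> is the componentwise power. The columns of all \<open>A\<^sup>k B\<close>, \<open>k < n\<close>, are the
  columns of the reachability matrix \<open>[B, A B, \<dots>, A\<^sup>n\<^sup>-\<^sup>1 B]\<close>.\<close>

definition reachable :: "complex^'n^'n \<Rightarrow> complex^'m^'n \<Rightarrow> bool" where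
  "reachable A B \<longleftrightarrow>
     vec.span (\<Union>k<CARD('n). columns (((**) A ^^ k) B)) = (UNIV :: (complex^'n) set)"

definition block_matrix ::
  "complex^'n^'n \<Rightarrow> complex^'m^'n \<Rightarrow> complex^'n^'m \<Rightarrow> complex^'m^'m \<Rightarrow> complex^('n + 'm)^('n + 'm)"
where
  "block_matrix P Q R S = (\<chi> i j.
     case i of
       Inl a \<Rightarrow> (case j of Inl b \<Rightarrow> P $ a $ b | Inr b \<Rightarrow> Q $ a $ b)
     | Inr a \<Rightarrow> (case j of Inl b \<Rightarrow> R $ a $ b | Inr b \<Rightarrow> S $ a $ b))"

definition range_proj :: "complex^'m^'n \<Rightarrow> complex^'n^'n" where
  "range_proj B = B ** matrix_inv (ctransp B ** B) ** ctransp B"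

section \<open>Matrix functions on the unit circle\<close>

text \<open>A function on the unit circle is a function on \<^typ>\<open>complex\<close> of which only the values on
  \<^term>\<open>sphere 0 1 :: complex set\<close> are ever used; it is integrated through
  \<open>\<theta> \<mapsto> F (cis \<theta>)\<close> against normalized Lebesgue measure on \<open>[-\<pi>, \<pi>]\<close>.\<close>

definition circle_measure :: "real measure" where
  "circle_measure = uniform_measure lebesgue {-pi..pi}"

definition circle_measurable :: "(complex \<Rightarrow> 'b::topological_space) \<Rightarrow> bool" where
  "circle_measurable F \<longleftrightarrow> (\<lambda>\<theta>. F (cis \<theta>)) \<in> borel_measurable circle_measure"

definition circle_integral :: "(complex \<Rightarrow> 'b::{banach, second_countable_topology}) \<Rightarrow> 'b" where
  "circle_integral F = integral\<^sup>L circle_measure (\<lambda>\<theta>. F (cis \<theta>))"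

definition ae_equal :: "(complex \<Rightarrow> 'b) \<Rightarrow> (complex \<Rightarrow> 'b) \<Rightarrow> bool" where
  "ae_equal F H \<longleftrightarrow> (AE \<theta> in circle_measure. F (cis \<theta>) = H (cis \<theta>))"

text \<open>The class \<open>\<S>\<^sub>+\<close>, as a set of functions; their identification modulo null sets is made
  explicit through \<^const>\<open>ae_equal\<close> wherever equality of functions matters.\<close>

definition spectral_densities :: "(complex \<Rightarrow> complex^'m^'m) set" where
  "spectral_densities = {\<Phi>. circle_measurable \<Phi> \<and> bounded (\<Phi> ` sphere 0 1) \<and>
     (\<forall>z\<in>sphere 0 1. psd (\<Phi> z)) \<and>
     (\<exists>c>0. AE \<theta> in circle_measure. posdef (\<Phi> (cis \<theta>) - mat (complex_of_real c)))}"

definition L2_matrix :: "(complex \<Rightarrow> complex^'m^'m) set" where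
  "L2_matrix = {F. circle_measurable F \<and>
     integrable circle_measure (\<lambda>\<theta>. Re (trace (F (cis \<theta>) ** ctransp (F (cis \<theta>)))))}"

definition L2_norm :: "(complex \<Rightarrow> complex^'m^'m) \<Rightarrow> real" where
  "L2_norm F = sqrt (circle_integral (\<lambda>z. Re (trace (F z ** ctransp (F z)))))"

text \<open>The real infimum is meaningful because square-integrable factors exist for members of
  \<^const>\<open>spectral_densities\<close>, to which the distance is applied.\<close>

definition hellinger_dist ::
  "(complex \<Rightarrow> complex^'m^'m) \<Rightarrow> (complex \<Rightarrow> complex^'m^'m) \<Rightarrow> real" where
  "hellinger_dist \<Phi> \<Psi> = sqrt (Inf {(L2_norm (\<lambda>z. W\<^sub>\<Psi> z - W\<^sub>\<Phi> z))\<^sup>2 | W\<^sub>\<Psi> W\<^sub>\<Phi>.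
     W\<^sub>\<Psi> \<in> L2_matrix \<and> W\<^sub>\<Phi> \<in> L2_matrix \<and>
     ae_equal (\<lambda>z. W\<^sub>\<Psi> z ** ctransp (W\<^sub>\<Psi> z)) \<Psi> \<and>
     ae_equal (\<lambda>z. W\<^sub>\<Phi> z ** ctransp (W\<^sub>\<Phi> z)) \<Phi>})"

section \<open>The moment map and the dual parameters\<close>

definition transfer_fun :: "complex^'n^'n \<Rightarrow> complex^'m^'n \<Rightarrow> complex \<Rightarrow> complex^'m^'n" where
  "transfer_fun A B z = matrix_inv (mat z - A) ** B"

text \<open>The formula for \<open>\<Gamma>\<close>, used both on continuous functions and on
  \<^const>\<open>spectral_densities\<close>.\<close>

definition moment :: "(complex \<Rightarrow> complex^'m^'n) \<Rightarrow> (complex \<Rightarrow> complex^'m^'m) \<Rightarrow> complex^'n^'n" where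
  "moment G \<Phi> = circle_integral (\<lambda>z. G z ** \<Phi> z ** ctransp (G z))"

definition cont_hermitian :: "(complex \<Rightarrow> complex^'m^'m) set" where
  "cont_hermitian =
     {\<Phi>. continuous_on (sphere 0 1) \<Phi> \<and> (\<forall>z\<in>sphere 0 1. hermitian (\<Phi> z))}"

definition Range_Gamma :: "(complex \<Rightarrow> complex^'m^'n) \<Rightarrow> (complex^'n^'n) set" where
  "Range_Gamma G = moment G ` cont_hermitian"

definition dual_pencil ::
  "(complex \<Rightarrow> complex^'m^'n) \<Rightarrow> complex^'n^'n \<Rightarrow> complex \<Rightarrow> complex^'m^'m" where
  "dual_pencil G \<Lambda> z = mat 1 + ctransp (G z) ** \<Lambda> ** G z"

definition L_H :: "(complex \<Rightarrow> complex^'m^'n) \<Rightarrow> (complex^'n^'n) set" where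
  "L_H G = {\<Lambda>. hermitian \<Lambda> \<and> (\<forall>z\<in>sphere 0 1. posdef (dual_pencil G \<Lambda> z))}"

definition L_Gamma_H :: "(complex \<Rightarrow> complex^'m^'n) \<Rightarrow> (complex^'n^'n) set" where
  "L_Gamma_H G = L_H G \<inter> Range_Gamma G"

definition Phi_hat ::
  "(complex \<Rightarrow> complex^'m^'n) \<Rightarrow> (complex \<Rightarrow> complex^'m^'m) \<Rightarrow> complex^'n^'n \<Rightarrow> complex \<Rightarrow> complex^'m^'m"
where
  "Phi_hat G \<Psi> \<Lambda> z =
     matrix_inv (dual_pencil G \<Lambda> z) ** \<Psi> z ** matrix_inv (dual_pencil G \<Lambda> z)"

end

theory Submission
  imports Defs "HOL-Complex_Analysis.Cauchy_Integral_Formula"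
begin

text \<open>
  The theorem is Lagrange duality for the problem of minimising the squared Hellinger distance to
  \<open>\<Psi>\<close> under the moment constraint, with a Hermitian multiplier \<open>\<Lambda>\<close>. Write \<open>Q = I + G\<^sup>* \<Lambda> G\<close>.
  For factors \<open>W W\<^sup>* = \<Psi>\<close> and \<open>V V\<^sup>* = \<Phi>\<close> of a feasible \<open>\<Phi>\<close>, completing the square in \<open>V\<close>
  (\<open>complete_square\<close>) and integrating gives
    \<open>\<integral> \<parallel>W - V\<parallel>\<^sup>2 = \<integral> tr \<Psi> - \<integral> tr (Q\<^sup>-\<^sup>1 \<Psi>) - tr \<Lambda> + \<integral> tr (E\<^sup>* Q E)\<close>, where \<open>E = V - Q\<^sup>-\<^sup>1 W\<close>.
  The first three terms do not involve \<open>\<Phi>\<close>. So they bound the squared distance from below for every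
  feasible \<open>\<Phi>\<close> (\<open>dual_value_le_dist\<close>), and if the density \<open>Q\<^sup>-\<^sup>1 \<Psi> Q\<^sup>-\<^sup>1\<close> is itself feasible, then
  it attains the bound, through \<open>V = Q\<^sup>-\<^sup>1 W\<close> (\<open>dist_Phi_hat\<close>). The last term also yields uniqueness
  of the optimal density, although the infimum in the distance need not be attained: if it tends to
  zero, then \<open>V V\<^sup>*\<close> tends to \<open>Q\<^sup>-\<^sup>1 \<Psi> Q\<^sup>-\<^sup>1\<close> (\<open>optimal_density_unique\<close>).

  It remains to find \<open>\<Lambda>\<close>. The convex functional \<open>\<integral> tr (Q\<^sup>-\<^sup>1 \<Psi>) + tr \<Lambda>\<close> on \<open>\<L>\<^sub>\<Gamma>\<^sup>H\<close> has as gradient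
  the defect of the moment constraint (\<open>directional_derivative_nonneg\<close>), and the defect lies in the
  range of \<open>\<Gamma>\<close>, because moments of bounded densities do (\<open>moment_in_Range_Gamma\<close>). So a minimiser
  solves the constraint. It exists (\<open>dual_minimiser_exists\<close>) for two reasons. Sublevel sets are
  bounded: if \<open>\<Phi>\<^sub>0\<close> is a coercive density with moment \<open>I\<close>, then \<open>tr \<Lambda> = \<integral> tr ((Q - I) \<Phi>\<^sub>0)\<close>, which
  dominates the size of \<open>\<Lambda>\<close>. And minimising sequences stay away from the boundary of \<open>\<L>\<^sup>H\<close>
  (\<open>limit_in_L_H\<close>): on the boundary some \<open>v\<^sup>* Q v\<close> has a zero on the circle, where it vanishes at
  least linearly, so that \<open>\<integral> tr Q\<^sup>-\<^sup>1\<close> would be infinite. Uniqueness of \<open>\<Lambda>\<close> is strict monotonicity of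
  the gradient (\<open>pairing_increments\<close>).

  The rank condition enters through \<open>\<Phi>\<^sub>0\<close>. It is equivalent to \<open>\<parallel>A\<^sup>* x\<parallel> = \<parallel>x\<parallel>\<close> for all \<open>x\<close> in the kernel
  of \<open>B\<^sup>*\<close> (\<open>rank_bordered_iff\<close> gives the form with projections). Then the state feedback
  \<open>F = (I - \<Pi>\<^sub>B) A\<close> is stable with \<open>I - F F\<^sup>* = \<Pi>\<^sub>B\<close>, and the solution of this Stein equation as an
  integral over the circle is a moment of a coercive density (\<open>feasible_density\<close>).
\<close>

section \<open>Complex matrices and the trace inner product\<close>

lemma ctransp_nth [simp]: "ctransp M $ i $ j = cnj (M $ j $ i)"
  by (simp add: ctransp_def)

lemma ctransp_ctransp [simp]: "ctransp (ctransp M) = M"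
  by (simp add: vec_eq_iff)

lemma ctransp_mult: "ctransp (X ** Y) = ctransp Y ** ctransp X"
  by (simp add: vec_eq_iff matrix_matrix_mult_def mult.commute)

lemma ctransp_add: "ctransp (X + Y) = ctransp X + ctransp Y"
  by (simp add: vec_eq_iff)

lemma ctransp_diff: "ctransp (X - Y) = ctransp X - ctransp Y"
  by (simp add: vec_eq_iff)

lemma ctransp_0 [simp]: "ctransp 0 = 0"
  by (simp add: vec_eq_iff)

lemma ctransp_scaleR: "ctransp (r *\<^sub>R X) = r *\<^sub>R ctransp X"
  by (simp add: vec_eq_iff)

lemma ctransp_mat [simp]: "ctransp (mat c) = mat (cnj c)"
  by (simp add: vec_eq_iff mat_def)

lemma hermitianD: "hermitian M \<Longrightarrow> ctransp M = M"
  by (simp add: hermitian_def)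

lemma hermitian_add: "hermitian X \<Longrightarrow> hermitian Y \<Longrightarrow> hermitian (X + Y)"
  and hermitian_diff: "hermitian X \<Longrightarrow> hermitian Y \<Longrightarrow> hermitian (X - Y)"
  and hermitian_scaleR: "hermitian X \<Longrightarrow> hermitian (r *\<^sub>R X)"
  and hermitian_mat: "hermitian (mat (complex_of_real c))"
  and hermitian_mat1: "hermitian (mat 1)"
  and hermitian_0: "hermitian 0"
  by (simp_all add: hermitian_def ctransp_add ctransp_diff ctransp_scaleR)

lemma hermitian_congr: "hermitian X \<Longrightarrow> hermitian (ctransp T ** X ** T)"
  by (simp add: hermitian_def ctransp_mult matrix_mul_assoc)

lemma matrix_diff_ldistrib: "A ** (B - C) = A ** B - A ** (C :: complex^'a^'b)"
  by (simp add: vec_eq_iff matrix_matrix_mult_def right_diff_distrib sum_subtractf)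

lemma matrix_diff_rdistrib: "(B - C) ** A = B ** A - (C :: complex^'a^'b) ** A"
  by (simp add: vec_eq_iff matrix_matrix_mult_def left_diff_distrib sum_subtractf)

lemma matrix_sum_rdistrib: "(B + C) ** A = B ** A + (C :: complex^'a^'b) ** A"
  by (simp add: vec_eq_iff matrix_matrix_mult_def distrib_right sum.distrib)

lemma matrix_mult_0 [simp]: "(0::complex^'a^'b) ** X = 0" "Y ** (0::complex^'a^'b) = 0"
  by (simp_all add: vec_eq_iff matrix_matrix_mult_def)

lemma matrix_scaleR_left: "(r *\<^sub>R X) ** Y = r *\<^sub>R (X ** (Y :: complex^'a^'b))"
  by (simp add: vec_eq_iff matrix_matrix_mult_def scaleR_sum_right)

lemma matrix_scaleR_right: "X ** (r *\<^sub>R Y) = r *\<^sub>R (X ** (Y :: complex^'a^'b))"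
  by (simp add: vec_eq_iff matrix_matrix_mult_def scaleR_sum_right)

lemmas matrix_ring = matrix_add_ldistrib matrix_sum_rdistrib matrix_diff_ldistrib
  matrix_diff_rdistrib matrix_scaleR_left matrix_scaleR_right matrix_mul_assoc

lemma mat_of_real: "mat (complex_of_real c) = c *\<^sub>R mat 1"
  by (simp add: vec_eq_iff mat_def of_real_def)

lemma scaleR_matrix_vector: "(r *\<^sub>R M) *v x = r *\<^sub>R (M *v (x :: complex^'a))"
  by (simp add: vec_eq_iff matrix_vector_mult_def scaleR_sum_right)

lemma scaleR_matrix_vector_right: "M *v (r *\<^sub>R x) = r *\<^sub>R (M *v (x :: complex^'a))"
  by (simp add: vec_eq_iff matrix_vector_mult_def scaleR_sum_right)

text \<open>The real inner product of matrices is \<open>Re (tr (X\<^sup>* Y))\<close>, so moving a factor across it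
  amounts to conjugate transposition. All traces below are handled through this rule.\<close>

lemma inner_matrix_left: "(X ** Y) \<bullet> Z = Y \<bullet> (ctransp X ** (Z :: complex^'a^'b))"
proof -
  have "(X ** Y) \<bullet> Z = (\<Sum>i\<in>UNIV. \<Sum>j\<in>UNIV. \<Sum>k\<in>UNIV. Re (cnj (X $ i $ k) * cnj (Y $ k $ j) * Z $ i $ j))"
    by (simp add: inner_vec_def matrix_matrix_mult_def inner_complex_def[symmetric] inner_sum_left)
      (simp add: inner_complex_def algebra_simps)
  also have "\<dots> = (\<Sum>j\<in>UNIV. \<Sum>k\<in>UNIV. \<Sum>i\<in>UNIV. Re (cnj (X $ i $ k) * cnj (Y $ k $ j) * Z $ i $ j))"
    by (subst sum.swap, rule sum.cong[OF refl], rule sum.swap)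
  also have "\<dots> = (\<Sum>k\<in>UNIV. \<Sum>j\<in>UNIV. \<Sum>i\<in>UNIV. Re (cnj (X $ i $ k) * cnj (Y $ k $ j) * Z $ i $ j))"
    by (rule sum.swap)
  also have "\<dots> = Y \<bullet> (ctransp X ** Z)"
    by (simp add: inner_vec_def matrix_matrix_mult_def inner_sum_right)
      (simp add: inner_complex_def algebra_simps)
  finally show ?thesis .
qed

lemma inner_ctransp: "ctransp X \<bullet> ctransp Y = X \<bullet> (Y :: complex^'a^'b)"
  by (simp add: inner_vec_def inner_complex_def) (rule sum.swap)

lemma inner_matrix_right: "(X ** Y) \<bullet> Z = X \<bullet> (Z ** ctransp (Y :: complex^'a^'b))"
proof -
  have "(X ** Y) \<bullet> Z = (ctransp Y ** ctransp X) \<bullet> ctransp Z"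
    by (metis ctransp_mult inner_ctransp)
  also have "\<dots> = ctransp X \<bullet> (Y ** ctransp Z)" by (simp add: inner_matrix_left)
  also have "\<dots> = X \<bullet> (Z ** ctransp Y)"
    by (metis ctransp_ctransp ctransp_mult inner_ctransp)
  finally show ?thesis .
qed

lemma inner_matrix_left': "Z \<bullet> (X ** Y) = (ctransp X ** Z) \<bullet> (Y :: complex^'a^'b)"
  by (metis inner_commute inner_matrix_left)

lemma inner_matrix_right': "Z \<bullet> (X ** Y) = (Z ** ctransp Y) \<bullet> (X :: complex^'a^'b)"
  by (metis inner_commute inner_matrix_right)

lemma inner_matrix_vector: "(M *v x) \<bullet> y = x \<bullet> (ctransp M *v (y :: complex^'a))"
proof -
  have "(M *v x) \<bullet> y = (\<Sum>i\<in>UNIV. \<Sum>k\<in>UNIV. Re (cnj (M $ i $ k) * cnj (x $ k) * y $ i))"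
    by (simp add: inner_vec_def matrix_vector_mult_def inner_sum_left)
      (simp add: inner_complex_def algebra_simps)
  also have "\<dots> = (\<Sum>k\<in>UNIV. \<Sum>i\<in>UNIV. Re (cnj (M $ i $ k) * cnj (x $ k) * y $ i))"
    by (rule sum.swap)
  also have "\<dots> = x \<bullet> (ctransp M *v y)"
    by (simp add: inner_vec_def matrix_vector_mult_def inner_sum_right)
      (simp add: inner_complex_def algebra_simps)
  finally show ?thesis .
qed

lemma inner_matrix_vector': "y \<bullet> (M *v x) = (ctransp M *v (y :: complex^'a)) \<bullet> x"
  by (metis inner_commute inner_matrix_vector)

lemma Re_qform: "Re (qform M x) = x \<bullet> (M *v x)"
  by (simp add: qform_def inner_vec_def inner_complex_def)

lemma Re_trace: "Re (trace M) = mat 1 \<bullet> M"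
proof -
  have "mat 1 \<bullet> M = (\<Sum>i\<in>UNIV. \<Sum>j\<in>UNIV. if i = j then Re (M $ i $ j) else 0)"
    unfolding inner_vec_def by (intro sum.cong refl) (simp add: mat_def inner_complex_def)
  then show ?thesis by (simp add: trace_def)
qed

lemma Re_trace_mult_ctransp: "Re (trace (F ** ctransp F)) = (norm F)\<^sup>2"
  by (metis Re_trace ctransp_ctransp inner_matrix_right' inner_commute matrix_mul_lid
      power2_norm_eq_inner)

lemma norm_ctransp [simp]: "norm (ctransp X) = norm X"
  by (simp add: norm_eq_sqrt_inner inner_ctransp)

lemma norm_matrix_vector: "norm (M *v x) \<le> norm M * norm (x :: complex^'a)"
proof -
  have row: "norm ((M *v x) $ i) \<le> norm (M $ i) * norm x" for i
  proof -
    have "norm ((M *v x) $ i) \<le> (\<Sum>j\<in>UNIV. \<bar>norm (M $ i $ j)\<bar> * \<bar>norm (x $ j)\<bar>)"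
      unfolding matrix_vector_mult_def by (simp add: norm_mult[symmetric] sum_norm_le)
    also have "\<dots> \<le> norm (M $ i) * norm x"
      unfolding norm_vec_def by (rule L2_set_mult_ineq)
    finally show ?thesis .
  qed
  have "norm (M *v x) \<le> L2_set (\<lambda>i. norm x * norm (M $ i)) UNIV"
    unfolding norm_vec_def[of "M *v x"] using row by (intro L2_set_mono) (auto simp: mult.commute)
  also have "\<dots> = norm M * norm x"
    by (simp add: L2_set_right_distrib[symmetric] norm_vec_def[of M])
  finally show ?thesis .
qed

lemma norm_matrix_mult: "norm (X ** Y) \<le> norm X * norm (Y :: complex^'a^'b)"
proof -
  have row: "norm ((X ** Y) $ i) \<le> norm (X $ i) * norm Y" for i
  proof -
    have "(X ** Y) $ i = (\<Sum>k\<in>UNIV. X $ i $ k *s (Y $ k))"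
      by (simp add: vec_eq_iff matrix_matrix_mult_def)
    moreover have "norm (c *s y) = norm c * norm y" for c and y :: "complex^'a"
      by (simp add: norm_vec_def norm_mult L2_set_right_distrib)
    ultimately have "norm ((X ** Y) $ i) \<le> (\<Sum>k\<in>UNIV. \<bar>norm (X $ i $ k)\<bar> * \<bar>norm (Y $ k)\<bar>)"
      by (simp add: sum_norm_le)
    also have "\<dots> \<le> norm (X $ i) * norm Y"
      unfolding norm_vec_def[of Y] norm_vec_def[of "X $ i"] by (rule L2_set_mult_ineq)
    finally show ?thesis .
  qed
  have "norm (X ** Y) \<le> L2_set (\<lambda>i. norm Y * norm (X $ i)) UNIV"
    unfolding norm_vec_def[of "X ** Y"] using row by (intro L2_set_mono) (auto simp: mult.commute)
  also have "\<dots> = norm X * norm Y"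
    by (simp add: L2_set_right_distrib[symmetric] norm_vec_def[of X])
  finally show ?thesis .
qed

lemma bounded_bilinear_matrix_mult:
  "bounded_bilinear ((**) :: complex^'a^'b \<Rightarrow> complex^'c^'a \<Rightarrow> _)"
  by (rule bounded_bilinear.intro)
    (auto simp: matrix_ring intro!: exI[of _ 1] norm_matrix_mult)

lemma bounded_linear_ctransp: "bounded_linear ctransp"
  by (rule bounded_linear_intro[of _ 1]) (auto simp: ctransp_add ctransp_scaleR)

lemma bounded_bilinear_matrix_vector:
  "bounded_bilinear ((*v) :: complex^'a^'b \<Rightarrow> complex^'a \<Rightarrow> _)"
  by (rule bounded_bilinear.intro)
    (auto simp: matrix_vector_mult_add_rdistrib matrix_vector_right_distrib scaleR_matrix_vector
      scaleR_matrix_vector_right intro!: exI[of _ 1] norm_matrix_vector)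

lemmas continuous_on_matrix_mult [continuous_intros] =
  bounded_bilinear.continuous_on[OF bounded_bilinear_matrix_mult]
lemmas continuous_on_ctransp [continuous_intros] =
  bounded_linear.continuous_on[OF bounded_linear_ctransp]
lemmas continuous_on_matrix_vector [continuous_intros] =
  bounded_bilinear.continuous_on[OF bounded_bilinear_matrix_vector]
lemmas tendsto_matrix_mult [tendsto_intros] =
  bounded_bilinear.tendsto[OF bounded_bilinear_matrix_mult]
lemmas tendsto_ctransp [tendsto_intros] =
  bounded_linear.tendsto[OF bounded_linear_ctransp]
lemmas tendsto_matrix_vector [tendsto_intros] =
  bounded_bilinear.tendsto[OF bounded_bilinear_matrix_vector]

lemma borel_measurable_matrix_mult [measurable]:
  fixes f :: "'x \<Rightarrow> complex^'a^'b" and g :: "'x \<Rightarrow> complex^'c^'a"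
  assumes "f \<in> borel_measurable M" "g \<in> borel_measurable M"
  shows "(\<lambda>x. f x ** g x) \<in> borel_measurable M"
  by (rule borel_measurable_continuous_Pair[OF assms]) (intro continuous_intros)

lemma psd_iff: "psd M \<longleftrightarrow> hermitian M \<and> (\<forall>x. 0 \<le> x \<bullet> (M *v x))"
  by (simp add: psd_def Re_qform)

lemma posdef_iff: "posdef M \<longleftrightarrow> hermitian M \<and> (\<forall>x. x \<noteq> 0 \<longrightarrow> 0 < x \<bullet> (M *v x))"
  by (simp add: posdef_def Re_qform)

lemma posdef_imp_psd: "posdef M \<Longrightarrow> psd M"
  unfolding posdef_iff psd_iff by (metis inner_zero_left less_eq_real_def)

lemma inner_mat_of_real: "x \<bullet> (mat (complex_of_real c) *v x) = c * (norm x)\<^sup>2"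
  by (simp add: mat_of_real scaleR_matrix_vector power2_norm_eq_inner)

subsection \<open>Inverses\<close>

lemma
  fixes M :: "complex^'a^'a"
  assumes "\<And>x. M *v x = 0 \<Longrightarrow> x = 0"
  shows matrix_inv_right_ker: "M ** matrix_inv M = mat 1"
    and matrix_inv_left_ker: "matrix_inv M ** M = mat 1"
proof -
  have "\<exists>N. N ** M = mat 1"
    using assms matrix_left_invertible_ker by blast
  then have "\<exists>N. M ** N = mat 1 \<and> N ** M = mat 1"
    using matrix_left_right_inverse by blast
  from someI_ex[OF this] show "M ** matrix_inv M = mat 1" "matrix_inv M ** M = mat 1"
    unfolding matrix_inv_def by auto
qed

lemma matrix_inv_unique:
  fixes M :: "complex^'a^'a"
  assumes "N ** M = mat 1"
  shows "matrix_inv M = N"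
proof -
  have "\<And>x. M *v x = 0 \<Longrightarrow> x = 0"
    using assms matrix_left_invertible_ker by blast
  from matrix_inv_right_ker[OF this] show ?thesis
    by (metis assms matrix_mul_assoc matrix_mul_lid matrix_mul_rid)
qed

lemma posdef_ker: "posdef M \<Longrightarrow> M *v x = 0 \<Longrightarrow> x = 0"
  unfolding posdef_iff by (metis inner_zero_right less_irrefl)

lemma posdef_inv_right: "posdef M \<Longrightarrow> M ** matrix_inv M = mat 1"
  by (blast intro: matrix_inv_right_ker posdef_ker)

lemma posdef_inv_left: "posdef M \<Longrightarrow> matrix_inv M ** M = mat 1"
  by (blast intro: matrix_inv_left_ker posdef_ker)

lemma hermitian_inv: "posdef M \<Longrightarrow> hermitian (matrix_inv M)"
proof -
  assume p: "posdef M"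
  then have "ctransp (matrix_inv M) ** M = ctransp (M ** matrix_inv M)"
    by (simp add: ctransp_mult hermitianD posdef_iff)
  also have "\<dots> = mat 1" by (simp add: posdef_inv_right[OF p])
  finally show "hermitian (matrix_inv M)"
    unfolding hermitian_def by (metis matrix_inv_unique)
qed

lemma posdef_inv:
  assumes "posdef M" shows "posdef (matrix_inv M)"
  unfolding posdef_iff
proof (intro conjI allI impI)
  show "hermitian (matrix_inv M)" using assms by (rule hermitian_inv)
  fix x :: "complex^'a" assume "x \<noteq> 0"
  define y where "y = matrix_inv M *v x"
  have x: "x = M *v y"
    by (simp add: y_def matrix_vector_mul_assoc posdef_inv_right[OF assms])
  with \<open>x \<noteq> 0\<close> have "y \<noteq> 0" by auto
  then have "0 < y \<bullet> (M *v y)" using assms by (simp add: posdef_iff)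
  then show "0 < x \<bullet> (matrix_inv M *v x)"
    by (metis x y_def inner_commute)
qed

text \<open>Cramer's rule, stated for the entries of the inverse because it makes them rational
  functions of the entries of \<open>M\<close>; continuity and holomorphy of inverses follow.\<close>

lemma matrix_inv_entry:
  fixes M :: "complex^'a^'a"
  assumes "det M \<noteq> 0"
  shows "matrix_inv M $ i $ j =
    det (\<chi> k l. if l = i then (if k = j then 1 else 0) else M $ k $ l) / det M"
proof -
  have "\<And>x. M *v x = 0 \<Longrightarrow> x = 0"
    using assms by (metis invertible_det_nz invertible_left_inverse matrix_left_invertible_ker)
  then have "M *v (matrix_inv M *v axis j 1) = axis j 1"
    by (simp add: matrix_vector_mul_assoc matrix_inv_right_ker)
  then have "matrix_inv M *v axis j 1 =
      (\<chi> i. det (\<chi> k l. if l = i then axis j 1 $ k else M $ k $ l) / det M)"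
    using cramer[OF assms] by blast
  moreover have "(matrix_inv M *v axis j 1) $ i = matrix_inv M $ i $ j"
    by (simp add: matrix_vector_mult_def axis_def if_distrib[of "\<lambda>x. _ * x"] sum.delta cong: if_cong)
  moreover have "axis j 1 $ k = (if k = j then 1 else (0::complex))" for k
    by (simp add: axis_def)
  ultimately show ?thesis by (simp only: vec_lambda_beta)
qed

lemma det_nonzero_iff_ker:
  fixes M :: "complex^'a^'a"
  shows "det M \<noteq> 0 \<longleftrightarrow> (\<forall>x. M *v x = 0 \<longrightarrow> x = 0)"
  by (metis invertible_det_nz invertible_left_inverse matrix_left_invertible_ker)

lemma continuous_on_det_entries:
  fixes M :: "'t::topological_space \<Rightarrow> complex^'a^'a"
  assumes "\<And>i j. continuous_on S (\<lambda>z. M z $ i $ j)"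
  shows "continuous_on S (\<lambda>z. det (M z))"
  unfolding det_def by (intro continuous_intros assms)

lemma continuous_on_matrix_inv:
  fixes M :: "'t::topological_space \<Rightarrow> complex^'a^'a"
  assumes "continuous_on S M" and "\<And>z x. z \<in> S \<Longrightarrow> M z *v x = 0 \<Longrightarrow> x = 0"
  shows "continuous_on S (\<lambda>z. matrix_inv (M z))"
proof -
  have d: "det (M z) \<noteq> 0" if "z \<in> S" for z
    unfolding det_nonzero_iff_ker using assms(2)[OF that] by simp
  have e: "continuous_on S (\<lambda>z. M z $ i $ j)" for i j
    by (intro continuous_intros assms)
  have c: "continuous_on S (\<lambda>z. (\<chi> k l. if l = i then (if k = j then 1 else 0) else M z $ k $ l) $ k $ l)"
    for i j k l :: 'a
    by (cases "l = i"; cases "k = j") (simp_all add: e)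
  have "continuous_on S (\<lambda>z. \<chi> i j.
      det (\<chi> k l. if l = i then (if k = j then 1 else 0) else M z $ k $ l) / det (M z))"
    by (intro continuous_on_vec_lambda continuous_on_divide continuous_on_det_entries e c)
      (simp add: d)
  then show ?thesis
    by (rule continuous_on_eq) (simp add: vec_eq_iff d matrix_inv_entry)
qed

section \<open>Square roots and positivity\<close>

definition coercive :: "real \<Rightarrow> complex^'a^'a \<Rightarrow> bool" where
  "coercive c M \<longleftrightarrow> hermitian M \<and> (\<forall>x. c * (norm x)\<^sup>2 \<le> x \<bullet> (M *v x))"

lemma coercive_imp_posdef: "coercive c M \<Longrightarrow> 0 < c \<Longrightarrow> posdef M"
  unfolding coercive_def posdef_iff
  by (metis less_le_trans mult_pos_pos zero_less_norm_iff zero_less_power)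

lemma coercive_mono: "coercive c M \<Longrightarrow> d \<le> c \<Longrightarrow> coercive d M"
  unfolding coercive_def by (meson mult_right_mono order_trans zero_le_power2)

lemma posdef_diff_imp_coercive:
  assumes "posdef (M - mat (complex_of_real c))" shows "coercive c M"
proof -
  have "hermitian (M - mat (complex_of_real c) + mat (complex_of_real c))"
    using assms by (intro hermitian_add hermitian_mat) (simp add: posdef_iff)
  moreover have "0 \<le> x \<bullet> ((M - mat (complex_of_real c)) *v x)" for x
    using posdef_imp_psd[OF assms] by (simp add: psd_iff)
  ultimately show ?thesis
    by (simp add: coercive_def matrix_vector_mult_diff_rdistrib inner_diff_right
        inner_mat_of_real)
qed

lemma coercive_imp_posdef_diff:
  assumes "coercive c M" "d < c" shows "posdef (M - mat (complex_of_real d))"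
  unfolding posdef_iff
proof (intro conjI allI impI)
  show "hermitian (M - mat (complex_of_real d))"
    using assms by (intro hermitian_diff hermitian_mat) (simp add: coercive_def)
  fix x :: "complex^'a" assume "x \<noteq> 0"
  then have "d * (norm x)\<^sup>2 < c * (norm x)\<^sup>2" using assms by simp
  also have "\<dots> \<le> x \<bullet> (M *v x)" using assms by (simp add: coercive_def)
  finally show "0 < x \<bullet> ((M - mat (complex_of_real d)) *v x)"
    by (simp add: matrix_vector_mult_diff_rdistrib inner_diff_right inner_mat_of_real)
qed

lemma posdef_family_uniformly_coercive:
  fixes M :: "'t::metric_space \<Rightarrow> complex^'a^'a"
  assumes "compact K" "K \<noteq> {}" "continuous_on K M" "\<And>z. z \<in> K \<Longrightarrow> posdef (M z)"
  obtains c where "0 < c" "\<And>z. z \<in> K \<Longrightarrow> coercive c (M z)"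
proof -
  let ?S = "sphere (0 :: complex^'a) 1"
  let ?f = "\<lambda>p. snd p \<bullet> (M (fst p) *v snd p)"
  have ne: "?S \<noteq> {}"
  proof -
    have "norm (axis i 1 :: complex^'a) = 1" for i
      by (simp add: norm_axis_1)
    then show ?thesis by (metis empty_iff mem_sphere_0)
  qed
  have "continuous_on (K \<times> ?S) (\<lambda>p. M (fst p))"
    by (rule continuous_on_compose2[OF assms(3)]) (auto intro: continuous_intros)
  then have cont: "continuous_on (K \<times> ?S) ?f"
    by (intro continuous_intros)
  obtain p where p: "p \<in> K \<times> ?S" "\<And>r. r \<in> K \<times> ?S \<Longrightarrow> ?f p \<le> ?f r"
    using continuous_attains_inf[OF _ _ cont] assms(1,2) ne
    by (metis compact_Times compact_sphere Sigma_empty1 Times_empty)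
  have "0 < ?f p"
  proof -
    have "snd p \<noteq> 0" "posdef (M (fst p))" using p(1) assms(4) by (auto simp: mem_Times_iff)
    then show ?thesis by (simp add: posdef_iff)
  qed
  moreover have "coercive (?f p) (M z)" if z: "z \<in> K" for z
    unfolding coercive_def
  proof (intro conjI allI)
    show "hermitian (M z)" using assms(4)[OF z] by (simp add: posdef_iff)
    fix x :: "complex^'a"
    show "?f p * (norm x)\<^sup>2 \<le> x \<bullet> (M z *v x)"
    proof (cases "x = 0")
      case False
      define u where "u = (1 / norm x) *\<^sub>R x"
      have x: "x = norm x *\<^sub>R u" and "norm u = 1" using False by (simp_all add: u_def)
      then have "?f p \<le> u \<bullet> (M z *v u)" using p(2)[of "(z, u)"] z by simp
      then have "?f p * (norm x)\<^sup>2 \<le> (u \<bullet> (M z *v u)) * (norm x)\<^sup>2"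
        by (rule mult_right_mono) simp
      also have "\<dots> = x \<bullet> (M z *v x)"
        using arg_cong[OF x, of "\<lambda>y. y \<bullet> (M z *v y)"]
        by (simp add: scaleR_matrix_vector_right power2_eq_square)
      finally show ?thesis .
    qed simp
  qed
  ultimately show thesis using that by blast
qed

lemma posdef_circle_coercive:
  fixes M :: "complex \<Rightarrow> complex^'a^'a"
  assumes "continuous_on (sphere 0 1) M" "\<And>z. cmod z = 1 \<Longrightarrow> posdef (M z)"
  obtains c where "0 < c" "\<And>z. cmod z = 1 \<Longrightarrow> coercive c (M z)"
proof -
  have "(1 :: complex) \<in> sphere 0 1" by simp
  then have "sphere 0 1 \<noteq> ({} :: complex set)" by blast
  then obtain c where "0 < c" "\<And>z. z \<in> sphere 0 1 \<Longrightarrow> coercive c (M z)"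
    using posdef_family_uniformly_coercive[OF compact_sphere _ assms(1)] assms(2)
    by (metis mem_sphere_0)
  then show thesis by (intro that) auto
qed

lemma posdef_imp_coercive:
  assumes "posdef M" obtains c where "0 < c" "coercive c M"
  using posdef_family_uniformly_coercive[of "{0::real}" "\<lambda>_. M"] assms
  by (metis compact_sing continuous_on_const insert_not_empty singletonI)

lemma coercive_upper: "x \<bullet> (M *v x) \<le> norm M * (norm x)\<^sup>2" for x :: "complex^'a"
proof -
  have "x \<bullet> (M *v x) \<le> norm x * norm (M *v x)" by (rule norm_cauchy_schwarz)
  also have "\<dots> \<le> norm x * (norm M * norm x)"
    by (intro mult_left_mono norm_matrix_vector) simp
  finally show ?thesis by (simp add: power2_eq_square ac_simps)
qed

text \<open>A Hermitian form between \<open>0\<close> and \<open>q\<close> has operator norm at most \<open>q\<close>. The bound on the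
  operator, not only on the form, is what makes the square root iteration below a contraction.\<close>

lemma hermitian_form_contraction:
  fixes S :: "complex^'a^'a"
  assumes S: "hermitian S" and q: "0 < q"
    and lo: "\<And>x. 0 \<le> x \<bullet> (S *v x)" and hi: "\<And>x. x \<bullet> (S *v x) \<le> q * (norm x)\<^sup>2"
  shows "norm (S *v x) \<le> q * norm x"
proof -
  define a where "a = S *v x"
  have sym: "a \<bullet> a = (norm a)\<^sup>2" "x \<bullet> (S *v a) = (norm a)\<^sup>2" "a \<bullet> x = x \<bullet> a"
    by (simp_all add: dot_square_norm inner_commute)
      (metis S a_def dot_square_norm hermitianD inner_matrix_vector)
  \<comment> \<open>The form at \<open>x - a / q\<close> is non-negative; for this step length the two
    quadratic terms in \<open>a\<close> combine to \<open>- (norm a)\<^sup>2 / q\<close>.\<close>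
  have "0 \<le> (x - (1 / q) *\<^sub>R a) \<bullet> (S *v (x - (1 / q) *\<^sub>R a))" by (rule lo)
  also have "\<dots> = x \<bullet> (S *v x) - 2 / q * (norm a)\<^sup>2 + (1 / q)\<^sup>2 * (a \<bullet> (S *v a))"
    by (simp add: matrix_vector_mult_diff_distrib inner_diff_left inner_diff_right
        scaleR_matrix_vector_right a_def[symmetric] sym power2_eq_square[of "1 / q"] diff_divide_distrib)
  also have "\<dots> \<le> q * (norm x)\<^sup>2 - 2 / q * (norm a)\<^sup>2 + (1 / q)\<^sup>2 * (q * (norm a)\<^sup>2)"
    by (intro add_mono diff_mono mult_left_mono hi order_refl) simp
  also have "\<dots> = q * (norm x)\<^sup>2 - (norm a)\<^sup>2 / q"
    using q by (simp add: field_simps power2_eq_square)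
  finally have "(norm a)\<^sup>2 \<le> (q * norm x)\<^sup>2"
    using q by (simp add: field_simps power2_eq_square)
  then show ?thesis
    using q by (simp add: a_def power2_le_iff_abs_le)
qed

subsection \<open>A measurable square root\<close>

text \<open>The fixed point \<open>Y\<close> of \<open>Y \<mapsto> (S + Y\<^sup>2) / 2\<close> satisfies \<open>(1 - Y)\<^sup>2 = 1 - S\<close>. The iterates
  are polynomials in \<open>S\<close>, so the limit depends measurably on \<open>S\<close>.\<close>

primrec sqrt_iter :: "complex^'a^'a \<Rightarrow> nat \<Rightarrow> complex^'a^'a" where
  "sqrt_iter S 0 = 0"
| "sqrt_iter S (Suc k) = (1 / 2) *\<^sub>R (S + sqrt_iter S k ** sqrt_iter S k)"

lemma hermitian_sqrt_iter: "hermitian S \<Longrightarrow> hermitian (sqrt_iter S k)"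
  by (induction k)
    (simp_all add: hermitian_0 hermitian_def ctransp_scaleR ctransp_add ctransp_mult)

text \<open>The Frobenius norm of a matrix of small operator norm need not be less than one, so the
  iteration is estimated in operator norm; this crude comparison transfers convergence.\<close>

lemma norm_le_operator_bound:
  fixes M :: "complex^'a^'b"
  assumes "\<And>x. norm (M *v x) \<le> r * norm x"
  shows "norm M \<le> real (CARD('b) * CARD('a)) * r"
proof -
  have e: "norm (M $ i $ j) \<le> r" for i j
  proof -
    have "M $ i $ j = (M *v axis j 1) $ i"
      by (simp add: matrix_vector_mult_def axis_def if_distrib[of "\<lambda>x. _ * x"] cong: if_cong)
    then have "norm (M $ i $ j) \<le> norm (M *v axis j 1)"
      using Finite_Cartesian_Product.norm_nth_le[of "M *v axis j 1" i] by simp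
    also have "\<dots> \<le> r" using assms[of "axis j 1"] by (simp add: norm_axis_1)
    finally show ?thesis .
  qed
  have "norm M \<le> (\<Sum>i\<in>UNIV. norm (M $ i))" unfolding norm_vec_def by (rule L2_set_le_sum) simp
  also have "\<dots> \<le> (\<Sum>i\<in>(UNIV::'b set). \<Sum>j\<in>(UNIV::'a set). r)"
  proof (rule sum_mono)
    fix i
    have "norm (M $ i) \<le> (\<Sum>j\<in>UNIV. norm (M $ i $ j))"
      unfolding norm_vec_def[of "M $ i"] by (rule L2_set_le_sum) simp
    also have "\<dots> \<le> (\<Sum>j\<in>(UNIV::'a set). r)" by (intro sum_mono e)
    finally show "norm (M $ i) \<le> (\<Sum>j\<in>(UNIV::'a set). r)" .
  qed
  finally show ?thesis by simp
qed

lemma sqrt_iter_converges: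
  fixes S :: "complex^'a^'a"
  assumes S: "\<And>x. norm (S *v x) \<le> q * norm x" and q: "0 \<le> q" "q < 1"
  shows "convergent (sqrt_iter S)"
proof -
  \<comment> \<open>\<open>\<rho>\<close> is the smaller root of \<open>(q + \<rho>\<^sup>2) / 2 = \<rho>\<close>: the ball of radius \<open>\<rho>\<close> is
    mapped into itself, and the map contracts by the factor \<open>\<rho>\<close> there.\<close>
  define \<rho> where "\<rho> = 1 - sqrt (1 - q)"
  have \<rho>: "0 \<le> \<rho>" "\<rho> < 1" "(q + \<rho> * \<rho>) / 2 = \<rho>"
  proof -
    show "0 \<le> \<rho>" "\<rho> < 1" using q by (auto simp: \<rho>_def)
    define s where "s = sqrt (1 - q)"
    have "s * s = 1 - q" using q unfolding s_def by (intro real_sqrt_mult_self[THEN trans]) simp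
    then show "(q + \<rho> * \<rho>) / 2 = \<rho>" by (simp add: \<rho>_def s_def[symmetric] field_simps)
  qed
  let ?Y = "sqrt_iter S"
  have b: "norm (?Y k *v x) \<le> \<rho> * norm x" for k x
  proof (induction k arbitrary: x)
    case (Suc k)
    have "norm (?Y (Suc k) *v x) = norm (S *v x + ?Y k *v (?Y k *v x)) / 2"
      by (simp add: scaleR_matrix_vector matrix_vector_mult_add_rdistrib matrix_vector_mul_assoc)
    also have "norm (S *v x + ?Y k *v (?Y k *v x)) \<le> q * norm x + \<rho> * norm (?Y k *v x)"
      using S Suc.IH by (intro order_trans[OF norm_triangle_ineq] add_mono) auto
    also have "\<dots> \<le> q * norm x + \<rho> * (\<rho> * norm x)"
      by (intro add_left_mono mult_left_mono Suc.IH \<rho>(1))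
    also have "(q * norm x + \<rho> * (\<rho> * norm x)) / 2 = (q + \<rho> * \<rho>) / 2 * norm x"
      by (simp add: algebra_simps)
    finally show ?case using \<rho>(3) by simp
  qed (simp add: \<rho>)
  have d: "norm ((?Y (Suc k) - ?Y k) *v x) \<le> \<rho> ^ k * q * norm x" for k x
  proof (induction k arbitrary: x)
    case 0
    have "norm (S *v x) / 2 \<le> norm (S *v x)" by simp
    also have "\<dots> \<le> q * norm x" by (rule S)
    finally show ?case by (simp add: scaleR_matrix_vector)
  next
    case (Suc k)
    define D where "D = ?Y (Suc k) - ?Y k"
    have "?Y (Suc (Suc k)) - ?Y (Suc k) =
        (1 / 2) *\<^sub>R (S + ?Y (Suc k) ** ?Y (Suc k)) - (1 / 2) *\<^sub>R (S + ?Y k ** ?Y k)"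
      by (rule arg_cong2[where f = "(-)"]) (rule sqrt_iter.simps)+
    also have "\<dots> = (1 / 2) *\<^sub>R (?Y (Suc k) ** ?Y (Suc k) - ?Y k ** ?Y k)"
      by (simp only: scaleR_right_diff_distrib[symmetric] add_diff_cancel_left)
    also have "?Y (Suc k) ** ?Y (Suc k) - ?Y k ** ?Y k = ?Y (Suc k) ** D + D ** ?Y k"
      by (simp add: D_def matrix_ring del: sqrt_iter.simps)
    finally have "?Y (Suc (Suc k)) - ?Y (Suc k) = (1 / 2) *\<^sub>R (?Y (Suc k) ** D + D ** ?Y k)" .
    then have "norm ((?Y (Suc (Suc k)) - ?Y (Suc k)) *v x) =
        norm (?Y (Suc k) *v (D *v x) + D *v (?Y k *v x)) / 2"
      by (simp add: scaleR_matrix_vector matrix_vector_mult_add_rdistrib matrix_vector_mul_assoc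
          del: sqrt_iter.simps)
    also have "norm (?Y (Suc k) *v (D *v x) + D *v (?Y k *v x)) \<le>
        \<rho> * norm (D *v x) + \<rho> ^ k * q * norm (?Y k *v x)"
      using b[of "Suc k"] Suc.IH unfolding D_def[symmetric]
      by (intro order_trans[OF norm_triangle_ineq] add_mono)
    also have "\<dots> \<le> \<rho> * (\<rho> ^ k * q * norm x) + \<rho> ^ k * q * (\<rho> * norm x)"
      using Suc.IH[of x] b[of k x] \<rho>(1,2) q unfolding D_def[symmetric]
      by (intro add_mono mult_left_mono) auto
    finally show ?case by (simp add: algebra_simps)
  qed
  have n: "norm (?Y (Suc k) - ?Y k) \<le> real (CARD('a) * CARD('a)) * (\<rho> ^ k * q)" for k
    by (rule norm_le_operator_bound) (rule d)
  have "summable (\<lambda>k. \<rho> ^ k)" by (rule summable_geometric) (simp add: \<rho>(1,2))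
  then have "summable (\<lambda>k. (real (CARD('a) * CARD('a)) * q) * \<rho> ^ k)" by (rule summable_mult)
  moreover have "norm (?Y (Suc k) - ?Y k) \<le> (real (CARD('a) * CARD('a)) * q) * \<rho> ^ k" for k
    using n[of k] by (simp only: ac_simps)
  ultimately have "summable (\<lambda>k. ?Y (Suc k) - ?Y k)"
    by (rule summable_comparison_test')
  then have "convergent (\<lambda>n. \<Sum>k<n. ?Y (Suc k) - ?Y k)"
    by (rule summable_iff_convergent[THEN iffD1])
  moreover have "(\<Sum>k<n. ?Y (Suc k) - ?Y k) = ?Y n" for n
    by (subst sum_lessThan_telescope) simp
  ultimately show ?thesis by simp
qed

text \<open>The parameter \<open>b\<close> bounds the norm of \<open>M\<close> and brings the spectrum of \<open>M / b\<close> into the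
  unit interval. Choosing \<open>b\<close> uniformly over a family makes the root measurable.\<close>

definition herm_sqrt :: "real \<Rightarrow> complex^'a^'a \<Rightarrow> complex^'a^'a" where
  "herm_sqrt b M = sqrt b *\<^sub>R (mat 1 - lim (sqrt_iter (mat 1 - (1 / b) *\<^sub>R M)))"

lemma herm_sqrt:
  fixes M :: "complex^'a^'a"
  assumes M: "coercive c M" and c: "0 < c" and b: "norm M \<le> b"
  shows "hermitian (herm_sqrt b M)" and "herm_sqrt b M ** herm_sqrt b M = M"
proof -
  have hM: "hermitian M" using M by (simp add: coercive_def)
  define u where "u = (axis undefined 1 :: complex^'a)"
  have "c * (norm u)\<^sup>2 \<le> u \<bullet> (M *v u)" using M by (simp add: coercive_def)
  also have "\<dots> \<le> norm M * (norm u)\<^sup>2" by (rule coercive_upper)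
  finally have cb: "c \<le> b" using b by (simp add: u_def norm_axis_1)
  then have b0: "0 < b" using c by simp
  define S where "S = mat 1 - (1 / b) *\<^sub>R M"
  define q where "q = 1 - c / (2 * b)"
  have q: "0 < q" "q < 1" using cb c b0 by (auto simp: q_def field_simps)
  have hS: "hermitian S" unfolding S_def by (intro hermitian_diff hermitian_mat1 hermitian_scaleR hM)
  have form: "x \<bullet> (S *v x) = (norm x)\<^sup>2 - (x \<bullet> (M *v x)) / b" for x
    by (simp add: S_def matrix_vector_mult_diff_rdistrib scaleR_matrix_vector inner_diff_right
        power2_norm_eq_inner)
  have "norm (S *v x) \<le> q * norm x" for x
  proof (rule hermitian_form_contraction[OF hS q(1)])
    fix x :: "complex^'a"
    have "x \<bullet> (M *v x) \<le> b * (norm x)\<^sup>2"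
      by (rule order_trans[OF coercive_upper]) (simp add: b mult_right_mono)
    then show "0 \<le> x \<bullet> (S *v x)" using b0 by (simp add: form field_simps)
    have "c / 2 * (norm x)\<^sup>2 \<le> c * (norm x)\<^sup>2" using c by (intro mult_right_mono) auto
    also have "\<dots> \<le> x \<bullet> (M *v x)" using M by (simp add: coercive_def)
    finally show "x \<bullet> (S *v x) \<le> q * (norm x)\<^sup>2"
      using b0 by (simp add: form q_def field_simps)
  qed
  then have "convergent (sqrt_iter S)" using q by (intro sqrt_iter_converges) auto
  then obtain Y where Y: "sqrt_iter S \<longlonglongrightarrow> Y" by (auto simp: convergent_def)
  have "(\<lambda>k. sqrt_iter S (Suc k)) \<longlonglongrightarrow> (1 / 2) *\<^sub>R (S + Y ** Y)"
    unfolding sqrt_iter.simps by (intro tendsto_intros Y)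
  then have fix_pt: "Y = (1 / 2) *\<^sub>R (S + Y ** Y)"
    by (rule LIMSEQ_unique[OF LIMSEQ_Suc[OF Y]])
  have "2 *\<^sub>R Y = 2 *\<^sub>R ((1 / 2) *\<^sub>R (S + Y ** Y))" using fix_pt by (rule arg_cong)
  then have YY: "Y ** Y = Y + Y - S" by (simp add: scaleR_2)
  have sq: "(mat 1 - Y) ** (mat 1 - Y) = mat 1 - S"
    by (simp add: matrix_diff_ldistrib matrix_diff_rdistrib YY)
  have "(\<lambda>k. ctransp (sqrt_iter S k)) \<longlonglongrightarrow> ctransp Y" by (intro tendsto_intros Y)
  then have "ctransp Y = Y"
    using Y hermitian_sqrt_iter[OF hS] by (simp add: hermitian_def LIMSEQ_unique)
  then have hY: "hermitian (mat 1 - Y)"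
    by (intro hermitian_diff hermitian_mat1) (simp add: hermitian_def)
  have eq: "herm_sqrt b M = sqrt b *\<^sub>R (mat 1 - Y)"
    using limI[OF Y] by (simp add: herm_sqrt_def S_def)
  show "hermitian (herm_sqrt b M)" unfolding eq by (intro hermitian_scaleR hY)
  show "herm_sqrt b M ** herm_sqrt b M = M"
    unfolding eq using b0 by (simp add: matrix_scaleR_left matrix_scaleR_right sq S_def)
qed

lemma borel_measurable_herm_sqrt:
  fixes F :: "'t \<Rightarrow> complex^'a^'a"
  assumes [measurable]: "F \<in> borel_measurable N"
  shows "(\<lambda>x. herm_sqrt b (F x)) \<in> borel_measurable N"
proof -
  have [measurable]: "(\<lambda>x. sqrt_iter (mat 1 - (1 / b) *\<^sub>R F x) k) \<in> borel_measurable N" for k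
    by (induction k) simp_all
  have [measurable]: "(\<lambda>x. lim (\<lambda>k. sqrt_iter (mat 1 - (1 / b) *\<^sub>R F x) k)) \<in> borel_measurable N"
    by (rule borel_measurable_lim_metric) measurable
  show ?thesis unfolding herm_sqrt_def by measurable
qed

lemma posdef_sqrt_exists:
  assumes "posdef M" obtains W where "hermitian W" "W ** W = M"
proof -
  obtain c where "0 < c" "coercive c M" using assms by (rule posdef_imp_coercive)
  from herm_sqrt[OF this(2,1) order_refl] show thesis by (rule that)
qed

subsection \<open>Trace inequalities\<close>

lemma inner_columns: "X \<bullet> Y = (\<Sum>j\<in>UNIV. column j X \<bullet> column j (Y :: complex^'a^'b))"
  by (simp add: inner_vec_def column_def) (rule sum.swap)

lemma column_matrix_mult: "column j (X ** Y) = X *v column j Y"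
  by (simp add: vec_eq_iff column_def matrix_matrix_mult_def matrix_vector_mult_def)

text \<open>Each column of \<open>W\<close> contributes one value of the form of \<open>Q\<close>.\<close>

lemma inner_congr_ge:
  assumes "\<And>x. c * (norm x)\<^sup>2 \<le> x \<bullet> (Q *v x)"
  shows "c * (norm W)\<^sup>2 \<le> W \<bullet> (Q ** (W :: complex^'a^'b))"
proof -
  have "c * (norm W)\<^sup>2 = (\<Sum>j\<in>UNIV. c * (norm (column j W))\<^sup>2)"
    by (simp add: power2_norm_eq_inner inner_columns[of W W] sum_distrib_left)
  also have "\<dots> \<le> (\<Sum>j\<in>UNIV. column j W \<bullet> (Q *v column j W))" by (intro sum_mono assms)
  also have "\<dots> = W \<bullet> (Q ** W)" by (simp add: inner_columns[of W] column_matrix_mult)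
  finally show ?thesis .
qed

lemma inner_hermitian_square: "hermitian W \<Longrightarrow> M \<bullet> (W ** W) = W \<bullet> (M ** W)"
  by (subst inner_matrix_right') (simp add: hermitianD inner_commute)

lemma trace_hermitian_square: "hermitian W \<Longrightarrow> mat 1 \<bullet> (W ** W) = (norm W)\<^sup>2"
  by (simp add: inner_hermitian_square power2_norm_eq_inner)

lemma inner_coercive_ge:
  assumes "\<And>x. c * (norm x)\<^sup>2 \<le> x \<bullet> (M *v x)" and "posdef P"
  shows "c * (mat 1 \<bullet> P) \<le> M \<bullet> P"
proof -
  obtain W where W: "hermitian W" "W ** W = P" using assms(2) by (rule posdef_sqrt_exists)
  have "c * (norm W)\<^sup>2 \<le> W \<bullet> (M ** W)" using assms(1) by (rule inner_congr_ge)
  then show ?thesis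
    unfolding W(2)[symmetric] inner_hermitian_square[OF W(1), of M] trace_hermitian_square[OF W(1)] .
qed

lemma inner_psd_nonneg: "psd M \<Longrightarrow> posdef P \<Longrightarrow> 0 \<le> M \<bullet> P"
  using inner_coercive_ge[of 0 M P] by (simp add: psd_iff)

lemma norm_le_trace:
  assumes "posdef P" shows "norm P \<le> mat 1 \<bullet> P"
proof -
  obtain W where W: "hermitian W" "W ** W = P" using assms by (rule posdef_sqrt_exists)
  have "norm (W ** W) \<le> mat 1 \<bullet> (W ** W)"
    using norm_matrix_mult[of W W]
    by (simp add: trace_hermitian_square[OF W(1)] power2_eq_square[of "norm W"])
  then show ?thesis unfolding W(2) .
qed

lemma norm_inv_le:
  fixes M :: "complex^'a^'a"
  assumes "coercive c M" "0 < c"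
  shows "norm (matrix_inv M) \<le> norm (mat 1 :: complex^'a^'a) / c"
proof -
  let ?W = "matrix_inv M"
  have pd: "posdef M" using assms by (rule coercive_imp_posdef)
  have "c * (norm ?W)\<^sup>2 \<le> ?W \<bullet> (M ** ?W)"
    using assms by (intro inner_congr_ge) (simp add: coercive_def)
  also have "\<dots> \<le> norm ?W * norm (mat 1 :: complex^'a^'a)"
    unfolding posdef_inv_right[OF pd] by (rule norm_cauchy_schwarz)
  finally have "norm ?W * (c * norm ?W) \<le> norm ?W * norm (mat 1 :: complex^'a^'a)"
    by (simp add: power2_eq_square ac_simps)
  then show ?thesis using \<open>0 < c\<close>
    by (cases "norm ?W = 0") (auto simp: field_simps)
qed

text \<open>Cauchy--Schwarz for the vectors \<open>Q\<^sup>1\<^sup>/\<^sup>2 v\<close> and \<open>Q\<^sup>-\<^sup>1\<^sup>/\<^sup>2 v\<close>, proved without the roots.\<close>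

lemma inv_form_ge:
  fixes Q :: "complex^'a^'a"
  assumes Q: "posdef Q" and v: "norm v = 1"
  shows "1 / (v \<bullet> (Q *v v)) \<le> v \<bullet> (matrix_inv Q *v v)"
proof -
  define r where "r = v \<bullet> (Q *v v)"
  have "v \<noteq> 0" using v by auto
  then have r: "0 < r" using Q by (simp add: r_def posdef_iff)
  have h: "ctransp (matrix_inv Q) = matrix_inv Q" using hermitian_inv[OF Q] by (rule hermitianD)
  have vv: "v \<bullet> v = 1" using v by (simp add: power2_norm_eq_inner[symmetric])
  have inv: "matrix_inv Q *v (Q *v v) = v"
    by (simp add: matrix_vector_mul_assoc posdef_inv_left[OF Q])
  have "(Q *v v) \<bullet> (matrix_inv Q *v v) = 1"
    using inner_matrix_vector'[of "Q *v v" "matrix_inv Q" v] vv by (simp add: h inv)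
  \<comment> \<open>The form of the inverse is non-negative at \<open>v - Q v / r\<close>.\<close>
  moreover have "0 \<le> (v - (1 / r) *\<^sub>R (Q *v v)) \<bullet> (matrix_inv Q *v (v - (1 / r) *\<^sub>R (Q *v v)))"
    using posdef_imp_psd[OF posdef_inv[OF Q]] by (simp add: psd_iff)
  moreover have "(Q *v v) \<bullet> v = r" by (simp add: r_def inner_commute)
  ultimately have "0 \<le> v \<bullet> (matrix_inv Q *v v) - 2 / r + 1 / r"
    using r vv by (simp add: matrix_vector_mult_diff_distrib scaleR_matrix_vector_right inv
        inner_diff_left inner_diff_right divide_simps)
  then show ?thesis by (simp add: r_def)
qed

lemma inv_trace_ge:
  fixes Q :: "complex^'a^'a"
  assumes Q: "posdef Q" and v: "norm v = 1"
  shows "1 / (v \<bullet> (Q *v v)) \<le> mat 1 \<bullet> matrix_inv Q"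
proof -
  have "1 / (v \<bullet> (Q *v v)) \<le> v \<bullet> (matrix_inv Q *v v)" using assms by (rule inv_form_ge)
  also have "\<dots> \<le> norm (matrix_inv Q)" using coercive_upper[of v "matrix_inv Q"] v by simp
  also have "\<dots> \<le> mat 1 \<bullet> matrix_inv Q" by (intro norm_le_trace posdef_inv Q)
  finally show ?thesis .
qed

section \<open>The bordered matrix\<close>

text \<open>Rank--nullity: a basis \<open>C\<close> of the kernel is extended to a basis \<open>D\<close> of the whole space, and
  \<open>M\<close> is injective on the span of \<open>D - C\<close>.\<close>

lemma dim_range_plus_dim_kernel:
  fixes M :: "complex^'n^'m"
  shows "vec.dim (range ((*v) M)) + vec.dim {x. M *v x = 0} = CARD('n)"
proof -
  let ?K = "{x. M *v x = 0}"
  have lin: "Vector_Spaces.linear (*s) (*s) ((*v) M)" by (rule matrix_vector_mul_linear_gen)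
  obtain C where C: "C \<subseteq> ?K" "vec.independent C" "?K \<subseteq> vec.span C" "card C = vec.dim ?K"
    by (rule vec.basis_exists)
  obtain D where D: "C \<subseteq> D" "vec.independent D" "vec.span D = UNIV"
    by (metis C(2) vec.extend_basis_superset vec.independent_extend_basis vec.span_extend_basis)
  have finD: "finite D" using D(2) by (rule vec.finiteI_independent)
  have cardD: "card D = CARD('n)"
    using D by (metis vec.dim_UNIV vec.dim_eq_card vec.dimension_def vec_dim_card vec.span_UNIV)
  have "inj_on ((*v) M) (vec.span (D - C))"
  proof (rule inj_onI)
    fix x y assume xy: "x \<in> vec.span (D - C)" "y \<in> vec.span (D - C)" "M *v x = M *v y"
    then have "x - y \<in> vec.span C"
      using C(3) by (auto simp: matrix_vector_mult_diff_distrib)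
    then obtain s where s: "x - y = (\<Sum>b\<in>C. s b *s b)"
      using vec.span_finite[of C] finite_subset[OF D(1) finD] by auto
    have "x - y \<in> vec.span (D - C)" using xy by (intro vec.span_diff)
    then obtain r where r: "x - y = (\<Sum>b\<in>D - C. r b *s b)"
      using vec.span_finite[of "D - C"] finD by auto
    let ?u = "\<lambda>b. if b \<in> C then s b else - r b"
    have "(\<Sum>b\<in>D. ?u b *s b) = (\<Sum>b\<in>D - C. ?u b *s b) + (\<Sum>b\<in>C. ?u b *s b)"
      using D(1) finD by (rule sum.subset_diff)
    also have "(\<Sum>b\<in>D - C. ?u b *s b) = - (x - y)"
      unfolding r sum_negf[symmetric] by (intro sum.cong) auto
    also have "(\<Sum>b\<in>C. ?u b *s b) = x - y"
      unfolding s by (intro sum.cong) auto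
    finally have "(\<Sum>b\<in>D. ?u b *s b) = 0" by simp
    then have "s b = 0" if "b \<in> C" for b
      using vec.independentD[OF D(2) finD order_refl, of ?u b] that D(1) by auto
    then show "x = y" using s by simp
  qed
  then have "vec.dim ((*v) M ` (D - C)) = vec.dim (D - C)"
    by (rule vec.dim_image_eq[OF lin])
  also have "vec.dim (D - C) = card (D - C)"
    using D(2) by (intro vec.dim_eq_card_independent) (meson Diff_subset vec.independent_mono)
  finally have d: "vec.dim ((*v) M ` (D - C)) = card (D - C)" .
  have "range ((*v) M) = vec.span ((*v) M ` D)"
    using vec.linear_span_image[OF lin, of D] D(3) by simp
  also have "vec.span ((*v) M ` D) = vec.span ((*v) M ` (D - C))"
  proof (rule vec.span_eq[THEN iffD2], intro conjI subsetI)
    fix y assume "y \<in> (*v) M ` D"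
    then obtain x where "x \<in> D" "y = M *v x" by auto
    then show "y \<in> vec.span ((*v) M ` (D - C))"
      using subsetD[OF C(1), of x]
      by (cases "x \<in> C") (auto intro: vec.span_base vec.span_zero)
  qed (auto intro: vec.span_base)
  finally have "vec.dim (range ((*v) M)) = card (D - C)" using d by simp
  moreover have "card (D - C) + card C = card D"
    using D(1) finD by (metis card_Diff_subset card_mono finite_subset le_add_diff_inverse2)
  ultimately show ?thesis using C(4) cardD by simp
qed

lemma rank_eq_dim_range_transpose: "rank M = vec.dim (range ((*v) (transpose M)))"
  for M :: "complex^'n^'m"
proof -
  have "vec.span (columns N) = range ((*v) N)" for N :: "complex^'m^'n"
  proof
    have "column j N = N *v axis j 1" for j
      by (simp add: vec_eq_iff column_def matrix_vector_mult_def axis_def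
          if_distrib[of "\<lambda>x. _ * x"] cong: if_cong)
    then have "columns N \<subseteq> range ((*v) N)" by (auto simp: columns_def)
    moreover have "vec.subspace (range ((*v) N))"
      by (rule vec.linear_subspace_image[OF matrix_vector_mul_linear_gen vec.subspace_UNIV])
    ultimately show "vec.span (columns N) \<subseteq> range ((*v) N)" by (rule vec.span_minimal)
    show "range ((*v) N) \<subseteq> vec.span (columns N)"
      using matrix_vector_mult_in_columnspace_gen by blast
  qed
  then show ?thesis
    by (metis row_rank_def_gen columns_transpose vec.dim_span)
qed

lemma full_column_rank_inj:
  fixes B :: "complex^'m^'n"
  assumes "rank B = CARD('m)" and "B *v x = 0"
  shows "x = 0"
proof -
  have "vec.dim (range ((*v) (transpose B))) = CARD('m)"
    using assms(1) by (simp add: rank_eq_dim_range_transpose)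
  moreover have "vec.subspace (range ((*v) (transpose B)))"
    by (rule vec.linear_subspace_image[OF matrix_vector_mul_linear_gen vec.subspace_UNIV])
  ultimately have "range ((*v) (transpose B)) = UNIV"
    by (intro vec.subspace_dim_equal) (auto simp: vec.subspace_UNIV vec_dim_card card_cart_basis)
  then obtain X where "transpose B ** X = mat 1"
    using matrix_right_invertible_surjective by blast
  then have "transpose X ** B = mat 1"
    by (metis matrix_transpose_mul transpose_mat transpose_transpose)
  then show ?thesis using assms(2) matrix_left_invertible_ker by blast
qed

definition top_part :: "complex^('n::finite + 'm::finite) \<Rightarrow> complex^'n" where
  "top_part v = (\<chi> a. v $ Inl a)"

definition bottom_part :: "complex^('n::finite + 'm::finite) \<Rightarrow> complex^'m" where
  "bottom_part v = (\<chi> b. v $ Inr b)"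

lemma vec_eq_parts_iff: "v = w \<longleftrightarrow> top_part v = top_part w \<and> bottom_part v = bottom_part w"
  by (auto simp: top_part_def bottom_part_def vec_eq_iff split_sum_all)

lemma sum_UNIV_sum_type:
  "(\<Sum>s\<in>(UNIV :: ('n::finite + 'm::finite) set). f s) = (\<Sum>a\<in>UNIV. f (Inl a)) + (\<Sum>b\<in>UNIV. f (Inr b))"
  by (simp add: UNIV_Plus_UNIV[symmetric] sum.Plus o_def del: UNIV_Plus_UNIV)

lemma
  fixes P :: "complex^'n^'n"
  shows top_part_block: "top_part (block_matrix P Q R S *v v) = P *v top_part v + Q *v bottom_part v"
    and bottom_part_block: "bottom_part (block_matrix P Q R S *v v) = R *v top_part v + S *v bottom_part v"
  by (simp_all add: top_part_def bottom_part_def block_matrix_def vec_eq_iff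
      matrix_vector_mult_def sum_UNIV_sum_type)

lemma transpose_block_matrix:
  "transpose (block_matrix P Q R S) =
    block_matrix (transpose P) (transpose R) (transpose Q) (transpose S)"
  by (auto simp: vec_eq_iff transpose_def block_matrix_def split: sum.split)

text \<open>Row operations are avoided: the rank is the dimension of the range of the transpose, and the
  kernel of the transpose projects injectively to its upper component, onto those \<open>x\<close> in the kernel
  of \<open>B\<^sup>T\<close> that \<open>P\<^sup>T\<close> maps into the range of \<open>C\<^sup>T\<close>. The rank is \<open>2m\<close> exactly when this subspace
  has full dimension \<open>n - m\<close>, that is, when it is the whole kernel of \<open>B\<^sup>T\<close>.\<close>

lemma rank_bordered:
  fixes P :: "complex^'n^'n" and B :: "complex^'m^'n" and C :: "complex^'n^'m"
  assumes B: "rank B = CARD('m)" and C: "\<And>u. transpose C *v u = 0 \<Longrightarrow> u = 0"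
  shows "rank (block_matrix P B C 0) = 2 * CARD('m) \<longleftrightarrow>
    (\<forall>x. transpose B *v x = 0 \<longrightarrow> (\<exists>u. transpose P *v x + transpose C *v u = 0))"
proof -
  let ?N = "transpose (block_matrix P B C 0)"
  let ?K = "{x. transpose B *v x = 0}"
  let ?L = "{x. transpose B *v x = 0 \<and> (\<exists>u. transpose P *v x + transpose C *v u = 0)}"
  have N: "?N *v v = 0 \<longleftrightarrow> transpose P *v top_part v + transpose C *v bottom_part v = 0 \<and>
      transpose B *v top_part v = 0" for v
    by (subst vec_eq_parts_iff)
      (auto simp: transpose_block_matrix top_part_block bottom_part_block,
        simp_all add: top_part_def bottom_part_def vec_eq_iff transpose_def matrix_vector_mult_def)
  have lin: "Vector_Spaces.linear (*s) (*s) (top_part :: complex^('n + 'm) \<Rightarrow> _)"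
    by unfold_locales (simp_all add: top_part_def vec_eq_iff)
  have sub: "vec.subspace {v. ?N *v v = 0}"
    by (rule vec.linear_subspace_kernel[OF matrix_vector_mul_linear_gen])
  have "inj_on top_part {v. ?N *v v = 0}"
  proof (rule inj_onI)
    fix v w assume vw: "v \<in> {v. ?N *v v = 0}" "w \<in> {v. ?N *v v = 0}" "top_part v = top_part w"
    then have "transpose C *v bottom_part v = transpose C *v bottom_part w"
      unfolding mem_Collect_eq N by (metis add_left_cancel)
    then have "bottom_part v = bottom_part w"
      using C[of "bottom_part v - bottom_part w"] by (simp add: matrix_vector_mult_diff_distrib)
    then show "v = w" using vw(3) vec_eq_parts_iff by blast
  qed
  then have "vec.dim (top_part ` {v. ?N *v v = 0}) = vec.dim {v. ?N *v v = 0}"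
    using vec.dim_image_eq[OF lin] sub by (metis vec.span_eq_iff)
  moreover have "top_part ` {v. ?N *v v = 0} = ?L"
  proof (intro equalityI subsetI)
    fix x assume "x \<in> ?L"
    then obtain u where u: "transpose B *v x = 0" "transpose P *v x + transpose C *v u = 0" by auto
    define v where "v = (\<chi> s. case s of Inl a \<Rightarrow> x $ a | Inr b \<Rightarrow> u $ b)"
    have "top_part v = x" "bottom_part v = u"
      by (simp_all add: v_def top_part_def bottom_part_def vec_eq_iff)
    then show "x \<in> top_part ` {v. ?N *v v = 0}" using u N by blast
  qed (use N in auto)
  ultimately have dL: "vec.dim ?L = vec.dim {v. ?N *v v = 0}" by simp
  have "rank (block_matrix P B C 0) + vec.dim ?L = CARD('n) + CARD('m)"
    using dim_range_plus_dim_kernel[of ?N] dL by (simp add: rank_eq_dim_range_transpose)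
  moreover have "CARD('m) + vec.dim ?K = CARD('n)"
    using dim_range_plus_dim_kernel[of "transpose B"] B by (simp add: rank_eq_dim_range_transpose)
  ultimately have "rank (block_matrix P B C 0) = 2 * CARD('m) \<longleftrightarrow> vec.dim ?L = vec.dim ?K"
    by linarith
  also have "\<dots> \<longleftrightarrow> ?L = ?K"
  proof
    assume "vec.dim ?L = vec.dim ?K"
    moreover have "vec.subspace ?L"
      unfolding \<open>top_part ` _ = ?L\<close>[symmetric] by (rule vec.linear_subspace_image[OF lin sub])
    moreover have "vec.subspace ?K"
      by (rule vec.linear_subspace_kernel[OF matrix_vector_mul_linear_gen])
    ultimately show "?L = ?K" by (intro vec.subspace_dim_equal) auto
  qed simp
  also have "\<dots> \<longleftrightarrow> (\<forall>x. transpose B *v x = 0 \<longrightarrow> (\<exists>u. transpose P *v x + transpose C *v u = 0))"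
    by auto
  finally show ?thesis .
qed

lemma cnj_matrix_vector:
  "(\<chi> i. cnj ((M *v x) $ i)) = transpose (ctransp M) *v (\<chi> i. cnj (x $ i))"
  by (simp add: vec_eq_iff matrix_vector_mult_def transpose_def)

lemma gram_posdef:
  fixes B :: "complex^'m^'n"
  assumes "\<And>x. B *v x = 0 \<Longrightarrow> x = 0"
  shows "posdef (ctransp B ** B)"
  unfolding posdef_iff
proof (intro conjI allI impI)
  show "hermitian (ctransp B ** B)" by (simp add: hermitian_def ctransp_mult)
  fix x :: "complex^'m" assume "x \<noteq> 0"
  then have "0 < (B *v x) \<bullet> (B *v x)" using assms by fastforce
  then show "0 < x \<bullet> (ctransp B ** B *v x)"
    by (metis inner_matrix_vector matrix_vector_mul_assoc)
qed

context
  fixes B :: "complex^'m^'n"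
  assumes inj: "\<And>x. B *v x = 0 \<Longrightarrow> x = 0"
begin

lemma range_proj_mult_self: "range_proj B ** B = B"
  unfolding range_proj_def
  by (metis gram_posdef inj matrix_mul_assoc matrix_mul_rid posdef_inv_left)

lemma ctransp_mult_range_proj: "ctransp B ** range_proj B = ctransp B"
  unfolding range_proj_def
  by (metis gram_posdef inj matrix_mul_assoc matrix_mul_lid posdef_inv_right)

lemma hermitian_range_proj: "hermitian (range_proj B)"
proof -
  have "ctransp (matrix_inv (ctransp B ** B)) = matrix_inv (ctransp B ** B)"
    by (rule hermitianD[OF hermitian_inv[OF gram_posdef]]) (rule inj)
  then show ?thesis
    by (simp add: range_proj_def hermitian_def ctransp_mult matrix_mul_assoc)
qed

lemma range_proj_idem: "range_proj B ** range_proj B = range_proj B"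
  by (metis range_proj_def range_proj_mult_self matrix_mul_assoc)

end

text \<open>For Hermitian \<open>P\<close> and \<open>C = B\<^sup>*\<close> the transposes are entrywise conjugates of \<open>P\<close> and \<open>B\<close>;
  conjugating all vectors leaves the condition that \<open>P\<close> maps the kernel of \<open>B\<^sup>*\<close>, which is the range
  of \<open>1 - \<Pi>\<close>, into the range of \<open>B\<close>, which is the kernel of \<open>1 - \<Pi>\<close>.\<close>

theorem rank_bordered_iff:
  fixes P :: "complex^'n^'n" and B :: "complex^'m^'n"
  assumes B: "rank B = CARD('m)" and P: "hermitian P"
  shows "rank (block_matrix P B (ctransp B) 0) = 2 * CARD('m) \<longleftrightarrow>
    (mat 1 - range_proj B) ** P ** (mat 1 - range_proj B) = 0"
proof -
  note inj = full_column_rank_inj[OF B]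
  let ?E = "mat 1 - range_proj B"
  let ?c = "\<lambda>x. \<chi> i. cnj (x $ i)"
  have cc: "?c (?c x) = x" for x :: "complex^'k" by (simp add: vec_eq_iff)
  have c0: "?c x = 0 \<longleftrightarrow> x = 0" for x :: "complex^'k" by (simp add: vec_eq_iff)
  have cadd: "?c (x + y) = ?c x + ?c y" for x y :: "complex^'k" by (simp add: vec_eq_iff)
  have tB: "transpose (ctransp B) *v u = ?c (B *v ?c u)" for u
    by (simp only: cnj_matrix_vector cc)
  have tP: "transpose P *v x = ?c (P *v ?c x)" for x
    by (metis P cnj_matrix_vector cc hermitianD)
  have tB': "transpose B *v x = ?c (ctransp B *v ?c x)" for x
    by (metis cnj_matrix_vector cc ctransp_ctransp)
  have "rank (block_matrix P B (ctransp B) 0) = 2 * CARD('m) \<longleftrightarrow>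
      (\<forall>x. transpose B *v x = 0 \<longrightarrow> (\<exists>u. transpose P *v x + transpose (ctransp B) *v u = 0))"
  proof (rule rank_bordered[OF B])
    fix u assume "transpose (ctransp B) *v u = 0"
    then show "u = 0" unfolding tB c0 using inj c0 by blast
  qed
  also have "\<dots> \<longleftrightarrow> (\<forall>x. ctransp B *v ?c x = 0 \<longrightarrow> (\<exists>u. P *v ?c x + B *v ?c u = 0))"
    unfolding tB tP tB' cadd[symmetric] c0 ..
  also have "\<dots> \<longleftrightarrow> (\<forall>x. ctransp B *v x = 0 \<longrightarrow> (\<exists>u. P *v x + B *v u = 0))"
    by (metis cc)
  also have "\<dots> \<longleftrightarrow> ?E ** P ** ?E = 0"
  proof
    assume *: "\<forall>x. ctransp B *v x = 0 \<longrightarrow> (\<exists>u. P *v x + B *v u = 0)"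
    have "(?E ** P ** ?E) *v y = 0" for y
    proof -
      have "ctransp B *v (?E *v y) = 0"
        by (simp add: matrix_vector_mul_assoc matrix_ring ctransp_mult_range_proj[OF inj])
      with * obtain u where "P *v (?E *v y) + B *v u = 0" by blast
      then have "P *v (?E *v y) = B *v (- u)"
        by (simp add: eq_neg_iff_add_eq_0 vec.neg)
      then have "(?E ** P ** ?E) *v y = (?E ** B) *v (- u)"
        by (metis matrix_vector_mul_assoc)
      then show ?thesis by (simp add: matrix_ring range_proj_mult_self[OF inj])
    qed
    then show "?E ** P ** ?E = 0" by (simp add: matrix_eq)
  next
    assume *: "?E ** P ** ?E = 0"
    show "\<forall>x. ctransp B *v x = 0 \<longrightarrow> (\<exists>u. P *v x + B *v u = 0)"
    proof (intro allI impI)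
      fix x assume "ctransp B *v x = 0"
      then have "?E *v x = x"
        by (simp add: matrix_vector_mult_diff_rdistrib range_proj_def matrix_vector_mul_assoc[symmetric])
      then have "?E *v (P *v x) = 0"
        using * by (metis matrix_vector_mul_assoc matrix_vector_mult_0)
      then have "P *v x = B *v ((matrix_inv (ctransp B ** B) ** ctransp B) *v (P *v x))"
        by (simp add: matrix_vector_mult_diff_rdistrib range_proj_def
            matrix_vector_mul_assoc[symmetric])
      then have "P *v x + B *v (- ((matrix_inv (ctransp B ** B) ** ctransp B) *v (P *v x))) = 0"
        by (simp add: vec.neg)
      then show "\<exists>u. P *v x + B *v u = 0" by blast
    qed
  qed
  finally show ?thesis .
qed

section \<open>Integration over the circle\<close>

lemma lebesgue_emeasure_circle: "emeasure lebesgue {-pi..pi} = ennreal (2 * pi)"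
  by (simp add: emeasure_lborel_Icc)

lemma emeasure_circle_space: "emeasure circle_measure (space circle_measure) = 1"
proof -
  have "emeasure lebesgue {-pi..pi} / emeasure lebesgue {-pi..pi} = 1"
    unfolding lebesgue_emeasure_circle by (intro ennreal_divide_self) auto
  then show ?thesis by (simp add: circle_measure_def)
qed

lemma finite_measure_circle: "finite_measure circle_measure"
  by (rule finite_measureI) (simp add: emeasure_circle_space)

lemma measure_circle_space: "measure circle_measure (space circle_measure) = 1"
  by (simp add: measure_def emeasure_circle_space)

lemma circle_integral_const [simp]: "circle_integral (\<lambda>_. c) = c"
  by (simp add: circle_integral_def measure_circle_space)

lemma continuous_borel_circle:
  fixes f :: "real \<Rightarrow> 'b::topological_space"
  assumes "continuous_on UNIV f" shows "f \<in> borel_measurable circle_measure"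
proof -
  have "f \<in> borel_measurable borel" using assms by (rule borel_measurable_continuous_onI)
  then have "f \<in> borel_measurable lebesgue" by (simp add: measurable_completion)
  then show ?thesis unfolding circle_measure_def
    by (simp cong: measurable_cong_sets)
qed

lemma integral_circle_continuous:
  fixes f :: "real \<Rightarrow> 'b::euclidean_space"
  assumes f: "continuous_on UNIV f"
  shows "integral\<^sup>L circle_measure f = (1 / (2 * pi)) *\<^sub>R integral {-pi..pi} f"
proof -
  have "f absolutely_integrable_on cbox (-pi) pi"
    by (rule absolutely_integrable_continuous) (rule continuous_on_subset[OF f subset_UNIV])
  then have int: "set_integrable lebesgue {-pi..pi} f" by simp
  have "(indicator {-pi..pi} x :: ennreal) / ennreal (2 * pi) =
      ennreal (indicat_real {-pi..pi} x / (2 * pi))" for x :: real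
    by (auto simp: indicator_def divide_ennreal[symmetric] simp del: divide_ennreal)
  then have d: "circle_measure = density lebesgue (\<lambda>x. ennreal (indicat_real {-pi..pi} x / (2 * pi)))"
    unfolding circle_measure_def uniform_measure_def lebesgue_emeasure_circle by simp
  have "f \<in> borel_measurable borel" using f by (rule borel_measurable_continuous_onI)
  then have [measurable]: "f \<in> borel_measurable lebesgue" by (simp add: measurable_completion)
  have [measurable]: "indicat_real {-pi..pi} \<in> borel_measurable lebesgue"
    by (rule borel_measurable_indicator) simp
  have "integral\<^sup>L circle_measure f =
      (\<integral>x. (indicat_real {-pi..pi} x / (2 * pi)) *\<^sub>R f x \<partial>lebesgue)"
    unfolding d by (rule integral_density) auto
  also have "\<dots> = (\<integral>x. (1 / (2 * pi)) *\<^sub>R (indicat_real {-pi..pi} x *\<^sub>R f x) \<partial>lebesgue)"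
    by (intro Bochner_Integration.integral_cong) auto
  also have "\<dots> = (1 / (2 * pi)) *\<^sub>R (LINT x:{-pi..pi}|lebesgue. f x)"
    unfolding set_lebesgue_integral_def
    using int unfolding set_integrable_def by (intro integral_scaleR_right)
  also have "(LINT x:{-pi..pi}|lebesgue. f x) = integral {-pi..pi} f"
    using int by (rule set_lebesgue_integral_eq_integral(2))
  finally show ?thesis .
qed

text \<open>Boundedness is demanded at every point of the circle, as in the definition of the class
  \<open>\<S>\<^sub>+\<close>. The integrands formed from \<open>G\<close>, \<open>\<Psi>\<close> and the inverses of pencils are of this
  kind, so their integrability follows from closure properties.\<close>

definition circle_bounded :: "(complex \<Rightarrow> 'b::real_normed_vector) \<Rightarrow> bool" where
  "circle_bounded F \<longleftrightarrow> circle_measurable F \<and> bounded (F ` sphere 0 1)"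

lemma circle_boundedI:
  assumes "circle_measurable F" "\<And>z. cmod z = 1 \<Longrightarrow> norm (F z) \<le> b"
  shows "circle_bounded F"
  using assms unfolding circle_bounded_def bounded_iff by (auto intro!: exI[of _ b])

lemma circle_boundedE:
  assumes "circle_bounded F"
  obtains b where "0 < b" "\<And>z. cmod z = 1 \<Longrightarrow> norm (F z) \<le> b"
proof -
  obtain b where "\<forall>y\<in>F ` sphere 0 1. norm y \<le> b"
    using assms unfolding circle_bounded_def bounded_iff by blast
  then have b: "\<And>z. cmod z = 1 \<Longrightarrow> norm (F z) \<le> b" by simp
  show thesis
    by (rule that[of "max b 1"]) (auto intro: order_trans[OF b])
qed

lemma circle_bounded_continuous:
  fixes F :: "complex \<Rightarrow> 'b::real_normed_vector"
  assumes "continuous_on (sphere 0 1) F" shows "circle_bounded F"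
  unfolding circle_bounded_def circle_measurable_def
proof
  have "continuous_on UNIV (\<lambda>\<theta>. F (cis \<theta>))"
    by (rule continuous_on_compose2[OF assms]) (auto intro: continuous_intros)
  then show "(\<lambda>\<theta>. F (cis \<theta>)) \<in> borel_measurable circle_measure" by (rule continuous_borel_circle)
  show "bounded (F ` sphere 0 1)"
    by (intro compact_imp_bounded compact_continuous_image assms compact_sphere)
qed

lemma circle_bounded_integrable:
  fixes F :: "complex \<Rightarrow> 'b::{banach, second_countable_topology}"
  assumes "circle_bounded F" shows "integrable circle_measure (\<lambda>\<theta>. F (cis \<theta>))"
proof -
  obtain b where "\<And>z. cmod z = 1 \<Longrightarrow> norm (F z) \<le> b" using assms by (rule circle_boundedE) blast
  then show ?thesis
    using assms by (intro finite_measure.integrable_const_bound[OF finite_measure_circle, of _ b])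
      (auto simp: circle_bounded_def circle_measurable_def)
qed

lemma circle_bounded_const: "circle_bounded (\<lambda>_. c)"
  by (rule circle_bounded_continuous) (rule continuous_on_const)

lemma circle_bounded_bilinear:
  fixes h :: "'b::{real_normed_vector,second_countable_topology} \<Rightarrow> 'c::{real_normed_vector,second_countable_topology} \<Rightarrow> 'd::real_normed_vector"
  assumes h: "bounded_bilinear h" and F: "circle_bounded F" and H: "circle_bounded H"
  shows "circle_bounded (\<lambda>z. h (F z) (H z))"
proof -
  obtain K where K: "0 < K" "\<And>x y. norm (h x y) \<le> norm x * norm y * K"
    using bounded_bilinear.pos_bounded[OF h] by blast
  obtain b where b: "0 < b" "\<And>z. cmod z = 1 \<Longrightarrow> norm (F z) \<le> b" using F by (rule circle_boundedE) blast
  obtain c where c: "0 < c" "\<And>z. cmod z = 1 \<Longrightarrow> norm (H z) \<le> c" using H by (rule circle_boundedE) blast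
  show ?thesis
  proof (rule circle_boundedI)
    show "circle_measurable (\<lambda>z. h (F z) (H z))"
      unfolding circle_measurable_def
    proof (rule borel_measurable_continuous_Pair)
      show "continuous_on UNIV (\<lambda>x. h (fst x) (snd x))"
        by (rule bounded_bilinear.continuous_on[OF h]) (intro continuous_intros)+
    qed (use F H in \<open>simp_all add: circle_bounded_def circle_measurable_def\<close>)
    fix z :: complex assume z: "cmod z = 1"
    have "norm (h (F z) (H z)) \<le> norm (F z) * norm (H z) * K" by (rule K)
    also have "\<dots> \<le> b * c * K" using b(2)[OF z] c(2)[OF z] b(1) K(1)
      by (intro mult_right_mono mult_mono) auto
    finally show "norm (h (F z) (H z)) \<le> b * c * K" .
  qed
qed

lemma circle_bounded_add:
  fixes F :: "complex \<Rightarrow> 'b::{real_normed_vector,second_countable_topology}"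
  assumes F: "circle_bounded F" and H: "circle_bounded H"
  shows "circle_bounded (\<lambda>z. F z + H z)"
proof -
  obtain b where b: "\<And>z. cmod z = 1 \<Longrightarrow> norm (F z) \<le> b" using F by (rule circle_boundedE) blast
  obtain c where c: "\<And>z. cmod z = 1 \<Longrightarrow> norm (H z) \<le> c" using H by (rule circle_boundedE) blast
  show ?thesis
  proof (rule circle_boundedI)
    show "circle_measurable (\<lambda>z. F z + H z)"
      using F H unfolding circle_bounded_def circle_measurable_def by (auto intro: borel_measurable_add)
    show "norm (F z + H z) \<le> b + c" if "cmod z = 1" for z
      by (intro order_trans[OF norm_triangle_ineq] add_mono b c that)
  qed
qed

lemma circle_bounded_linear:
  assumes "bounded_linear l" "circle_bounded F"
  shows "circle_bounded (\<lambda>z. l (F z))"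
proof -
  obtain b where b: "\<And>z. cmod z = 1 \<Longrightarrow> norm (F z) \<le> b" using assms(2) by (rule circle_boundedE) blast
  obtain K where K: "0 < K" "\<And>x. norm (l x) \<le> norm x * K"
    using bounded_linear.pos_bounded[OF assms(1)] by auto
  have l: "l \<in> borel_measurable borel"
    by (rule borel_measurable_continuous_onI) (rule linear_continuous_on[OF assms(1)])
  show ?thesis
  proof (rule circle_boundedI)
    show "circle_measurable (\<lambda>z. l (F z))"
      unfolding circle_measurable_def
      by (rule measurable_compose[OF _ l])
        (use assms(2) in \<open>simp add: circle_bounded_def circle_measurable_def\<close>)
    show "norm (l (F z)) \<le> b * K" if "cmod z = 1" for z
      using K(2)[of "F z"] mult_right_mono[OF b[OF that], of K] K(1) by linarith
  qed
qed

lemmas circle_bounded_mult = circle_bounded_bilinear[OF bounded_bilinear_matrix_mult]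
lemmas circle_bounded_inner = circle_bounded_bilinear[OF bounded_bilinear_inner]
lemmas circle_bounded_scaleR = circle_bounded_linear[OF bounded_linear_scaleR_right]
lemmas circle_bounded_ctransp = circle_bounded_linear[OF bounded_linear_ctransp]

lemma circle_bounded_diff:
  fixes F :: "complex \<Rightarrow> 'b::{real_normed_vector,second_countable_topology}"
  shows "circle_bounded F \<Longrightarrow> circle_bounded H \<Longrightarrow> circle_bounded (\<lambda>z. F z - H z)"
  using circle_bounded_add[of F "\<lambda>z. - H z"]
    circle_bounded_linear[OF bounded_linear_minus[OF bounded_linear_ident], of H] by simp

lemma circle_bounded_norm:
  assumes "circle_bounded F" shows "circle_bounded (\<lambda>z. norm (F z))"
proof -
  obtain b where b: "\<And>z. cmod z = 1 \<Longrightarrow> norm (F z) \<le> b" using assms by (rule circle_boundedE) blast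
  show ?thesis
    by (rule circle_boundedI[of _ b])
      (use assms b in \<open>auto simp: circle_bounded_def circle_measurable_def\<close>)
qed

lemmas circle_bounded_intros = circle_bounded_const circle_bounded_mult circle_bounded_inner
  circle_bounded_scaleR circle_bounded_ctransp circle_bounded_diff circle_bounded_add
  circle_bounded_norm

lemma circle_integral_add:
  fixes F :: "complex \<Rightarrow> 'b::{banach, second_countable_topology}"
  shows "circle_bounded F \<Longrightarrow> circle_bounded H \<Longrightarrow>
    circle_integral (\<lambda>z. F z + H z) = circle_integral F + circle_integral H"
  unfolding circle_integral_def by (simp add: circle_bounded_integrable)

lemma circle_integral_diff:
  fixes F :: "complex \<Rightarrow> 'b::{banach, second_countable_topology}"
  shows "circle_bounded F \<Longrightarrow> circle_bounded H \<Longrightarrow>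
    circle_integral (\<lambda>z. F z - H z) = circle_integral F - circle_integral H"
  unfolding circle_integral_def by (simp add: circle_bounded_integrable)

lemma circle_integral_linear:
  fixes F :: "complex \<Rightarrow> 'b::{banach, second_countable_topology}"
    and l :: "'b \<Rightarrow> 'c::{banach, second_countable_topology}"
  shows "bounded_linear l \<Longrightarrow> circle_bounded F \<Longrightarrow>
    circle_integral (\<lambda>z. l (F z)) = l (circle_integral F)"
  unfolding circle_integral_def
  by (rule integral_bounded_linear) (auto simp: circle_bounded_integrable)

lemma circle_integral_mono_AE:
  fixes F :: "complex \<Rightarrow> real"
  shows "circle_bounded F \<Longrightarrow> circle_bounded H \<Longrightarrow>
    AE \<theta> in circle_measure. F (cis \<theta>) \<le> H (cis \<theta>) \<Longrightarrow> circle_integral F \<le> circle_integral H"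
  unfolding circle_integral_def by (simp add: integral_mono_AE circle_bounded_integrable)

lemma circle_integral_mono:
  fixes F :: "complex \<Rightarrow> real"
  shows "circle_bounded F \<Longrightarrow> circle_bounded H \<Longrightarrow> (\<And>z. cmod z = 1 \<Longrightarrow> F z \<le> H z) \<Longrightarrow>
    circle_integral F \<le> circle_integral H"
  by (rule circle_integral_mono_AE) auto

lemma circle_integral_cong:
  "(\<And>z. cmod z = 1 \<Longrightarrow> F z = H z) \<Longrightarrow> circle_integral F = circle_integral H"
  unfolding circle_integral_def by (rule Bochner_Integration.integral_cong) auto

lemma circle_integral_zero_imp_AE:
  fixes F :: "complex \<Rightarrow> real"
  assumes "circle_bounded F" "AE \<theta> in circle_measure. 0 \<le> F (cis \<theta>)" "circle_integral F = 0"
  shows "AE \<theta> in circle_measure. F (cis \<theta>) = 0"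
  using assms integral_nonneg_eq_0_iff_AE[OF circle_bounded_integrable[OF assms(1)]]
  by (simp add: circle_integral_def)

lemma cis_Arg_unit: "cmod z = 1 \<Longrightarrow> cis (Arg z) = z"
  by (subst cis_Arg) (auto simp: sgn_div_norm)

lemma AE_circle_continuous:
  fixes F :: "complex \<Rightarrow> 'b::{real_normed_vector}"
  assumes F: "continuous_on (sphere 0 1) F"
    and AE: "AE \<theta> in circle_measure. F (cis \<theta>) = 0" and z: "cmod z = 1"
  shows "F z = 0"
proof (rule ccontr)
  assume "F z \<noteq> 0"
  define g where "g \<theta> = norm (F (cis \<theta>))" for \<theta>
  have "continuous_on UNIV (\<lambda>\<theta>. F (cis \<theta>))"
    by (rule continuous_on_compose2[OF F]) (auto intro: continuous_intros)
  then have g: "continuous_on UNIV g" unfolding g_def by (intro continuous_intros)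
  have "integral\<^sup>L circle_measure g = 0"
    by (rule integral_eq_zero_AE) (use AE in \<open>simp add: g_def\<close>)
  then have "integral {-pi..pi} g = 0" using integral_circle_continuous[OF g] by simp
  then have "\<forall>\<theta>\<in>{-pi..pi}. g \<theta> = 0"
    using integral_eq_0_iff[of "-pi" pi g] continuous_on_subset[OF g, of "{-pi..pi}"]
    by (auto simp: g_def)
  moreover have "Arg z \<in> {-pi..pi}" using mpi_less_Arg[of z] Arg_le_pi[of z] by auto
  ultimately have "g (Arg z) = 0" by blast
  moreover have "cis (Arg z) = z" using z by (rule cis_Arg_unit)
  ultimately show False using \<open>F z \<noteq> 0\<close> by (simp add: g_def)
qed

text \<open>Cauchy's formula at the centre. It is applied to \<open>z \<mapsto> f (- z)\<close> because the circular contour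
  starts at angle \<open>0\<close>, whereas the measure lives on \<open>[-\<pi>, \<pi>]\<close>.\<close>

lemma circle_integral_mean_value:
  fixes f :: "complex \<Rightarrow> complex"
  assumes cont: "continuous_on (cball 0 1) f" and hol: "f holomorphic_on ball 0 1"
  shows "circle_integral f = f 0"
proof -
  let ?g = "\<lambda>z. f (- z)"
  have "continuous_on (cball 0 1) ?g"
    by (rule continuous_on_compose2[OF cont]) (auto intro: continuous_intros)
  moreover have "?g holomorphic_on ball 0 1"
    using holomorphic_on_compose_gen[OF holomorphic_on_minus[OF holomorphic_on_ident] hol, of "ball 0 1"]
    by (force simp: o_def image_subset_iff)
  ultimately have "((\<lambda>u. ?g u / (u - 0)) has_contour_integral (2 * of_real pi * \<i> * ?g 0)) (circlepath 0 1)"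
    by (rule Cauchy_integral_circlepath) simp
  then have "((\<lambda>t. ?g (cis t) / cis t * \<i> * cis t) has_integral (2 * of_real pi * \<i> * f 0)) {0..2 * pi}"
    unfolding circlepath_def by (simp add: has_contour_integral_part_circlepath_iff)
  then have "((\<lambda>t. (1 / \<i>) * (?g (cis t) / cis t * \<i> * cis t)) has_integral
      (1 / \<i>) * (2 * of_real pi * \<i> * f 0)) {0..2 * pi}"
    by (rule has_integral_mult_right)
  then have "((\<lambda>t. ?g (cis t)) has_integral (2 * of_real pi * f 0)) {0..2 * pi}"
    by (simp add: cis_neq_zero field_simps)
  then have "((\<lambda>t. ?g (cis (t + pi))) has_integral (2 * of_real pi * f 0)) {0 - pi..2 * pi - pi}"
    by (rule has_integral_shift_real_ivl)
  then have "((\<lambda>t. f (cis t)) has_integral (2 * of_real pi * f 0)) {-pi..pi}"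
    by (simp add: cis_mult[symmetric])
  then have "integral {-pi..pi} (\<lambda>t. f (cis t)) = 2 * of_real pi * f 0" by (rule integral_unique)
  moreover have "continuous_on UNIV (\<lambda>\<theta>. f (cis \<theta>))"
    by (rule continuous_on_compose2[OF cont]) (auto intro: continuous_intros)
  ultimately show ?thesis
    by (simp add: circle_integral_def integral_circle_continuous scaleR_conv_of_real)
qed

text \<open>As \<open>e\<close> tends to zero the left side tends to infinity: the reciprocal of a function that
  grows at most linearly from a zero is not integrable. Only the part of the circle to the left of \<open>a\<close> is
  used; it is non-trivial since arguments are taken in \<open>(-\<pi>, \<pi>]\<close>.\<close>

lemma integral_reciprocal_ge:
  assumes K: "0 < K" and e: "0 < e" and a: "-pi < a" "a \<le> pi"
  shows "(ln (K * (a + pi)) - ln e) / (2 * pi * K) \<le>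
    integral\<^sup>L circle_measure (\<lambda>\<theta>. 1 / (K * \<bar>\<theta> - a\<bar> + e))"
proof -
  let ?h = "\<lambda>\<theta>. 1 / (K * \<bar>\<theta> - a\<bar> + e)"
  have pos: "0 < K * \<bar>\<theta> - a\<bar> + e" for \<theta> using K e by (intro add_nonneg_pos mult_nonneg_nonneg) auto
  have cont: "continuous_on S ?h" for S
    using pos by (intro continuous_intros) (auto simp: less_le)
  have "((\<lambda>\<theta>. 1 / (K * (a - \<theta>) + e)) has_integral
      (- ln (K * (a - a) + e) / K) - (- ln (K * (a - (-pi)) + e) / K)) {-pi..a}"
  proof (rule fundamental_theorem_of_calculus)
    show "- pi \<le> a" using a by simp
    fix t assume "t \<in> {-pi..a}"
    then have "0 < K * (a - t) + e" using K e by (intro add_nonneg_pos mult_nonneg_nonneg) auto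
    then show "((\<lambda>t. - ln (K * (a - t) + e) / K) has_vector_derivative 1 / (K * (a - t) + e))
        (at t within {-pi..a})"
      unfolding has_real_derivative_iff_has_vector_derivative[symmetric]
      using K by (auto intro!: derivative_eq_intros simp: divide_simps)
  qed
  then have "(?h has_integral
      (- ln (K * (a - a) + e) / K) - (- ln (K * (a - (-pi)) + e) / K)) {-pi..a}"
    by (rule has_integral_eq[rotated]) auto
  then have "integral {-pi..a} ?h =
      (- ln (K * (a - a) + e) / K) - (- ln (K * (a - (-pi)) + e) / K)"
    by (rule integral_unique)
  then have "(ln (K * (a + pi) + e) - ln e) / K = integral {-pi..a} ?h"
    by (simp add: diff_divide_distrib)
  also have "\<dots> \<le> integral {-pi..pi} ?h"
    using pos a by (intro integral_subset_le integrable_continuous_interval cont)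
      (auto simp: less_imp_le)
  finally have i: "(ln (K * (a + pi) + e) - ln e) / K \<le> integral {-pi..pi} ?h" .
  have "0 < K * (a + pi)" using K a by simp
  then have "ln (K * (a + pi)) \<le> ln (K * (a + pi) + e)" using e by (subst ln_le_cancel_iff) auto
  then have "(ln (K * (a + pi)) - ln e) / K \<le> integral {-pi..pi} ?h"
    using K by (intro order_trans[OF _ i] divide_right_mono) auto
  then have "(1 / (2 * pi)) * ((ln (K * (a + pi)) - ln e) / K) \<le> (1 / (2 * pi)) * integral {-pi..pi} ?h"
    by (intro mult_left_mono) auto
  then show ?thesis
    unfolding integral_circle_continuous[OF cont] real_scaleR_def
    by (simp only: times_divide_times_eq mult_1)
qed

section \<open>Resolvents of stable matrices\<close>

lemma mat_matrix_vector: "mat z *v x = z *s (x :: complex^'a)"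
  by (simp add: vec_eq_iff matrix_vector_mult_def mat_def if_distrib[of "\<lambda>y. y * _"] cong: if_cong)

lemma mat_mult_commute: "mat z ** X = X ** mat (z :: complex)"
  by (simp add: vec_eq_iff matrix_matrix_mult_def mat_def if_distrib[of "\<lambda>y. y * _"]
      if_distrib[of "\<lambda>y. _ * y"] mult.commute cong: if_cong)

lemma mat_mult_mat: "mat z ** mat w = (mat (z * w) :: complex^'a^'a)"
  by (simp add: vec_eq_iff matrix_matrix_mult_def mat_def if_distrib[of "\<lambda>y. y * _"]
      if_distrib[of "\<lambda>y. _ * y"] cong: if_cong)

lemma continuous_on_mat [continuous_intros]:
  assumes "continuous_on S f" shows "continuous_on S (\<lambda>z. mat (f z) :: complex^'a^'a)"
proof -
  have "continuous_on S (\<lambda>z. if i = j then f z else 0)" for i j :: 'a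
    by (cases "i = j") (simp_all add: assms)
  then show ?thesis unfolding mat_def by (intro continuous_on_vec_lambda)
qed

lemma ker_ctransp:
  fixes M :: "complex^'a^'a"
  assumes "\<And>x. M *v x = 0 \<Longrightarrow> x = 0" "ctransp M *v x = 0"
  shows "x = 0"
proof -
  have "ctransp (M ** matrix_inv M) = mat 1" using assms(1) by (subst matrix_inv_right_ker) auto
  then have "ctransp (matrix_inv M) ** ctransp M = mat 1" by (simp add: ctransp_mult)
  then show ?thesis using assms(2) matrix_left_invertible_ker by blast
qed

lemma not_eigenvalue_ker:
  assumes "\<not> is_eigenvalue A z" "(mat z - A) *v x = 0" shows "x = 0"
  using assms unfolding is_eigenvalue_def
  by (auto simp: matrix_vector_mult_diff_rdistrib mat_matrix_vector)

lemma is_eigenvalue_ctransp: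
  assumes "is_eigenvalue (ctransp A) z" shows "is_eigenvalue A (cnj z)"
proof (rule ccontr)
  assume "\<not> is_eigenvalue A (cnj z)"
  then have "\<And>x. ctransp (mat (cnj z) - A) *v x = 0 \<Longrightarrow> x = 0"
    using ker_ctransp not_eigenvalue_ker by blast
  then show False using assms unfolding is_eigenvalue_def
    by (auto simp: ctransp_diff matrix_vector_mult_diff_rdistrib mat_matrix_vector)
qed

definition stable :: "complex^'n^'n \<Rightarrow> bool" where
  "stable A \<longleftrightarrow> (\<forall>k. is_eigenvalue A k \<longrightarrow> cmod k < 1)"

lemma stable_ctransp: "stable A \<Longrightarrow> stable (ctransp A)"
  unfolding stable_def using is_eigenvalue_ctransp by fastforce

lemma stable_resolvent_ker:
  "stable A \<Longrightarrow> 1 \<le> cmod z \<Longrightarrow> (mat z - A) *v x = 0 \<Longrightarrow> x = 0"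
  unfolding stable_def using not_eigenvalue_ker by (metis not_le)

lemma stable_one_minus_ker:
  assumes A: "stable A" and z: "cmod z \<le> 1" and x: "(mat 1 - mat z ** A) *v x = 0"
  shows "x = 0"
proof (rule ccontr)
  assume "x \<noteq> 0"
  have e: "x = z *s (A *v x)"
    using x by (simp add: matrix_vector_mult_diff_rdistrib matrix_vector_mul_assoc[symmetric]
        mat_matrix_vector)
  then have "z \<noteq> 0" using \<open>x \<noteq> 0\<close> by auto
  have "(1 / z) *s x = (1 / z) *s (z *s (A *v x))" using e by (rule arg_cong)
  then have "A *v x = (1 / z) *s x" using \<open>z \<noteq> 0\<close> by (simp add: vector_smult_assoc)
  then have "is_eigenvalue A (1 / z)" using \<open>x \<noteq> 0\<close> unfolding is_eigenvalue_def by blast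
  then have "cmod (1 / z) < 1" using A by (simp add: stable_def)
  then show False using z \<open>z \<noteq> 0\<close> by (simp add: norm_divide divide_simps split: if_splits)
qed

definition resolvent :: "complex^'n^'n \<Rightarrow> complex \<Rightarrow> complex^'n^'n" where
  "resolvent A z = matrix_inv (mat z - A)"

lemma transfer_fun_resolvent: "transfer_fun A B z = resolvent A z ** B"
  by (simp add: transfer_fun_def resolvent_def)

lemma
  assumes "stable A" "cmod z = 1"
  shows resolvent_left: "resolvent A z ** (mat z - A) = mat 1"
    and resolvent_right: "(mat z - A) ** resolvent A z = mat 1"
  unfolding resolvent_def
  by (rule matrix_inv_left_ker matrix_inv_right_ker, rule stable_resolvent_ker[OF assms(1)],
      use assms(2) in auto)+

lemma continuous_on_resolvent:
  assumes "stable A" shows "continuous_on (sphere 0 1) (resolvent A)"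
  unfolding resolvent_def
proof (rule continuous_on_matrix_inv)
  show "continuous_on (sphere 0 1) (\<lambda>z. mat z - A)" by (intro continuous_intros)
  show "x = 0" if "z \<in> sphere 0 1" "(mat z - A) *v x = 0" for z x
    using stable_resolvent_ker[OF assms, of z x] that by simp
qed

text \<open>The first resolvent identity.\<close>

lemma resolvent_diff:
  assumes "stable A" "cmod z = 1" "cmod w = 1"
  shows "resolvent A z - resolvent A w = mat (w - z) ** (resolvent A z ** resolvent A w)"
proof -
  have "(mat w - A) - (mat z - A) = mat (w - z)" by (simp add: vec_eq_iff mat_def)
  then have "mat (w - z) ** (resolvent A z ** resolvent A w) =
      resolvent A z ** ((mat w - A) - (mat z - A)) ** resolvent A w"
    by (simp only: matrix_mul_assoc mat_mult_commute)
  also have "\<dots> = resolvent A z ** ((mat w - A) ** resolvent A w) -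
      (resolvent A z ** (mat z - A)) ** resolvent A w"
    by (simp only: matrix_diff_rdistrib matrix_diff_ldistrib matrix_mul_assoc)
  also have "\<dots> = resolvent A z - resolvent A w"
    using assms by (simp add: resolvent_left resolvent_right)
  finally show ?thesis ..
qed

text \<open>On the circle \<open>(z - F)\<^sup>-\<^sup>1 = z\<^sup>-\<^sup>1 (1 - F / z)\<^sup>-\<^sup>1\<close>, and the conjugate transpose of the
  second factor extends holomorphically to the disc with value \<open>1\<close> at the centre.\<close>

lemma circle_integral_resolvent:
  fixes F :: "complex^'n^'n"
  assumes F: "stable F"
  shows "circle_integral (\<lambda>z. ctransp (mat z ** resolvent F z)) = mat 1"
proof -
  let ?M = "\<lambda>w. mat 1 - mat w ** ctransp F"
  define H where "H w = matrix_inv (?M w)" for w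
  have ker: "?M w *v x = 0 \<Longrightarrow> x = 0" if "cmod w \<le> 1" for w x
    using stable_one_minus_ker[OF stable_ctransp[OF F] that] .
  have eq: "ctransp (mat z ** resolvent F z) = H z" if z: "cmod z = 1" for z
  proof -
    have "cnj z * z = 1" using z by (metis complex_norm_square mult.commute of_real_1 one_power2)
    then have "mat 1 - mat (cnj z) ** F = mat (cnj z) ** (mat z - F)"
      by (simp add: matrix_diff_ldistrib mat_mult_mat)
    then have "ctransp (?M z) = mat (cnj z) ** (mat z - F)"
      by (simp add: ctransp_diff ctransp_mult mat_mult_commute)
    then have "ctransp (?M z) ** (mat z ** resolvent F z) =
        mat (cnj z) ** mat z ** ((mat z - F) ** resolvent F z)"
      by (metis mat_mult_commute matrix_mul_assoc)
    also have "\<dots> = mat 1"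
      using \<open>cnj z * z = 1\<close> F z by (simp add: mat_mult_mat resolvent_right)
    finally have "ctransp (ctransp (?M z) ** (mat z ** resolvent F z)) = mat 1" by simp
    then have "ctransp (mat z ** resolvent F z) ** ?M z = mat 1"
      by (simp only: ctransp_mult ctransp_ctransp)
    then show ?thesis unfolding H_def by (rule matrix_inv_unique[symmetric])
  qed
  have d: "det (?M w) \<noteq> 0" if "w \<in> cball 0 1" for w
    unfolding det_nonzero_iff_ker using ker that by simp
  have contM: "continuous_on S ?M" for S by (intro continuous_intros)
  have contH: "continuous_on (cball 0 1) H"
    unfolding H_def by (rule continuous_on_matrix_inv[OF contM]) (use ker in simp)
  have holM: "(\<lambda>w. ?M w $ i $ j) holomorphic_on S" for i j S
    by (cases "i = j") (simp_all add: matrix_matrix_mult_def mat_def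
        if_distrib[of "\<lambda>y. y * _"] cong: if_cong; intro holomorphic_intros)+
  have hol_det: "(\<lambda>w. det (N w)) holomorphic_on S"
    if "\<And>i j. (\<lambda>w. N w $ i $ j) holomorphic_on S" for N :: "complex \<Rightarrow> complex^'n^'n" and S
    unfolding det_def by (intro holomorphic_intros that)
  have holH: "(\<lambda>w. H w $ i $ j) holomorphic_on ball 0 1" for i j
  proof -
    have e: "(\<lambda>w. (\<chi> k l. if l = i then (if k = j then 1 else 0) else ?M w $ k $ l) $ k $ l) holomorphic_on ball 0 1"
      for k l
      using holM[of k l "ball 0 1"] by (cases "l = i"; cases "k = j") simp_all
    have "(\<lambda>w. det (\<chi> k l. if l = i then (if k = j then 1 else 0) else ?M w $ k $ l) / det (?M w))
        holomorphic_on ball 0 1"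
      by (intro holomorphic_on_divide hol_det holM e d) auto
    then show ?thesis
      by (rule holomorphic_transform) (simp add: H_def matrix_inv_entry[OF d])
  qed
  have bH: "circle_bounded H"
    by (rule circle_bounded_continuous) (rule continuous_on_subset[OF contH], auto)
  have "circle_integral H $ i $ j = mat 1 $ i $ j" for i j
  proof -
    have "circle_integral H $ i $ j = circle_integral (\<lambda>z. H z $ i $ j)"
      using circle_integral_linear[OF bounded_linear_compose[OF bounded_linear_vec_nth bounded_linear_vec_nth] bH]
      by metis
    also have "\<dots> = H 0 $ i $ j"
      by (rule circle_integral_mean_value) (intro continuous_intros contH, rule holH)
    also have "H 0 = mat 1" 
    proof -
      have "mat 0 = (0 :: complex^'n^'n)" by (simp add: vec_eq_iff mat_def)
      then show ?thesis unfolding H_def by (intro matrix_inv_unique) simp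
    qed
    finally show ?thesis .
  qed
  then have "circle_integral H = mat 1" by (simp add: vec_eq_iff)
  then show ?thesis using circle_integral_cong[OF eq] by simp
qed

text \<open>\<open>P\<close> and \<open>F\<close> are related by the Stein equation \<open>X - F X F\<^sup>* = P\<close> with \<open>X = 1\<close>, whose solution
  for stable \<open>F\<close> is this integral. Writing \<open>R\<close> for the resolvent at a point of the circle and
  \<open>M = z - F\<close>, the equation reads \<open>P = z M\<^sup>* + M z\<^sup>* - M M\<^sup>*\<close>, so the integrand is
  \<open>z R + (z R)\<^sup>* - 1\<close>, and both resolvent terms have mean \<open>1\<close>.\<close>

lemma circle_integral_stein:
  fixes F P :: "complex^'n^'n"
  assumes F: "stable F" and P: "P = mat 1 - F ** ctransp F"
  shows "circle_integral (\<lambda>z. resolvent F z ** P ** ctransp (resolvent F z)) = mat 1"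
proof -
  let ?U = "\<lambda>z. mat z ** resolvent F z"
  have eq: "resolvent F z ** P ** ctransp (resolvent F z) = ?U z + ctransp (?U z) - mat 1"
    if z: "cmod z = 1" for z
  proof -
    define M where "M = mat z - F"
    define R where "R = resolvent F z"
    have RM: "R ** M = mat 1" unfolding R_def M_def using F z by (rule resolvent_left)
    then have MR: "ctransp M ** ctransp R = mat 1"
      by (metis complex_cnj_one ctransp_mat ctransp_mult)
    have zz: "z * cnj z = 1" using z by (metis complex_norm_square of_real_1 one_power2)
    have F': "F = mat z - M" by (simp add: M_def)
    have "P = mat z ** ctransp M + M ** mat (cnj z) - M ** ctransp M"
      unfolding P F' by (simp add: ctransp_diff matrix_ring mat_mult_mat zz)
    then have "R ** P ** ctransp R = R ** mat z ** (ctransp M ** ctransp R) +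
        (R ** M) ** mat (cnj z) ** ctransp R - (R ** M) ** (ctransp M ** ctransp R)"
      by (simp add: matrix_ring)
    also have "\<dots> = mat z ** R + ctransp (mat z ** R) - mat 1"
      by (simp add: RM MR mat_mult_commute ctransp_mult)
    finally show ?thesis unfolding R_def .
  qed
  have bU: "circle_bounded ?U"
    by (intro circle_bounded_mult circle_bounded_continuous continuous_on_resolvent F continuous_intros)
  have cU: "circle_integral (\<lambda>z. ctransp (?U z)) = mat 1" using F by (rule circle_integral_resolvent)
  then have "ctransp (circle_integral ?U) = mat 1"
    using circle_integral_linear[OF bounded_linear_ctransp bU] by simp
  then have "circle_integral ?U = mat 1" by (metis complex_cnj_one ctransp_ctransp ctransp_mat)
  then have "circle_integral (\<lambda>z. ?U z + ctransp (?U z) - mat 1) = mat 1"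
    using cU bU by (simp add: circle_integral_diff circle_integral_add circle_bounded_intros)
  then show ?thesis using circle_integral_cong[OF eq] by simp
qed

section \<open>A coercive density with identity covariance\<close>

text \<open>Let \<open>\<Pi>\<close> project onto the range of \<open>B\<close> and put \<open>F = (1 - \<Pi>) A\<close>. The hypothesis says exactly that
  \<open>F F\<^sup>* = 1 - \<Pi>\<close>. An eigenvector of \<open>F\<^sup>*\<close> for an eigenvalue of modulus at least one would then be
  annihilated by \<open>\<Pi>\<close> and hence be an eigenvector of \<open>A\<^sup>*\<close>; so \<open>F\<close> is stable. Thus
  \<open>(z - F)\<^sup>-\<^sup>1 \<Pi> (z - F)\<^sup>-\<^sup>*\<close> integrates to \<open>1\<close>, and it is of the form \<open>G \<Phi> G\<^sup>*\<close> because \<open>F\<close> arises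
  from \<open>A\<close> by state feedback.\<close>

theorem feasible_density:
  fixes A :: "complex^'n^'n" and B :: "complex^'m^'n"
  assumes A: "stable A" and inj: "\<And>x. B *v x = 0 \<Longrightarrow> x = 0"
    and cond: "(mat 1 - range_proj B) ** (mat 1 - A ** ctransp A) ** (mat 1 - range_proj B) = 0"
  obtains \<Phi> where "continuous_on (sphere 0 1) \<Phi>" "\<And>z. cmod z = 1 \<Longrightarrow> posdef (\<Phi> z)"
    "moment (transfer_fun A B) \<Phi> = mat 1"
proof -
  define P where "P = range_proj B"
  define E where "E = mat 1 - P"
  define F where "F = E ** A"
  define N where "N = matrix_inv (ctransp B ** B)"
  have P: "ctransp P = P" "P ** P = P" "P = B ** N ** ctransp B"
    unfolding P_def
    by (rule hermitianD[OF hermitian_range_proj[OF inj]], assumption,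
        rule range_proj_idem[OF inj], assumption, simp add: range_proj_def N_def)
  have E: "ctransp E = E" "E ** E = E"
    by (simp_all add: E_def ctransp_diff P(1,2) matrix_ring)
  have EAE: "E ** E = E ** (A ** ctransp A) ** E"
    using cond unfolding P_def[symmetric] E_def[symmetric]
    by (simp add: matrix_diff_ldistrib matrix_diff_rdistrib)
  have "F ** ctransp F = E ** (A ** ctransp A) ** E"
    by (simp add: F_def ctransp_mult E(1) matrix_mul_assoc)
  also have "\<dots> = E" unfolding EAE[symmetric] by (rule E(2))
  finally have FF: "F ** ctransp F = E" .
  have stF: "stable F"
  proof -
    have "cmod \<mu> < 1" if ev: "is_eigenvalue (ctransp F) \<mu>" for \<mu>
    proof (rule ccontr)
      assume "\<not> cmod \<mu> < 1"
      obtain x where x: "x \<noteq> 0" "ctransp F *v x = \<mu> *s x"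
        using ev unfolding is_eigenvalue_def by blast
      have nrm: "norm (\<mu> *s x) = cmod \<mu> * norm x"
        by (simp add: norm_vec_def norm_mult L2_set_right_distrib)
      have "x \<bullet> (E *v x) = x \<bullet> (F *v (ctransp F *v x))"
        by (simp only: FF matrix_vector_mul_assoc)
      also have "\<dots> = (ctransp F *v x) \<bullet> (ctransp F *v x)" by (rule inner_matrix_vector')
      also have "\<dots> = (norm (ctransp F *v x))\<^sup>2" by (rule dot_square_norm)
      also have "\<dots> = (cmod \<mu>)\<^sup>2 * (norm x)\<^sup>2" by (simp add: x nrm power_mult_distrib)
      finally have 1: "x \<bullet> (E *v x) = (cmod \<mu>)\<^sup>2 * (norm x)\<^sup>2" .
      have "x \<bullet> (P *v x) = (P *v x) \<bullet> (P *v x)"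
        using inner_matrix_vector'[of x P "P *v x"] by (simp add: P(1,2) matrix_vector_mul_assoc)
      then have "x \<bullet> (E *v x) = (norm x)\<^sup>2 - (norm (P *v x))\<^sup>2"
        by (simp add: E_def matrix_vector_mult_diff_rdistrib inner_diff_right dot_square_norm)
      moreover have "1 * (norm x)\<^sup>2 \<le> (cmod \<mu>)\<^sup>2 * (norm x)\<^sup>2"
        using \<open>\<not> cmod \<mu> < 1\<close> by (intro mult_right_mono) auto
      ultimately have "(norm (P *v x))\<^sup>2 \<le> 0" using 1 by linarith
      then have "P *v x = 0" by simp
      then have "E *v x = x" by (simp add: E_def matrix_vector_mult_diff_rdistrib)
      then have "ctransp A *v x = \<mu> *s x"
        using x(2) by (simp add: F_def ctransp_mult E matrix_vector_mul_assoc[symmetric])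
      then have "is_eigenvalue (ctransp A) \<mu>" using x(1) unfolding is_eigenvalue_def by blast
      then show False using stable_ctransp[OF A] \<open>\<not> cmod \<mu> < 1\<close> by (simp add: stable_def)
    qed
    then show ?thesis using stable_ctransp[of "ctransp F"] by (simp add: stable_def)
  qed
  let ?G = "transfer_fun A B"
  \<comment> \<open>\<open>W\<close> is the transfer function whose inverse is obtained by the state feedback
    that turns \<open>A\<close> into \<open>F\<close>; it carries one state space realisation to the other.\<close>
  define W where "W z = mat 1 + N ** ctransp B ** A ** ?G z" for z
  have GW: "?G z = resolvent F z ** B ** W z" if z: "cmod z = 1" for z
  proof -
    have "(mat z - F) ** ?G z = (mat z - A) ** ?G z + P ** A ** ?G z"
      by (simp add: F_def E_def matrix_ring)
    also have "(mat z - A) ** ?G z = B"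
      by (simp add: transfer_fun_resolvent matrix_mul_assoc resolvent_right[OF A z])
    also have "B + P ** A ** ?G z = B ** W z"
      by (simp add: W_def P(3) matrix_ring)
    finally have "resolvent F z ** ((mat z - F) ** ?G z) = resolvent F z ** (B ** W z)" by simp
    then show ?thesis by (simp add: matrix_mul_assoc resolvent_left[OF stF z])
  qed
  have kerW: "x = 0" if z: "cmod z = 1" and x: "W z *v x = 0" for z x
  proof -
    have "?G z *v x = 0" using GW[OF z] x by (simp add: matrix_vector_mul_assoc[symmetric])
    then have "(mat z - A) *v (?G z *v x) = 0" by simp
    then have "B *v x = 0"
      by (simp add: transfer_fun_resolvent matrix_vector_mul_assoc matrix_mul_assoc
          resolvent_right[OF A z])
    then show ?thesis by (rule inj)
  qed
  define V where "V z = matrix_inv (W z)" for z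
  define \<Phi> where "\<Phi> z = V z ** N ** ctransp (V z)" for z
  have contG: "continuous_on (sphere 0 1) ?G"
    unfolding transfer_fun_resolvent by (intro continuous_intros continuous_on_resolvent A)
  have contW: "continuous_on (sphere 0 1) W"
    unfolding W_def by (intro continuous_intros contG)
  have contV: "continuous_on (sphere 0 1) V"
    unfolding V_def by (rule continuous_on_matrix_inv[OF contW]) (use kerW in auto)
  have pN: "posdef N" unfolding N_def by (intro posdef_inv gram_posdef inj)
  have pos: "posdef (\<Phi> z)" if z: "cmod z = 1" for z
    unfolding posdef_iff
  proof (intro conjI allI impI)
    have "ctransp N = N" using pN by (simp add: posdef_iff hermitianD)
    then show "hermitian (\<Phi> z)"
      by (simp add: \<Phi>_def hermitian_def ctransp_mult matrix_mul_assoc)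
    fix x :: "complex^'m" assume "x \<noteq> 0"
    have "W z ** V z = mat 1" unfolding V_def by (rule matrix_inv_right_ker) (rule kerW[OF z])
    then have "V z ** W z = mat 1" by (simp add: matrix_left_right_inverse)
    then have "ctransp (W z) ** ctransp (V z) = mat 1"
      by (metis complex_cnj_one ctransp_mat ctransp_mult)
    then have "ctransp (V z) *v x \<noteq> 0" using \<open>x \<noteq> 0\<close> matrix_left_invertible_ker by blast
    then have "0 < (ctransp (V z) *v x) \<bullet> (N *v (ctransp (V z) *v x))"
      using pN by (simp add: posdef_iff)
    then show "0 < x \<bullet> (\<Phi> z *v x)"
      by (simp add: \<Phi>_def matrix_vector_mul_assoc[symmetric] inner_matrix_vector'[of x "V z"])
  qed
  have "?G z ** \<Phi> z ** ctransp (?G z) = resolvent F z ** P ** ctransp (resolvent F z)"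
    if z: "cmod z = 1" for z
  proof -
    have WV: "W z ** V z = mat 1" unfolding V_def by (rule matrix_inv_right_ker) (rule kerW[OF z])
    have GV: "?G z ** V z = resolvent F z ** B"
      by (simp add: GW[OF z] matrix_mul_assoc[symmetric] WV)
    have "?G z ** \<Phi> z ** ctransp (?G z) = (?G z ** V z) ** N ** ctransp (?G z ** V z)"
      by (simp add: \<Phi>_def ctransp_mult matrix_mul_assoc)
    also have "\<dots> = resolvent F z ** P ** ctransp (resolvent F z)"
      by (simp add: GV P(3) ctransp_mult matrix_mul_assoc)
    finally show ?thesis .
  qed
  then have "moment ?G \<Phi> = circle_integral (\<lambda>z. resolvent F z ** P ** ctransp (resolvent F z))"
    unfolding moment_def by (rule circle_integral_cong)
  also have "\<dots> = mat 1"
    by (rule circle_integral_stein[OF stF]) (simp add: FF E_def)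
  finally have "moment ?G \<Phi> = mat 1" .
  moreover have "continuous_on (sphere 0 1) \<Phi>"
    unfolding \<Phi>_def by (intro continuous_intros contV)
  ultimately show thesis using that pos by blast
qed

section \<open>The moment map\<close>

abbreviation congr_fun :: "(complex \<Rightarrow> complex^'m^'n) \<Rightarrow> complex^'n^'n \<Rightarrow> complex \<Rightarrow> complex^'m^'m" where
  "congr_fun G \<Lambda> z \<equiv> ctransp (G z) ** \<Lambda> ** G z"

text \<open>Transfer functions of stable systems are Lipschitz on the circle. This regularity is what
  rules out minimising sequences that approach the boundary of \<open>\<L>\<^sup>H\<close>.\<close>

locale moment_map =
  fixes G :: "complex \<Rightarrow> complex^'m^'n" and L :: real
  assumes L_pos: "0 < L"
    and lipschitz_G: "\<And>z w. cmod z = 1 \<Longrightarrow> cmod w = 1 \<Longrightarrow> norm (G z - G w) \<le> L * cmod (z - w)"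
begin

lemma continuous_G: "continuous_on (sphere 0 1) G"
proof -
  have "L-lipschitz_on (sphere 0 1) G"
    using lipschitz_G L_pos by (intro lipschitz_onI) (auto simp: dist_norm)
  then show ?thesis by (rule lipschitz_on_continuous_on)
qed

lemma circle_bounded_G: "circle_bounded G"
  by (rule circle_bounded_continuous[OF continuous_G])

lemma continuous_congr_fun: "continuous_on (sphere 0 1) (congr_fun G \<Lambda>)"
  by (intro continuous_intros continuous_G)

lemma circle_bounded_congr_fun: "circle_bounded (congr_fun G \<Lambda>)"
  by (rule circle_bounded_continuous[OF continuous_congr_fun])

lemma continuous_dual_pencil: "continuous_on (sphere 0 1) (dual_pencil G \<Lambda>)"
  unfolding dual_pencil_def by (intro continuous_intros continuous_G)

lemma circle_bounded_moment_integrand: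
  "circle_bounded \<Phi> \<Longrightarrow> circle_bounded (\<lambda>z. G z ** \<Phi> z ** ctransp (G z))"
  by (intro circle_bounded_intros circle_bounded_G)

lemma congr_fun_bound:
  obtains g where "0 < g" "\<And>\<Lambda> z. cmod z = 1 \<Longrightarrow> norm (congr_fun G \<Lambda> z) \<le> g * norm \<Lambda>"
proof -
  obtain b where b: "0 < b" "\<And>z. cmod z = 1 \<Longrightarrow> norm (G z) \<le> b"
    using circle_bounded_G by (rule circle_boundedE) blast
  show thesis
  proof (rule that[of "b * b"])
    show "0 < b * b" using b by simp
    fix \<Lambda> z assume z: "cmod z = 1"
    have "norm (congr_fun G \<Lambda> z) \<le> norm (ctransp (G z) ** \<Lambda>) * norm (G z)" by (rule norm_matrix_mult)
    also have "\<dots> \<le> (norm (ctransp (G z)) * norm \<Lambda>) * norm (G z)"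
      by (intro mult_right_mono norm_matrix_mult) simp
    also have "\<dots> \<le> (b * norm \<Lambda>) * b" using b z
      by (intro mult_mono) auto
    finally show "norm (congr_fun G \<Lambda> z) \<le> b * b * norm \<Lambda>" by (simp add: ac_simps)
  qed
qed

text \<open>The adjoint of the moment map for the real trace inner products is \<open>\<Lambda> \<mapsto> G\<^sup>* \<Lambda> G\<close>.\<close>

lemma inner_moment:
  assumes "circle_bounded \<Phi>"
  shows "\<Lambda> \<bullet> moment G \<Phi> = circle_integral (\<lambda>z. congr_fun G \<Lambda> z \<bullet> \<Phi> z)"
proof -
  have "\<Lambda> \<bullet> moment G \<Phi> = circle_integral (\<lambda>z. \<Lambda> \<bullet> (G z ** \<Phi> z ** ctransp (G z)))"
    unfolding moment_def
    by (rule circle_integral_linear[symmetric, OF bounded_linear_inner_right])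
      (rule circle_bounded_moment_integrand[OF assms])
  also have "\<dots> = circle_integral (\<lambda>z. congr_fun G \<Lambda> z \<bullet> \<Phi> z)"
  proof (rule circle_integral_cong)
    fix z
    have "\<Lambda> \<bullet> (G z ** \<Phi> z ** ctransp (G z)) = (\<Lambda> ** G z) \<bullet> (G z ** \<Phi> z)"
      by (simp only: inner_matrix_right' ctransp_ctransp)
    also have "\<dots> = congr_fun G \<Lambda> z \<bullet> \<Phi> z"
      by (simp only: inner_matrix_left' matrix_mul_assoc)
    finally show "\<Lambda> \<bullet> (G z ** \<Phi> z ** ctransp (G z)) = congr_fun G \<Lambda> z \<bullet> \<Phi> z" .
  qed
  finally show ?thesis .
qed

lemma hermitian_moment:
  assumes "circle_bounded \<Phi>" "\<And>z. cmod z = 1 \<Longrightarrow> hermitian (\<Phi> z)"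
  shows "hermitian (moment G \<Phi>)"
proof -
  have "ctransp (moment G \<Phi>) = circle_integral (\<lambda>z. ctransp (G z ** \<Phi> z ** ctransp (G z)))"
    unfolding moment_def
    by (rule circle_integral_linear[symmetric, OF bounded_linear_ctransp])
      (rule circle_bounded_moment_integrand[OF assms(1)])
  also have "\<dots> = moment G \<Phi>"
    unfolding moment_def
    by (rule circle_integral_cong) (simp add: ctransp_mult matrix_mul_assoc hermitianD[OF assms(2)])
  finally show ?thesis by (simp add: hermitian_def)
qed

lemma cont_hermitian_bounded: "\<Phi> \<in> cont_hermitian \<Longrightarrow> circle_bounded \<Phi>"
  by (simp add: cont_hermitian_def circle_bounded_continuous)

lemma hermitian_Range_Gamma: "\<Lambda> \<in> Range_Gamma G \<Longrightarrow> hermitian \<Lambda>"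
  unfolding Range_Gamma_def
  by (auto intro!: hermitian_moment cont_hermitian_bounded simp: cont_hermitian_def)

lemma subspace_Range_Gamma: "subspace (Range_Gamma G)"
proof (rule subspaceI)
  have "moment G (\<lambda>_. 0) = 0" unfolding moment_def by simp
  moreover have "(\<lambda>_. 0) \<in> cont_hermitian" by (simp add: cont_hermitian_def hermitian_0)
  ultimately show "0 \<in> Range_Gamma G" unfolding Range_Gamma_def by (rule image_eqI[OF sym])
next
  fix X Y assume "X \<in> Range_Gamma G" "Y \<in> Range_Gamma G"
  then obtain \<Phi> \<Psi> where 1: "\<Phi> \<in> cont_hermitian" "X = moment G \<Phi>" "\<Psi> \<in> cont_hermitian" "Y = moment G \<Psi>"
    unfolding Range_Gamma_def by blast
  have "moment G (\<lambda>z. \<Phi> z + \<Psi> z) = X + Y"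
    unfolding moment_def 1 using 1
    by (simp add: matrix_ring circle_integral_add circle_bounded_moment_integrand cont_hermitian_bounded)
  moreover have "(\<lambda>z. \<Phi> z + \<Psi> z) \<in> cont_hermitian"
    using 1 by (simp add: cont_hermitian_def hermitian_add continuous_on_add)
  ultimately show "X + Y \<in> Range_Gamma G" unfolding Range_Gamma_def by (rule image_eqI[OF sym])
next
  fix X :: "complex^'n^'n" and r :: real assume "X \<in> Range_Gamma G"
  then obtain \<Phi> where 1: "\<Phi> \<in> cont_hermitian" "X = moment G \<Phi>"
    unfolding Range_Gamma_def by blast
  have "moment G (\<lambda>z. r *\<^sub>R \<Phi> z) = r *\<^sub>R X"
    unfolding moment_def 1(2)
    using circle_integral_linear[OF bounded_linear_scaleR_right
        circle_bounded_moment_integrand[OF cont_hermitian_bounded[OF 1(1)]], of r]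
    by (simp add: matrix_ring)
  moreover have "(\<lambda>z. r *\<^sub>R \<Phi> z) \<in> cont_hermitian"
    using 1 by (simp add: cont_hermitian_def hermitian_scaleR continuous_on_scaleR)
  ultimately show "r *\<^sub>R X \<in> Range_Gamma G" unfolding Range_Gamma_def by (rule image_eqI[OF sym])
qed

lemma congr_fun_eq_0:
  assumes "b \<bullet> moment G (congr_fun G b) = 0" "cmod z = 1"
  shows "congr_fun G b z = 0"
proof -
  let ?f = "\<lambda>z. congr_fun G b z \<bullet> congr_fun G b z"
  have bnd: "circle_bounded ?f" by (intro circle_bounded_inner circle_bounded_congr_fun)
  have "circle_integral ?f = 0" using assms(1) inner_moment[OF circle_bounded_congr_fun] by simp
  then have "AE \<theta> in circle_measure. ?f (cis \<theta>) = 0"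
    by (intro circle_integral_zero_imp_AE bnd) auto
  then have "AE \<theta> in circle_measure. congr_fun G b (cis \<theta>) = 0" by simp
  then show ?thesis by (rule AE_circle_continuous[OF continuous_congr_fun _ assms(2)])
qed

lemma congr_fun_cont_hermitian: "hermitian b \<Longrightarrow> congr_fun G b \<in> cont_hermitian"
  unfolding cont_hermitian_def using continuous_congr_fun hermitian_congr by blast

text \<open>The range is already exhausted by continuous densities: a Hermitian matrix \<open>b\<close>
  orthogonal to it satisfies \<open>\<integral> \<parallel>G\<^sup>* b G\<parallel>\<^sup>2 = 0\<close>, hence is orthogonal to the moment of every
  bounded density.\<close>

lemma moment_in_Range_Gamma:
  assumes "circle_bounded \<Phi>" "\<And>z. cmod z = 1 \<Longrightarrow> hermitian (\<Phi> z)"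
  shows "moment G \<Phi> \<in> Range_Gamma G"
proof -
  have span: "span (Range_Gamma G) = Range_Gamma G"
    using subspace_Range_Gamma by (simp add: span_eq_iff)
  obtain a b where ab: "a \<in> span (Range_Gamma G)" "moment G \<Phi> = a + b"
    "\<And>w. w \<in> span (Range_Gamma G) \<Longrightarrow> orthogonal b w"
    using orthogonal_subspace_decomp_exists[of "Range_Gamma G" "moment G \<Phi>"] by metis
  have orth: "b \<bullet> w = 0" if "w \<in> Range_Gamma G" for w
    using ab(3) that span by (simp add: orthogonal_def)
  have "b = moment G \<Phi> - a" using ab by simp
  then have "hermitian b"
    using ab(1) span hermitian_moment[OF assms] hermitian_Range_Gamma by (simp add: hermitian_diff)
  then have "moment G (congr_fun G b) \<in> Range_Gamma G"
    unfolding Range_Gamma_def using congr_fun_cont_hermitian by blast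
  then have zero: "\<And>z. cmod z = 1 \<Longrightarrow> congr_fun G b z = 0"
    using congr_fun_eq_0 orth by blast
  have "b \<bullet> moment G \<Phi> = circle_integral (\<lambda>z. 0)"
    unfolding inner_moment[OF assms(1)] by (rule circle_integral_cong) (simp add: zero)
  then have "b \<bullet> b = 0" using orth[of a] ab(1,2) span by (simp add: inner_add_right)
  then show ?thesis using ab span by simp
qed

lemma Range_Gamma_eq_0:
  assumes "\<Lambda> \<in> Range_Gamma G" "\<And>z. cmod z = 1 \<Longrightarrow> congr_fun G \<Lambda> z = 0"
  shows "\<Lambda> = 0"
proof -
  obtain \<Phi> where \<Phi>: "\<Phi> \<in> cont_hermitian" "\<Lambda> = moment G \<Phi>"
    using assms(1) unfolding Range_Gamma_def by blast
  have "\<Lambda> \<bullet> moment G \<Phi> = circle_integral (\<lambda>z. 0)"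
    unfolding inner_moment[OF cont_hermitian_bounded[OF \<Phi>(1)]]
    by (rule circle_integral_cong) (simp add: assms(2))
  then show ?thesis using \<Phi>(2) by simp
qed

text \<open>The linear map \<open>\<Lambda> \<mapsto> \<integral> G (G\<^sup>* \<Lambda> G) G\<^sup>*\<close> is injective on the range, hence bounded below there
  by finite dimensionality; its values are controlled by \<open>\<integral> \<parallel>G\<^sup>* \<Lambda> G\<parallel>\<close>.\<close>

lemma Range_Gamma_norm_le:
  obtains C where "0 < C"
    "\<And>\<Lambda>. \<Lambda> \<in> Range_Gamma G \<Longrightarrow> norm \<Lambda> \<le> C * circle_integral (\<lambda>z. norm (congr_fun G \<Lambda> z))"
proof -
  let ?f = "\<lambda>\<Lambda>. moment G (congr_fun G \<Lambda>)"
  have lin: "linear ?f"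
  proof (rule linearI)
    show "?f (X + Y) = ?f X + ?f Y" for X Y
    proof -
      have "(\<lambda>z. G z ** congr_fun G (X + Y) z ** ctransp (G z)) =
          (\<lambda>z. G z ** congr_fun G X z ** ctransp (G z) + G z ** congr_fun G Y z ** ctransp (G z))"
        by (simp only: matrix_ring)
      then show ?thesis unfolding moment_def
        by (simp only: circle_integral_add circle_bounded_moment_integrand circle_bounded_congr_fun)
    qed
    show "?f (r *\<^sub>R X) = r *\<^sub>R ?f X" for r X
    proof -
      have "(\<lambda>z. G z ** congr_fun G (r *\<^sub>R X) z ** ctransp (G z)) =
          (\<lambda>z. r *\<^sub>R (G z ** congr_fun G X z ** ctransp (G z)))"
        by (simp only: matrix_ring)
      then show ?thesis unfolding moment_def
        using circle_integral_linear[OF bounded_linear_scaleR_right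
            circle_bounded_moment_integrand[OF circle_bounded_congr_fun[of X]], of r] by simp
    qed
  qed
  have inj: "X = 0" if "X \<in> Range_Gamma G" "?f X = 0" for X
    using that congr_fun_eq_0[of X] by (intro Range_Gamma_eq_0) auto
  obtain e where e: "0 < e" "\<And>X. X \<in> Range_Gamma G \<Longrightarrow> e * norm X \<le> norm (?f X)"
    using injective_imp_isometric[OF closed_subspace[OF subspace_Range_Gamma] subspace_Range_Gamma
        linear_conv_bounded_linear[THEN iffD1, OF lin]] inj by blast
  obtain g where g: "0 < g" "\<And>z. cmod z = 1 \<Longrightarrow> norm (G z) \<le> g"
    using circle_bounded_G by (rule circle_boundedE) blast
  have le: "norm (?f X) \<le> (g * g) * circle_integral (\<lambda>z. norm (congr_fun G X z))" for X
  proof -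
    have b: "circle_bounded (\<lambda>z. norm (congr_fun G X z))"
      by (intro circle_bounded_norm circle_bounded_congr_fun)
    have "norm (?f X) \<le> circle_integral (\<lambda>z. norm (G z ** congr_fun G X z ** ctransp (G z)))"
      unfolding moment_def circle_integral_def by (rule integral_norm_bound)
    also have "\<dots> \<le> circle_integral (\<lambda>z. (g * g) *\<^sub>R norm (congr_fun G X z))"
    proof (rule circle_integral_mono)
      fix z :: complex assume z: "cmod z = 1"
      have "norm (G z ** congr_fun G X z ** ctransp (G z)) \<le>
          (norm (G z) * norm (congr_fun G X z)) * norm (ctransp (G z))"
        by (intro order_trans[OF norm_matrix_mult] mult_right_mono norm_matrix_mult) simp
      also have "\<dots> \<le> (g * norm (congr_fun G X z)) * g"
        using g z by (intro mult_mono) auto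
      finally show "norm (G z ** congr_fun G X z ** ctransp (G z)) \<le> (g * g) *\<^sub>R norm (congr_fun G X z)"
        by (simp add: ac_simps)
    qed (intro circle_bounded_intros circle_bounded_congr_fun circle_bounded_G b)+
    also have "\<dots> = (g * g) * circle_integral (\<lambda>z. norm (congr_fun G X z))"
      using circle_integral_linear[OF bounded_linear_scaleR_right b, of "g * g"] by simp
    finally show ?thesis .
  qed
  show thesis
  proof (rule that[of "g * g / e"])
    show "0 < g * g / e" using e g by simp
    fix X assume "X \<in> Range_Gamma G"
    then have "e * norm X \<le> (g * g) * circle_integral (\<lambda>z. norm (congr_fun G X z))"
      using e(2) le order_trans by blast
    then show "norm X \<le> g * g / e * circle_integral (\<lambda>z. norm (congr_fun G X z))"
      using e(1) by (simp add: field_simps)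
  qed
qed

end

section \<open>The pencil and its inverse\<close>

lemma inv_diff:
  assumes "posdef P" "posdef Q"
  shows "matrix_inv P - matrix_inv Q = matrix_inv P ** (Q - P) ** matrix_inv Q"
proof -
  have "matrix_inv P ** (Q - P) ** matrix_inv Q =
      matrix_inv P ** (Q ** matrix_inv Q) - (matrix_inv P ** P) ** matrix_inv Q"
    by (simp only: matrix_diff_ldistrib matrix_diff_rdistrib matrix_mul_assoc)
  also have "\<dots> = matrix_inv P - matrix_inv Q"
    by (simp add: posdef_inv_left[OF assms(1)] posdef_inv_right[OF assms(2)])
  finally show ?thesis ..
qed

lemma norm_cis_diff_le: "cmod (cis t - cis s) \<le> \<bar>t - s\<bar>"
proof -
  have "cis t - cis s = cis s * (cis (t - s) - 1)"
    by (simp add: right_diff_distrib cis_mult)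
  then have "cmod (cis t - cis s) = cmod (exp (\<i> * of_real (t - s)) - 1)"
    by (simp add: norm_mult cis_conv_exp)
  also have "\<dots> = 2 * \<bar>sin ((t - s) / 2)\<bar>" by (rule dist_exp_i_1)
  also have "\<dots> \<le> 2 * \<bar>(t - s) / 2\<bar>" by (intro mult_left_mono abs_sin_x_le_abs_x) simp
  finally show ?thesis by simp
qed

lemma coercive_perturb:
  assumes "coercive (2 * c) Q" "hermitian P" "norm (P - Q) \<le> c"
  shows "coercive c P"
  unfolding coercive_def
proof (intro conjI allI assms(2))
  fix x :: "complex^'a"
  have "2 * c * (norm x)\<^sup>2 \<le> x \<bullet> (Q *v x)" using assms(1) by (simp add: coercive_def)
  moreover have "x \<bullet> ((Q - P) *v x) \<le> norm (Q - P) * (norm x)\<^sup>2" by (rule coercive_upper)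
  moreover have "norm (Q - P) * (norm x)\<^sup>2 \<le> c * (norm x)\<^sup>2"
    using assms(3) by (intro mult_right_mono) (simp_all add: norm_minus_commute)
  ultimately show "c * (norm x)\<^sup>2 \<le> x \<bullet> (P *v x)"
    by (simp add: matrix_vector_mult_diff_rdistrib inner_diff_right)
qed

context moment_map
begin

lemma dual_pencil_diff: "dual_pencil G \<Lambda>' z - dual_pencil G \<Lambda> z = congr_fun G (\<Lambda>' - \<Lambda>) z"
  by (simp add: dual_pencil_def matrix_ring)

lemma hermitian_dual_pencil: "hermitian \<Lambda> \<Longrightarrow> hermitian (dual_pencil G \<Lambda> z)"
  unfolding dual_pencil_def by (intro hermitian_add hermitian_mat1 hermitian_congr)

lemma L_H_posdef: "\<Lambda> \<in> L_H G \<Longrightarrow> cmod z = 1 \<Longrightarrow> posdef (dual_pencil G \<Lambda> z)"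
  by (simp add: L_H_def)

lemma L_H_hermitian: "\<Lambda> \<in> L_H G \<Longrightarrow> hermitian \<Lambda>"
  by (simp add: L_H_def)

lemma L_H_coercive:
  assumes "\<Lambda> \<in> L_H G"
  obtains c where "0 < c" "\<And>z. cmod z = 1 \<Longrightarrow> coercive c (dual_pencil G \<Lambda> z)"
  using posdef_circle_coercive[OF continuous_dual_pencil L_H_posdef[OF assms]] that by blast

lemma continuous_inv_pencil:
  assumes "\<Lambda> \<in> L_H G" shows "continuous_on (sphere 0 1) (\<lambda>z. matrix_inv (dual_pencil G \<Lambda> z))"
proof (rule continuous_on_matrix_inv[OF continuous_dual_pencil])
  fix z x assume "z \<in> sphere 0 1" "dual_pencil G \<Lambda> z *v x = 0"
  then show "x = 0" using L_H_posdef[OF assms, of z] posdef_ker by simp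
qed

lemma circle_bounded_dual_pencil: "circle_bounded (dual_pencil G \<Lambda>)"
  by (rule circle_bounded_continuous[OF continuous_dual_pencil])

lemma circle_bounded_inv_pencil:
  "\<Lambda> \<in> L_H G \<Longrightarrow> circle_bounded (\<lambda>z. matrix_inv (dual_pencil G \<Lambda> z))"
  by (rule circle_bounded_continuous[OF continuous_inv_pencil])

text \<open>The set \<open>\<L>\<^sup>H\<close> is relatively open, and inversion is Lipschitz near each of its points,
  uniformly on the circle. Both follow from a common coercivity constant for nearby pencils.\<close>

lemma inv_pencil_lipschitz:
  assumes \<Lambda>: "\<Lambda> \<in> L_H G"
  obtains \<delta> K where "0 < \<delta>" "0 < K"
    "\<And>\<Lambda>'. hermitian \<Lambda>' \<Longrightarrow> norm (\<Lambda>' - \<Lambda>) < \<delta> \<Longrightarrow> \<Lambda>' \<in> L_H G"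
    "\<And>\<Lambda>' z. hermitian \<Lambda>' \<Longrightarrow> norm (\<Lambda>' - \<Lambda>) < \<delta> \<Longrightarrow> cmod z = 1 \<Longrightarrow>
      norm (matrix_inv (dual_pencil G \<Lambda>' z) - matrix_inv (dual_pencil G \<Lambda> z)) \<le> K * norm (\<Lambda>' - \<Lambda>)"
proof -
  obtain c0 where c0: "0 < c0" "\<And>z. cmod z = 1 \<Longrightarrow> coercive c0 (dual_pencil G \<Lambda> z)"
    using L_H_coercive[OF \<Lambda>] by blast
  define c where "c = c0 / 2"
  have c: "0 < c" "\<And>z. cmod z = 1 \<Longrightarrow> coercive (2 * c) (dual_pencil G \<Lambda> z)"
    using c0 by (simp_all add: c_def)
  obtain g where g: "0 < g" "\<And>\<Lambda> z. cmod z = 1 \<Longrightarrow> norm (congr_fun G \<Lambda> z) \<le> g * norm \<Lambda>"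
    by (rule congr_fun_bound) blast
  define u where "u = norm (mat 1 :: complex^'m^'m)"
  have co: "coercive c (dual_pencil G \<Lambda>' z)"
    if "hermitian \<Lambda>'" "norm (\<Lambda>' - \<Lambda>) < c / g" "cmod z = 1" for \<Lambda>' z
  proof (rule coercive_perturb[OF c(2)[OF that(3)] hermitian_dual_pencil[OF that(1)]])
    have "norm (congr_fun G (\<Lambda>' - \<Lambda>) z) \<le> g * norm (\<Lambda>' - \<Lambda>)" by (rule g(2)[OF that(3)])
    also have "\<dots> \<le> c" using that(2) g(1) by (simp add: field_simps)
    finally show "norm (dual_pencil G \<Lambda>' z - dual_pencil G \<Lambda> z) \<le> c" by (simp only: dual_pencil_diff)
  qed
  show thesis
  proof (rule that[of "c / g" "u / c * g * (u / c) + 1"])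
    show "0 < c / g" using c g by simp
    have "0 \<le> u" by (simp add: u_def)
    then show "0 < u / c * g * (u / c) + 1"
      using c(1) g(1) by (intro add_nonneg_pos mult_nonneg_nonneg divide_nonneg_nonneg) auto
    fix \<Lambda>' assume h: "hermitian \<Lambda>'" "norm (\<Lambda>' - \<Lambda>) < c / g"
    have "posdef (dual_pencil G \<Lambda>' z)" if "cmod z = 1" for z
      by (rule coercive_imp_posdef[OF co[OF h that] c(1)])
    then show "\<Lambda>' \<in> L_H G" unfolding L_H_def using h by simp
    fix z :: complex assume z: "cmod z = 1"
    let ?P = "dual_pencil G \<Lambda>' z" and ?Q = "dual_pencil G \<Lambda> z"
    have coP: "coercive c ?P" by (rule co[OF h z])
    have coQ: "coercive c ?Q" using c(2)[OF z] by (rule coercive_mono) (use c(1) in simp)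
    have bP: "norm (matrix_inv ?P) \<le> u / c" unfolding u_def by (rule norm_inv_le[OF coP c(1)])
    have bQ: "norm (matrix_inv ?Q) \<le> u / c" unfolding u_def by (rule norm_inv_le[OF coQ c(1)])
    have "norm (?Q - ?P) \<le> g * norm (\<Lambda>' - \<Lambda>)"
      using g(2)[OF z, of "\<Lambda> - \<Lambda>'"] by (simp only: dual_pencil_diff norm_minus_commute)
    then have "norm (matrix_inv ?P ** (?Q - ?P) ** matrix_inv ?Q) \<le> u / c * (g * norm (\<Lambda>' - \<Lambda>)) * (u / c)"
      using bP bQ g(1) \<open>0 \<le> u\<close> c(1)
      by (intro order_trans[OF norm_matrix_mult] mult_mono) auto
    then show "norm (matrix_inv ?P - matrix_inv ?Q) \<le> (u / c * g * (u / c) + 1) * norm (\<Lambda>' - \<Lambda>)"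
      unfolding inv_diff[OF coercive_imp_posdef[OF coP c(1)] coercive_imp_posdef[OF coQ c(1)]]
      by (rule order_trans) (simp add: algebra_simps)
  qed
qed

text \<open>From a zero of \<open>v\<^sup>* (I + G\<^sup>* \<Lambda> G) v\<close> on the circle this function grows at most linearly, so
  its reciprocal, a lower bound of the trace of the inverse, is not integrable.
  Hence a bound on these integrals keeps a sequence away from the boundary of \<open>\<L>\<^sup>H\<close>.\<close>

lemma limit_in_L_H:
  assumes X: "\<And>k. X k \<in> L_H G" "X \<longlonglongrightarrow> \<Lambda>"
    and C: "\<And>k. circle_integral (\<lambda>z. mat 1 \<bullet> matrix_inv (dual_pencil G (X k) z)) \<le> C"
  shows "\<Lambda> \<in> L_H G"
proof -
  have "(\<lambda>k. ctransp (X k)) \<longlonglongrightarrow> ctransp \<Lambda>" by (intro tendsto_intros X)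
  then have herm: "hermitian \<Lambda>"
    using X L_H_hermitian by (simp add: hermitian_def LIMSEQ_unique)
  obtain g where g: "0 < g" "\<And>\<Lambda> z. cmod z = 1 \<Longrightarrow> norm (congr_fun G \<Lambda> z) \<le> g * norm \<Lambda>"
    by (rule congr_fun_bound) blast
  obtain b where b: "0 < b" "\<And>z. cmod z = 1 \<Longrightarrow> norm (G z) \<le> b"
    using circle_bounded_G by (rule circle_boundedE) blast
  have "posdef (dual_pencil G \<Lambda> z\<^sub>0)" if z\<^sub>0: "cmod z\<^sub>0 = 1" for z\<^sub>0
  proof (rule ccontr)
    assume "\<not> posdef (dual_pencil G \<Lambda> z\<^sub>0)"
    then obtain w where w: "w \<noteq> 0" "w \<bullet> (dual_pencil G \<Lambda> z\<^sub>0 *v w) \<le> 0"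
      using hermitian_dual_pencil[OF herm] unfolding posdef_iff by (meson not_le)
    define v where "v = (1 / norm w) *\<^sub>R w"
    have v1: "norm v = 1" using w by (simp add: v_def)
    have v: "v \<bullet> (dual_pencil G \<Lambda> z\<^sub>0 *v v) \<le> 0"
      using w by (simp add: v_def scaleR_matrix_vector_right mult_nonneg_nonpos divide_nonpos_nonneg)
    \<comment> \<open>The summand \<open>1\<close> only serves to make the Lipschitz constant positive.\<close>
    define K where "K = 2 * b * norm \<Lambda> * L + 1"
    have K: "0 < K" unfolding K_def using b L_pos by (intro add_nonneg_pos mult_nonneg_nonneg) auto
    define a where "a = Arg z\<^sub>0"
    have a: "-pi < a" "a \<le> pi" "cis a = z\<^sub>0"
      unfolding a_def using mpi_less_Arg Arg_le_pi cis_Arg_unit[OF z\<^sub>0] by auto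
    have lip: "v \<bullet> (dual_pencil G \<Lambda> z *v v) \<le> K * cmod (z - z\<^sub>0)" if z: "cmod z = 1" for z
    proof -
      define E where "E = G z - G z\<^sub>0"
      have "dual_pencil G \<Lambda> z - dual_pencil G \<Lambda> z\<^sub>0 =
          ctransp (G z) ** \<Lambda> ** E + ctransp E ** \<Lambda> ** G z\<^sub>0"
        by (simp add: dual_pencil_def E_def matrix_ring ctransp_diff)
      also have "norm \<dots> \<le> b * norm \<Lambda> * norm E + norm E * norm \<Lambda> * b"
        using b(2)[OF z] b(2)[OF z\<^sub>0] b(1)
        by (intro order_trans[OF norm_triangle_ineq] add_mono order_trans[OF norm_matrix_mult]
            mult_mono) auto
      also have "\<dots> = 2 * b * norm \<Lambda> * norm E" by (simp add: algebra_simps)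
      also have "\<dots> \<le> 2 * b * norm \<Lambda> * (L * cmod (z - z\<^sub>0))"
        unfolding E_def using b(1) by (intro mult_left_mono lipschitz_G z z\<^sub>0) auto
      also have "\<dots> \<le> K * cmod (z - z\<^sub>0)" unfolding K_def by (simp add: algebra_simps)
      finally have "norm (dual_pencil G \<Lambda> z - dual_pencil G \<Lambda> z\<^sub>0) \<le> K * cmod (z - z\<^sub>0)" .
      moreover have "v \<bullet> ((dual_pencil G \<Lambda> z - dual_pencil G \<Lambda> z\<^sub>0) *v v) \<le>
          norm (dual_pencil G \<Lambda> z - dual_pencil G \<Lambda> z\<^sub>0)"
        using coercive_upper[of v "dual_pencil G \<Lambda> z - dual_pencil G \<Lambda> z\<^sub>0"] v1 by simp
      ultimately show ?thesis
        using v by (simp add: matrix_vector_mult_diff_rdistrib inner_diff_right)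
    qed
    \<comment> \<open>Solving the divergent lower bound of the integrals for the deviation of \<open>X k\<close> from \<open>\<Lambda>\<close>
      shows that this deviation is bounded away from zero.\<close>
    have "\<forall>k. exp (ln (K * (a + pi)) - 2 * pi * K * C) \<le> g * norm (X k - \<Lambda>) + 1 / real (Suc k)"
    proof
      fix k
      define e where "e = g * norm (X k - \<Lambda>) + 1 / real (Suc k)"
      have e: "0 < e" unfolding e_def using g(1) by (intro add_nonneg_pos mult_nonneg_nonneg) auto
      let ?h = "\<lambda>\<theta>. 1 / (K * \<bar>\<theta> - a\<bar> + e)"
      have le: "?h \<theta> \<le> mat 1 \<bullet> matrix_inv (dual_pencil G (X k) (cis \<theta>))" for \<theta>
      proof -
        let ?Q = "dual_pencil G (X k) (cis \<theta>)"
        have pd: "posdef ?Q" using X(1) by (rule L_H_posdef) simp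
        have "v \<noteq> 0" using v1 by auto
        then have pos: "0 < v \<bullet> (?Q *v v)" using pd by (simp add: posdef_iff)
        have "v \<bullet> ((?Q - dual_pencil G \<Lambda> (cis \<theta>)) *v v) \<le> norm (?Q - dual_pencil G \<Lambda> (cis \<theta>))"
          using coercive_upper[of v "?Q - dual_pencil G \<Lambda> (cis \<theta>)"] v1 by simp
        also have "\<dots> \<le> g * norm (X k - \<Lambda>)"
          unfolding dual_pencil_diff by (rule g(2)) simp
        also have "\<dots> \<le> e" by (simp add: e_def)
        finally have "v \<bullet> (?Q *v v) \<le> v \<bullet> (dual_pencil G \<Lambda> (cis \<theta>) *v v) + e"
          by (simp add: matrix_vector_mult_diff_rdistrib inner_diff_right)
        also have "\<dots> \<le> K * cmod (cis \<theta> - cis a) + e" using lip[of "cis \<theta>"] a(3) by simp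
        also have "\<dots> \<le> K * \<bar>\<theta> - a\<bar> + e"
          using K by (intro add_right_mono mult_left_mono norm_cis_diff_le) auto
        finally have "1 / (K * \<bar>\<theta> - a\<bar> + e) \<le> 1 / (v \<bullet> (?Q *v v))"
          using pos by (intro divide_left_mono) (auto intro: mult_pos_pos less_le_trans)
        also have "\<dots> \<le> mat 1 \<bullet> matrix_inv ?Q" by (rule inv_trace_ge[OF pd v1])
        finally show ?thesis .
      qed
      have cont: "continuous_on UNIV ?h"
      proof (intro continuous_intros ballI)
        fix \<theta> show "K * \<bar>\<theta> - a\<bar> + e \<noteq> 0"
          using add_nonneg_pos[of "K * \<bar>\<theta> - a\<bar>" e] K e by simp
      qed
      have "integral\<^sup>L circle_measure ?h \<le> circle_integral (\<lambda>z. mat 1 \<bullet> matrix_inv (dual_pencil G (X k) z))"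
        unfolding circle_integral_def
      proof (rule integral_mono)
        have "norm (?h \<theta>) \<le> 1 / e" for \<theta>
        proof -
          have "e \<le> K * \<bar>\<theta> - a\<bar> + e" using K by simp
          then show ?thesis using e by (simp add: divide_left_mono)
        qed
        then show "integrable circle_measure ?h"
          by (intro finite_measure.integrable_const_bound[OF finite_measure_circle, of _ "1 / e"]
              continuous_borel_circle[OF cont]) simp
        show "integrable circle_measure (\<lambda>\<theta>. mat 1 \<bullet> matrix_inv (dual_pencil G (X k) (cis \<theta>)))"
          by (rule circle_bounded_integrable)
            (intro circle_bounded_intros circle_bounded_inv_pencil X(1))
      qed (rule le)
      then have "(ln (K * (a + pi)) - ln e) / (2 * pi * K) \<le> C"
        using integral_reciprocal_ge[OF K e a(1,2)] C[of k] by linarith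
      then have "ln (K * (a + pi)) - 2 * pi * K * C \<le> ln e"
        using K by (simp add: field_simps)
      then show "exp (ln (K * (a + pi)) - 2 * pi * K * C) \<le> g * norm (X k - \<Lambda>) + 1 / real (Suc k)"
        unfolding e_def[symmetric] using e by (metis exp_ln exp_le_cancel_iff)
    qed
    moreover have "(\<lambda>k. g * norm (X k - \<Lambda>) + 1 / real (Suc k)) \<longlonglongrightarrow> g * norm (\<Lambda> - \<Lambda>) + 0"
      by (intro tendsto_intros X LIMSEQ_Suc[OF lim_1_over_n])
    ultimately have "exp (ln (K * (a + pi)) - 2 * pi * K * C) \<le> g * norm (\<Lambda> - \<Lambda>) + 0"
      by (intro LIMSEQ_le_const) auto
    then show False by simp
  qed
  then show ?thesis using herm by (simp add: L_H_def)
qed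

end

lemma inner_congr_hermitian:
  assumes "hermitian X" "hermitian Y"
  shows "M \<bullet> (X ** D ** Y) = D \<bullet> (X ** M ** Y)"
proof -
  have "M \<bullet> (X ** D ** Y) = (M ** Y) \<bullet> (X ** D)"
    by (simp add: inner_matrix_right' hermitianD[OF assms(2)])
  also have "\<dots> = (X ** M ** Y) \<bullet> D"
    by (simp add: inner_matrix_left' hermitianD[OF assms(1)] matrix_mul_assoc)
  finally show ?thesis by (simp add: inner_commute)
qed

lemma norm_mult3_le:
  "norm X \<le> a \<Longrightarrow> norm Y \<le> b \<Longrightarrow> norm Z \<le> c \<Longrightarrow> norm (X ** Y ** Z) \<le> a * b * c"
  for X Y Z :: "complex^'a^'a"
  by (intro order_trans[OF norm_matrix_mult] mult_mono)
    (auto intro: order_trans[OF norm_ge_zero] mult_nonneg_nonneg)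

lemma spectral_densities_bounded: "\<Phi> \<in> spectral_densities \<Longrightarrow> circle_bounded \<Phi>"
  by (simp add: spectral_densities_def circle_bounded_def)

lemma spectral_densities_coercive:
  assumes "\<Phi> \<in> spectral_densities"
  obtains c where "0 < c" "AE \<theta> in circle_measure. coercive c (\<Phi> (cis \<theta>))"
proof -
  obtain c where "0 < c" "AE \<theta> in circle_measure. posdef (\<Phi> (cis \<theta>) - mat (complex_of_real c))"
    using assms unfolding spectral_densities_def by blast
  moreover from this(2) have "AE \<theta> in circle_measure. coercive c (\<Phi> (cis \<theta>))"
    by (rule eventually_mono) (rule posdef_diff_imp_coercive)
  ultimately show thesis using that by blast
qed

section \<open>The dual problem\<close>

text \<open>The density \<open>\<Phi>\<^sub>0\<close> is a strictly feasible point of the approximation problem.\<close>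

locale hellinger_problem = moment_map G L
  for G :: "complex \<Rightarrow> complex^'m^'n" and L :: real +
  fixes \<Psi> \<Phi>\<^sub>0 :: "complex \<Rightarrow> complex^'m^'m"
  assumes \<Psi>: "\<Psi> \<in> spectral_densities"
    and \<Phi>\<^sub>0: "continuous_on (sphere 0 1) \<Phi>\<^sub>0" "\<And>z. cmod z = 1 \<Longrightarrow> posdef (\<Phi>\<^sub>0 z)"
    and moment_\<Phi>\<^sub>0: "moment G \<Phi>\<^sub>0 = mat 1"
begin

abbreviation inv_pencil :: "complex^'n^'n \<Rightarrow> complex \<Rightarrow> complex^'m^'m" where
  "inv_pencil \<Lambda> z \<equiv> matrix_inv (dual_pencil G \<Lambda> z)"

lemmas circle_bounded_\<Psi> = spectral_densities_bounded[OF \<Psi>]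
lemmas coercive_\<Psi> = spectral_densities_coercive[OF \<Psi>]

lemma psd_\<Psi>: "cmod z = 1 \<Longrightarrow> psd (\<Psi> z)"
  using \<Psi> by (simp add: spectral_densities_def)

lemma circle_bounded_\<Psi>_inv:
  "\<Lambda> \<in> L_H G \<Longrightarrow> circle_bounded (\<lambda>z. \<Psi> z \<bullet> inv_pencil \<Lambda> z)"
  by (intro circle_bounded_inner circle_bounded_\<Psi> circle_bounded_inv_pencil)

lemma circle_bounded_\<Phi>\<^sub>0: "circle_bounded \<Phi>\<^sub>0"
  by (rule circle_bounded_continuous[OF \<Phi>\<^sub>0(1)])

lemma L_Gamma_HD: "\<Lambda> \<in> L_Gamma_H G \<Longrightarrow> \<Lambda> \<in> L_H G" "\<Lambda> \<in> L_Gamma_H G \<Longrightarrow> \<Lambda> \<in> Range_Gamma G"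
  by (simp_all add: L_Gamma_H_def)

lemma mat_1_in_Range: "mat 1 \<in> Range_Gamma G"
  unfolding moment_\<Phi>\<^sub>0[symmetric]
  by (intro moment_in_Range_Gamma circle_bounded_\<Phi>\<^sub>0) (use \<Phi>\<^sub>0(2) in \<open>simp add: posdef_iff\<close>)

text \<open>This is the negative of the Lagrange dual of the approximation problem, without the constant
  \<open>\<integral> tr \<Psi>\<close>.\<close>

definition dual_fun :: "complex^'n^'n \<Rightarrow> real" where
  "dual_fun \<Lambda> = circle_integral (\<lambda>z. \<Psi> z \<bullet> inv_pencil \<Lambda> z) + mat 1 \<bullet> \<Lambda>"

lemma integral_\<Psi>_inv_nonneg:
  assumes "\<Lambda> \<in> L_H G" shows "0 \<le> circle_integral (\<lambda>z. \<Psi> z \<bullet> inv_pencil \<Lambda> z)"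
proof -
  have "circle_integral (\<lambda>_. 0) \<le> circle_integral (\<lambda>z. \<Psi> z \<bullet> inv_pencil \<Lambda> z)"
    by (intro circle_integral_mono circle_bounded_const circle_bounded_\<Psi>_inv assms
        inner_psd_nonneg psd_\<Psi> posdef_inv L_H_posdef)
  then show ?thesis by simp
qed

text \<open>Pairing \<open>\<Lambda>\<close> with the feasible density \<open>\<Phi>\<^sub>0\<close> turns the linear term of the dual functional
  into \<open>\<integral> tr ((I + G\<^sup>* \<Lambda> G) \<Phi>\<^sub>0)\<close> up to a constant, which controls the size of \<open>\<Lambda>\<close>.\<close>

lemma trace_lower_bound:
  obtains c k where "0 < c"
    "\<And>\<Lambda>. \<Lambda> \<in> L_H G \<Longrightarrow> c * circle_integral (\<lambda>z. norm (dual_pencil G \<Lambda> z)) - k \<le> mat 1 \<bullet> \<Lambda>"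
proof -
  obtain c where c: "0 < c" "\<And>z. cmod z = 1 \<Longrightarrow> coercive c (\<Phi>\<^sub>0 z)"
    using posdef_circle_coercive[OF \<Phi>\<^sub>0] by blast
  define k where "k = circle_integral (\<lambda>z. mat 1 \<bullet> \<Phi>\<^sub>0 z)"
  have "c * circle_integral (\<lambda>z. norm (dual_pencil G \<Lambda> z)) - k \<le> mat 1 \<bullet> \<Lambda>" if \<Lambda>: "\<Lambda> \<in> L_H G" for \<Lambda>
  proof -
    have b: "circle_bounded (\<lambda>z. norm (dual_pencil G \<Lambda> z))"
      by (intro circle_bounded_norm circle_bounded_dual_pencil)
    have "mat 1 \<bullet> \<Lambda> = \<Lambda> \<bullet> moment G \<Phi>\<^sub>0" by (simp add: moment_\<Phi>\<^sub>0 inner_commute)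
    also have "\<dots> = circle_integral (\<lambda>z. congr_fun G \<Lambda> z \<bullet> \<Phi>\<^sub>0 z)"
      by (rule inner_moment[OF circle_bounded_\<Phi>\<^sub>0])
    also have "\<dots> = circle_integral (\<lambda>z. dual_pencil G \<Lambda> z \<bullet> \<Phi>\<^sub>0 z - mat 1 \<bullet> \<Phi>\<^sub>0 z)"
      by (simp add: dual_pencil_def inner_add_left)
    also have "\<dots> = circle_integral (\<lambda>z. dual_pencil G \<Lambda> z \<bullet> \<Phi>\<^sub>0 z) - k"
      unfolding k_def
      by (intro circle_integral_diff circle_bounded_intros circle_bounded_dual_pencil circle_bounded_\<Phi>\<^sub>0)
    finally have e: "mat 1 \<bullet> \<Lambda> = circle_integral (\<lambda>z. dual_pencil G \<Lambda> z \<bullet> \<Phi>\<^sub>0 z) - k" .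
    have "c * circle_integral (\<lambda>z. norm (dual_pencil G \<Lambda> z)) =
        circle_integral (\<lambda>z. c *\<^sub>R norm (dual_pencil G \<Lambda> z))"
      using circle_integral_linear[OF bounded_linear_scaleR_right b, of c] by simp
    also have "\<dots> \<le> circle_integral (\<lambda>z. dual_pencil G \<Lambda> z \<bullet> \<Phi>\<^sub>0 z)"
    proof (rule circle_integral_mono)
      fix z :: complex assume z: "cmod z = 1"
      have pd: "posdef (dual_pencil G \<Lambda> z)" using \<Lambda> z by (rule L_H_posdef)
      have "c * norm (dual_pencil G \<Lambda> z) \<le> c * (mat 1 \<bullet> dual_pencil G \<Lambda> z)"
        using c(1) norm_le_trace[OF pd] by (intro mult_left_mono) auto
      also have "\<dots> \<le> \<Phi>\<^sub>0 z \<bullet> dual_pencil G \<Lambda> z"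
        by (rule inner_coercive_ge[OF _ pd]) (use c(2)[of z] z in \<open>simp add: coercive_def\<close>)
      finally show "c *\<^sub>R norm (dual_pencil G \<Lambda> z) \<le> dual_pencil G \<Lambda> z \<bullet> \<Phi>\<^sub>0 z"
        by (simp add: inner_commute)
    qed (intro circle_bounded_intros b circle_bounded_dual_pencil circle_bounded_\<Phi>\<^sub>0)+
    finally show ?thesis using e by simp
  qed
  then show thesis using that c(1) by blast
qed

lemma dual_sublevel_bounded:
  obtains R where "\<And>\<Lambda>. \<Lambda> \<in> L_Gamma_H G \<Longrightarrow> dual_fun \<Lambda> \<le> M \<Longrightarrow> norm \<Lambda> \<le> R"
proof -
  obtain c k where ck: "0 < c"
    "\<And>\<Lambda>. \<Lambda> \<in> L_H G \<Longrightarrow> c * circle_integral (\<lambda>z. norm (dual_pencil G \<Lambda> z)) - k \<le> mat 1 \<bullet> \<Lambda>"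
    by (rule trace_lower_bound) blast
  obtain C where C: "0 < C"
    "\<And>\<Lambda>. \<Lambda> \<in> Range_Gamma G \<Longrightarrow> norm \<Lambda> \<le> C * circle_integral (\<lambda>z. norm (congr_fun G \<Lambda> z))"
    by (rule Range_Gamma_norm_le) blast
  define u where "u = norm (mat 1 :: complex^'m^'m)"
  have "norm \<Lambda> \<le> C * ((M + k) / c + u)" if \<Lambda>: "\<Lambda> \<in> L_Gamma_H G" "dual_fun \<Lambda> \<le> M" for \<Lambda>
  proof -
    note LH = L_Gamma_HD(1)[OF \<Lambda>(1)]
    have b: "circle_bounded (\<lambda>z. norm (dual_pencil G \<Lambda> z))"
      by (intro circle_bounded_norm circle_bounded_dual_pencil)
    have "mat 1 \<bullet> \<Lambda> \<le> M" using \<Lambda>(2) integral_\<Psi>_inv_nonneg[OF LH] by (simp add: dual_fun_def)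
    then have q: "circle_integral (\<lambda>z. norm (dual_pencil G \<Lambda> z)) \<le> (M + k) / c"
      using ck(2)[OF LH] ck(1) by (simp add: field_simps)
    have "circle_integral (\<lambda>z. norm (congr_fun G \<Lambda> z)) \<le>
        circle_integral (\<lambda>z. norm (dual_pencil G \<Lambda> z) + u)"
    proof (rule circle_integral_mono)
      show "norm (congr_fun G \<Lambda> z) \<le> norm (dual_pencil G \<Lambda> z) + u" for z
        using norm_triangle_ineq4[of "dual_pencil G \<Lambda> z" "mat 1"]
        by (simp add: dual_pencil_def u_def)
    qed (intro circle_bounded_intros circle_bounded_congr_fun b)+
    also have "\<dots> = circle_integral (\<lambda>z. norm (dual_pencil G \<Lambda> z)) + u"
      by (simp add: circle_integral_add[OF b circle_bounded_const])
    also have "\<dots> \<le> (M + k) / c + u" using q by simp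
    finally have "C * circle_integral (\<lambda>z. norm (congr_fun G \<Lambda> z)) \<le> C * ((M + k) / c + u)"
      using C(1) by (intro mult_left_mono) auto
    then show ?thesis using C(2)[OF L_Gamma_HD(2)[OF \<Lambda>(1)]] by linarith
  qed
  then show thesis by (rule that)
qed

lemma dual_fun_lipschitz:
  assumes \<Lambda>: "\<Lambda> \<in> L_H G"
  obtains \<delta> C where "0 < \<delta>" "0 \<le> C"
    "\<And>\<Lambda>'. hermitian \<Lambda>' \<Longrightarrow> norm (\<Lambda>' - \<Lambda>) < \<delta> \<Longrightarrow> \<bar>dual_fun \<Lambda>' - dual_fun \<Lambda>\<bar> \<le> C * norm (\<Lambda>' - \<Lambda>)"
proof -
  obtain \<delta> K where dK: "0 < \<delta>" "0 < K"
    "\<And>\<Lambda>'. hermitian \<Lambda>' \<Longrightarrow> norm (\<Lambda>' - \<Lambda>) < \<delta> \<Longrightarrow> \<Lambda>' \<in> L_H G"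
    "\<And>\<Lambda>' z. hermitian \<Lambda>' \<Longrightarrow> norm (\<Lambda>' - \<Lambda>) < \<delta> \<Longrightarrow> cmod z = 1 \<Longrightarrow>
      norm (inv_pencil \<Lambda>' z - inv_pencil \<Lambda> z) \<le> K * norm (\<Lambda>' - \<Lambda>)"
    using inv_pencil_lipschitz[OF \<Lambda>] by blast
  obtain b where b: "0 < b" "\<And>z. cmod z = 1 \<Longrightarrow> norm (\<Psi> z) \<le> b"
    using circle_bounded_\<Psi> by (rule circle_boundedE) blast
  define u where "u = norm (mat 1 :: complex^'n^'n)"
  have "\<bar>dual_fun \<Lambda>' - dual_fun \<Lambda>\<bar> \<le> (b * K + u) * norm (\<Lambda>' - \<Lambda>)"
    if h: "hermitian \<Lambda>'" "norm (\<Lambda>' - \<Lambda>) < \<delta>" for \<Lambda>'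
  proof -
    note \<Lambda>' = dK(3)[OF h]
    let ?d = "\<lambda>z. \<Psi> z \<bullet> (inv_pencil \<Lambda>' z - inv_pencil \<Lambda> z)"
    have "dual_fun \<Lambda>' - dual_fun \<Lambda> = circle_integral ?d + mat 1 \<bullet> (\<Lambda>' - \<Lambda>)"
      by (simp add: dual_fun_def inner_diff_right
          circle_integral_diff[OF circle_bounded_\<Psi>_inv[OF \<Lambda>'] circle_bounded_\<Psi>_inv[OF \<Lambda>]])
    moreover have "\<bar>mat 1 \<bullet> (\<Lambda>' - \<Lambda>)\<bar> \<le> u * norm (\<Lambda>' - \<Lambda>)"
      unfolding u_def by (rule Cauchy_Schwarz_ineq2)
    moreover have "\<bar>circle_integral ?d\<bar> \<le> b * K * norm (\<Lambda>' - \<Lambda>)"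
    proof -
      have bd: "circle_bounded ?d"
        by (intro circle_bounded_intros circle_bounded_\<Psi> circle_bounded_inv_pencil \<Lambda> \<Lambda>')
      have le: "\<bar>?d z\<bar> \<le> b * K * norm (\<Lambda>' - \<Lambda>)" if z: "cmod z = 1" for z
      proof -
        have "\<bar>?d z\<bar> \<le> norm (\<Psi> z) * norm (inv_pencil \<Lambda>' z - inv_pencil \<Lambda> z)"
          by (rule Cauchy_Schwarz_ineq2)
        also have "\<dots> \<le> b * (K * norm (\<Lambda>' - \<Lambda>))"
          using b z dK(4)[OF h z] by (intro mult_mono) auto
        finally show ?thesis by (simp add: ac_simps)
      qed
      have "circle_integral ?d \<le> circle_integral (\<lambda>_. b * K * norm (\<Lambda>' - \<Lambda>))"
        by (intro circle_integral_mono bd circle_bounded_const) (use le in \<open>simp add: abs_le_iff\<close>)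
      moreover have "circle_integral (\<lambda>_. - (b * K * norm (\<Lambda>' - \<Lambda>))) \<le> circle_integral ?d"
        by (intro circle_integral_mono bd circle_bounded_const) (use le in \<open>force simp: abs_le_iff\<close>)
      ultimately show ?thesis by simp
    qed
    ultimately show ?thesis by (simp add: distrib_right)
  qed
  moreover have "0 \<le> b * K + u" using b dK by (simp add: u_def)
  ultimately show thesis using that[OF dK(1)] by blast
qed

text \<open>A minimising sequence is bounded, and its limit points lie in the open set \<open>\<L>\<^sup>H\<close> because
  the integrals of the inverses stay bounded.\<close>

lemma dual_minimiser_exists:
  obtains \<Lambda> where "\<Lambda> \<in> L_Gamma_H G" "\<And>\<Lambda>'. \<Lambda>' \<in> L_Gamma_H G \<Longrightarrow> dual_fun \<Lambda> \<le> dual_fun \<Lambda>'"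
proof -
  obtain c k where ck: "0 < c"
    "\<And>\<Lambda>. \<Lambda> \<in> L_H G \<Longrightarrow> c * circle_integral (\<lambda>z. norm (dual_pencil G \<Lambda> z)) - k \<le> mat 1 \<bullet> \<Lambda>"
    by (rule trace_lower_bound) blast
  have low: "- k \<le> mat 1 \<bullet> \<Lambda>" if "\<Lambda> \<in> L_H G" for \<Lambda>
  proof -
    have "0 \<le> circle_integral (\<lambda>z. norm (dual_pencil G \<Lambda> z))"
      unfolding circle_integral_def by (rule Bochner_Integration.integral_nonneg) simp
    then have "0 \<le> c * circle_integral (\<lambda>z. norm (dual_pencil G \<Lambda> z))" using ck(1) by simp
    then show ?thesis using ck(2)[OF that] by linarith
  qed
  have lowJ: "- k \<le> dual_fun \<Lambda>" if "\<Lambda> \<in> L_Gamma_H G" for \<Lambda>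
    using low[OF L_Gamma_HD(1)[OF that]] integral_\<Psi>_inv_nonneg[OF L_Gamma_HD(1)[OF that]]
    by (simp add: dual_fun_def)
  have "posdef (mat 1 :: complex^'m^'m)"
    by (simp add: posdef_iff hermitian_mat1)
  then have "0 \<in> L_H G" by (simp add: L_H_def hermitian_0 dual_pencil_def)
  then have "0 \<in> L_Gamma_H G" by (simp add: L_Gamma_H_def subspace_0[OF subspace_Range_Gamma])
  then have ne: "dual_fun ` L_Gamma_H G \<noteq> {}" by blast
  have bdd: "bdd_below (dual_fun ` L_Gamma_H G)" using lowJ by (intro bdd_belowI2[of _ "- k"])
  define m where "m = Inf (dual_fun ` L_Gamma_H G)"
  have m: "m \<le> dual_fun \<Lambda>" if "\<Lambda> \<in> L_Gamma_H G" for \<Lambda>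
    unfolding m_def using bdd that by (intro cInf_lower) auto
  have "\<exists>\<Lambda>. \<Lambda> \<in> L_Gamma_H G \<and> dual_fun \<Lambda> < m + 1 / real (Suc j)" for j
  proof -
    have "Inf (dual_fun ` L_Gamma_H G) < m + 1 / real (Suc j)" by (simp add: m_def)
    then show ?thesis using cInf_lessD[OF ne] by blast
  qed
  then obtain X where X: "\<And>j. X j \<in> L_Gamma_H G" "\<And>j. dual_fun (X j) < m + 1 / real (Suc j)"
    by metis
  have Xm: "dual_fun (X j) \<le> m + 1" for j
    using X(2)[of j] by (rule order_trans[OF less_imp_le]) simp
  obtain R where R: "\<And>\<Lambda>. \<Lambda> \<in> L_Gamma_H G \<Longrightarrow> dual_fun \<Lambda> \<le> m + 1 \<Longrightarrow> norm \<Lambda> \<le> R"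
    by (rule dual_sublevel_bounded) blast
  have "\<forall>j. X j \<in> cball 0 R" using R X(1) Xm by simp
  then obtain \<Lambda> r where r: "strict_mono r" "(X \<circ> r) \<longlonglongrightarrow> \<Lambda>"
    using compact_cball[of "0 :: complex^'n^'n" R] unfolding compact_def by metis
  obtain cp where cp: "0 < cp" "AE \<theta> in circle_measure. coercive cp (\<Psi> (cis \<theta>))"
    by (rule coercive_\<Psi>)
  have bound: "circle_integral (\<lambda>z. mat 1 \<bullet> inv_pencil (X j) z) \<le> (m + 1 + k) / cp" for j
  proof -
    note LH = L_Gamma_HD(1)[OF X(1)[of j]]
    have b: "circle_bounded (\<lambda>z. mat 1 \<bullet> inv_pencil (X j) z)"
      by (intro circle_bounded_intros circle_bounded_inv_pencil LH)
    have "cp * circle_integral (\<lambda>z. mat 1 \<bullet> inv_pencil (X j) z) =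
        circle_integral (\<lambda>z. cp *\<^sub>R (mat 1 \<bullet> inv_pencil (X j) z))"
      using circle_integral_linear[OF bounded_linear_scaleR_right b, of cp] by simp
    also have "\<dots> \<le> circle_integral (\<lambda>z. \<Psi> z \<bullet> inv_pencil (X j) z)"
    proof (rule circle_integral_mono_AE)
      show "AE \<theta> in circle_measure. cp *\<^sub>R (mat 1 \<bullet> inv_pencil (X j) (cis \<theta>)) \<le>
          \<Psi> (cis \<theta>) \<bullet> inv_pencil (X j) (cis \<theta>)"
        using cp(2)
      proof (rule eventually_mono)
        fix \<theta> assume "coercive cp (\<Psi> (cis \<theta>))"
        then show "cp *\<^sub>R (mat 1 \<bullet> inv_pencil (X j) (cis \<theta>)) \<le> \<Psi> (cis \<theta>) \<bullet> inv_pencil (X j) (cis \<theta>)"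
          unfolding real_scaleR_def
          by (intro inner_coercive_ge posdef_inv L_H_posdef[OF LH]) (simp_all add: coercive_def)
      qed
    qed (intro circle_bounded_intros b circle_bounded_\<Psi> circle_bounded_inv_pencil LH)+
    also have "\<dots> \<le> m + 1 + k" using Xm[of j] low[OF LH] by (simp add: dual_fun_def)
    finally show ?thesis using cp(1) by (simp add: field_simps)
  qed
  have LH: "\<Lambda> \<in> L_H G"
    by (rule limit_in_L_H[OF _ r(2), of "(m + 1 + k) / cp"])
      (use L_Gamma_HD(1)[OF X(1)] bound in simp_all)
  have "\<Lambda> \<in> Range_Gamma G"
    using closed_subspace[OF subspace_Range_Gamma] r(2) L_Gamma_HD(2)[OF X(1)]
    by (metis closed_sequentially comp_apply)
  then have \<Lambda>: "\<Lambda> \<in> L_Gamma_H G" using LH by (simp add: L_Gamma_H_def)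
  obtain \<delta> C where dC: "0 < \<delta>" "0 \<le> C"
    "\<And>\<Lambda>'. hermitian \<Lambda>' \<Longrightarrow> norm (\<Lambda>' - \<Lambda>) < \<delta> \<Longrightarrow> \<bar>dual_fun \<Lambda>' - dual_fun \<Lambda>\<bar> \<le> C * norm (\<Lambda>' - \<Lambda>)"
    using dual_fun_lipschitz[OF LH] by blast
  have nrm: "(\<lambda>j. norm ((X \<circ> r) j - \<Lambda>)) \<longlonglongrightarrow> 0"
    using tendsto_norm_zero[OF LIM_zero[OF r(2)]] .
  have "\<forall>\<^sub>F j in sequentially. dual_fun \<Lambda> \<le> m + 1 / real (Suc j) + C * norm ((X \<circ> r) j - \<Lambda>)"
  proof -
    have "\<forall>\<^sub>F j in sequentially. norm ((X \<circ> r) j - \<Lambda>) < \<delta>"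
      using order_tendstoD(2)[OF nrm dC(1)] .
    then show ?thesis
    proof (rule eventually_mono)
      fix j assume "norm ((X \<circ> r) j - \<Lambda>) < \<delta>"
      then have "\<bar>dual_fun (X (r j)) - dual_fun \<Lambda>\<bar> \<le> C * norm ((X \<circ> r) j - \<Lambda>)"
        using dC(3)[of "X (r j)"] L_H_hermitian[OF L_Gamma_HD(1)[OF X(1)]] by simp
      moreover have "1 / real (Suc (r j)) \<le> 1 / real (Suc j)"
        using seq_suble[OF r(1), of j] by (intro divide_left_mono) auto
      ultimately show "dual_fun \<Lambda> \<le> m + 1 / real (Suc j) + C * norm ((X \<circ> r) j - \<Lambda>)"
        using X(2)[of "r j"] by linarith
    qed
  qed
  moreover have "(\<lambda>j. m + 1 / real (Suc j) + C * norm ((X \<circ> r) j - \<Lambda>)) \<longlonglongrightarrow> m + 0 + C * 0"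
    by (intro tendsto_intros nrm LIMSEQ_Suc[OF lim_1_over_n])
  ultimately have "dual_fun \<Lambda> \<le> m + 0 + C * 0"
    by (intro tendsto_lowerbound) auto
  then show thesis using that[OF \<Lambda>] m by (metis add_0_right mult_zero_right order_trans)
qed

lemma circle_bounded_Phi_hat: "\<Lambda> \<in> L_H G \<Longrightarrow> circle_bounded (Phi_hat G \<Psi> \<Lambda>)"
  unfolding Phi_hat_def by (intro circle_bounded_mult circle_bounded_inv_pencil circle_bounded_\<Psi>)

lemma hermitian_inv_pencil: "\<Lambda> \<in> L_H G \<Longrightarrow> cmod z = 1 \<Longrightarrow> hermitian (inv_pencil \<Lambda> z)"
  by (intro hermitian_inv L_H_posdef)

lemma hermitian_Phi_hat: "\<Lambda> \<in> L_H G \<Longrightarrow> cmod z = 1 \<Longrightarrow> hermitian (Phi_hat G \<Psi> \<Lambda> z)"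
  using hermitian_congr[of "\<Psi> z" "inv_pencil \<Lambda> z"] psd_\<Psi>[of z]
  by (simp add: Phi_hat_def hermitianD[OF hermitian_inv_pencil] psd_iff)

text \<open>The gradient of the dual functional at \<open>\<Lambda>\<close> is \<open>I - \<integral> G \<Phi> G\<^sup>*\<close> for the density \<open>\<Phi>\<close>
  attached to \<open>\<Lambda>\<close>. It lies in the range, so the inequality for \<open>H\<close> and \<open>- H\<close>
  makes it vanish at a minimiser.\<close>

lemma directional_derivative_nonneg:
  assumes \<Lambda>: "\<Lambda> \<in> L_Gamma_H G" and min: "\<And>\<Lambda>'. \<Lambda>' \<in> L_Gamma_H G \<Longrightarrow> dual_fun \<Lambda> \<le> dual_fun \<Lambda>'"
    and H: "H \<in> Range_Gamma G"
  shows "0 \<le> H \<bullet> (mat 1 - moment G (Phi_hat G \<Psi> \<Lambda>))"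
proof -
  note LH = L_Gamma_HD(1)[OF \<Lambda>]
  obtain \<delta> K where dK: "0 < \<delta>" "0 < K"
    "\<And>\<Lambda>'. hermitian \<Lambda>' \<Longrightarrow> norm (\<Lambda>' - \<Lambda>) < \<delta> \<Longrightarrow> \<Lambda>' \<in> L_H G"
    "\<And>\<Lambda>' z. hermitian \<Lambda>' \<Longrightarrow> norm (\<Lambda>' - \<Lambda>) < \<delta> \<Longrightarrow> cmod z = 1 \<Longrightarrow>
      norm (inv_pencil \<Lambda>' z - inv_pencil \<Lambda> z) \<le> K * norm (\<Lambda>' - \<Lambda>)"
    using inv_pencil_lipschitz[OF LH] by blast
  obtain b where b: "0 < b" "\<And>z. cmod z = 1 \<Longrightarrow> norm (\<Psi> z) \<le> b"
    using circle_bounded_\<Psi> by (rule circle_boundedE) blast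
  obtain q where q: "0 < q" "\<And>z. cmod z = 1 \<Longrightarrow> norm (inv_pencil \<Lambda> z) \<le> q"
    using circle_bounded_inv_pencil[OF LH] by (rule circle_boundedE) blast
  obtain d where d: "0 < d" "\<And>z. cmod z = 1 \<Longrightarrow> norm (congr_fun G H z) \<le> d"
    using circle_bounded_congr_fun[of H] by (rule circle_boundedE) blast
  define M where "M = b * (K * norm H * d * q)"
  have grad: "circle_integral (\<lambda>z. \<Psi> z \<bullet> (inv_pencil \<Lambda> z ** congr_fun G H z ** inv_pencil \<Lambda> z)) =
      H \<bullet> moment G (Phi_hat G \<Psi> \<Lambda>)"
    unfolding inner_moment[OF circle_bounded_Phi_hat[OF LH]]
    by (rule circle_integral_cong)
      (simp only: Phi_hat_def inner_congr_hermitian[OF hermitian_inv_pencil hermitian_inv_pencil] LH)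
  \<comment> \<open>The difference quotient for the step length \<open>t\<close> exceeds the derivative by at most \<open>M t\<close>.\<close>
  have step: "0 \<le> H \<bullet> (mat 1 - moment G (Phi_hat G \<Psi> \<Lambda>)) + M * t"
    if t: "0 < t" "t * norm H < \<delta>" for t
  proof -
    define \<Lambda>' where "\<Lambda>' = \<Lambda> + t *\<^sub>R H"
    have h: "hermitian \<Lambda>'"
      unfolding \<Lambda>'_def using L_H_hermitian[OF LH] hermitian_Range_Gamma[OF H]
      by (intro hermitian_add hermitian_scaleR)
    have n: "norm (\<Lambda>' - \<Lambda>) = t * norm H" using t by (simp add: \<Lambda>'_def)
    have LH': "\<Lambda>' \<in> L_H G" using dK(3)[OF h] n t by simp
    have "\<Lambda>' \<in> Range_Gamma G" unfolding \<Lambda>'_def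
      using subspace_Range_Gamma L_Gamma_HD(2)[OF \<Lambda>] H by (intro subspace_add subspace_scale)
    then have "\<Lambda>' \<in> L_Gamma_H G" using LH' by (simp add: L_Gamma_H_def)
    have lin: "mat 1 \<bullet> \<Lambda>' = mat 1 \<bullet> \<Lambda> + t * (mat 1 \<bullet> H)"
      by (simp add: \<Lambda>'_def inner_add_right)
    have "dual_fun \<Lambda> \<le> dual_fun \<Lambda>'" using \<open>\<Lambda>' \<in> L_Gamma_H G\<close> by (rule min)
    moreover have "dual_fun \<Lambda>' - dual_fun \<Lambda> =
        circle_integral (\<lambda>z. \<Psi> z \<bullet> inv_pencil \<Lambda>' z - \<Psi> z \<bullet> inv_pencil \<Lambda> z) + t * (mat 1 \<bullet> H)"
      using lin by (simp add: dual_fun_def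
          circle_integral_diff[OF circle_bounded_\<Psi>_inv[OF LH'] circle_bounded_\<Psi>_inv[OF LH]])
    moreover have "circle_integral (\<lambda>z. \<Psi> z \<bullet> inv_pencil \<Lambda>' z - \<Psi> z \<bullet> inv_pencil \<Lambda> z) \<le>
        circle_integral (\<lambda>z. (- t) *\<^sub>R (\<Psi> z \<bullet> (inv_pencil \<Lambda> z ** congr_fun G H z ** inv_pencil \<Lambda> z)) + t * (M * t))"
    proof (rule circle_integral_mono)
      fix z :: complex assume z: "cmod z = 1"
      let ?X = "inv_pencil \<Lambda>' z" and ?Y = "inv_pencil \<Lambda> z" and ?D = "congr_fun G H z"
      have "dual_pencil G \<Lambda> z - dual_pencil G \<Lambda>' z = (- t) *\<^sub>R ?D"
        unfolding dual_pencil_diff by (simp add: \<Lambda>'_def matrix_scaleR_left matrix_scaleR_right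
            flip: scaleR_minus_left)
      then have "?X - ?Y = ?X ** ((- t) *\<^sub>R ?D) ** ?Y"
        using inv_diff[OF L_H_posdef[OF LH' z] L_H_posdef[OF LH z]] by simp
      then have XY: "?X - ?Y = (- t) *\<^sub>R (?X ** ?D ** ?Y)"
        by (simp only: matrix_scaleR_left matrix_scaleR_right)
      have split: "?X ** ?D ** ?Y = ?Y ** ?D ** ?Y + (?X - ?Y) ** ?D ** ?Y"
        by (simp only: matrix_diff_rdistrib) simp
      have "\<Psi> z \<bullet> ?X - \<Psi> z \<bullet> ?Y = - t * (\<Psi> z \<bullet> (?X ** ?D ** ?Y))"
        using arg_cong[OF XY, of "inner (\<Psi> z)"] by (simp only: inner_diff_right inner_scaleR_right)
      also have "\<Psi> z \<bullet> (?X ** ?D ** ?Y) = \<Psi> z \<bullet> (?Y ** ?D ** ?Y) + \<Psi> z \<bullet> ((?X - ?Y) ** ?D ** ?Y)"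
        unfolding inner_add_right[symmetric] by (rule arg_cong[OF split])
      finally have "\<Psi> z \<bullet> ?X - \<Psi> z \<bullet> ?Y =
          - t * (\<Psi> z \<bullet> (?Y ** ?D ** ?Y)) - t * (\<Psi> z \<bullet> ((?X - ?Y) ** ?D ** ?Y))"
        by (simp only: distrib_left mult_minus_left)
      moreover have "- (\<Psi> z \<bullet> ((?X - ?Y) ** ?D ** ?Y)) \<le> M * t"
      proof -
        have "- (\<Psi> z \<bullet> ((?X - ?Y) ** ?D ** ?Y)) \<le> norm (\<Psi> z) * norm ((?X - ?Y) ** ?D ** ?Y)"
          using Cauchy_Schwarz_ineq2[of "\<Psi> z" "(?X - ?Y) ** ?D ** ?Y"] by linarith
        also have "\<dots> \<le> b * (K * (t * norm H) * d * q)"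
          using b z q d dK(4)[OF h _ z] n t
          by (intro mult_mono norm_mult3_le) auto
        finally show ?thesis by (simp add: M_def ac_simps)
      qed
      then have "t * (- (\<Psi> z \<bullet> ((?X - ?Y) ** ?D ** ?Y))) \<le> t * (M * t)"
        using t by (intro mult_left_mono) auto
      ultimately show "\<Psi> z \<bullet> ?X - \<Psi> z \<bullet> ?Y \<le> (- t) *\<^sub>R (\<Psi> z \<bullet> (?Y ** ?D ** ?Y)) + t * (M * t)"
        by simp
    qed (intro circle_bounded_intros circle_bounded_\<Psi> circle_bounded_inv_pencil LH LH' circle_bounded_congr_fun circle_bounded_G)+
    moreover have "circle_integral (\<lambda>z. (- t) *\<^sub>R (\<Psi> z \<bullet> (inv_pencil \<Lambda> z ** congr_fun G H z ** inv_pencil \<Lambda> z)) + t * (M * t)) =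
        - t * (H \<bullet> moment G (Phi_hat G \<Psi> \<Lambda>)) + t * (M * t)"
    proof -
      have bb: "circle_bounded (\<lambda>z. \<Psi> z \<bullet> (inv_pencil \<Lambda> z ** congr_fun G H z ** inv_pencil \<Lambda> z))"
        by (intro circle_bounded_inner circle_bounded_mult circle_bounded_\<Psi> circle_bounded_inv_pencil
            LH circle_bounded_congr_fun)
      show ?thesis
        using circle_integral_linear[OF bounded_linear_scaleR_right bb, of "- t"]
        by (simp add: circle_integral_add[OF circle_bounded_scaleR[OF bb] circle_bounded_const, of "- t", simplified] grad)
    qed
    ultimately have "0 \<le> t * (H \<bullet> (mat 1 - moment G (Phi_hat G \<Psi> \<Lambda>)) + M * t)"
      by (simp add: inner_diff_right inner_commute[of H "mat 1"] algebra_simps)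
    then show ?thesis using t(1) by (simp add: zero_le_mult_iff)
  qed
  \<comment> \<open>Step lengths that tend to zero and keep \<open>\<Lambda> + t H\<close> within distance \<open>\<delta>\<close> of \<open>\<Lambda>\<close>; the
    denominator allows for \<open>H = 0\<close>.\<close>
  define t where "t j = \<delta> / (norm H + 1) * (1 / real (Suc (Suc j)))" for j
  have tpos: "0 < t j" "t j * norm H < \<delta>" for j
  proof -
    have n0: "0 < norm H + 1" using norm_ge_zero[of H] by linarith
    show "0 < t j" using dK(1) n0 by (simp add: t_def)
    have "\<delta> / (norm H + 1) * (1 / real (Suc (Suc j))) \<le> \<delta> / (norm H + 1) * 1"
      using dK(1) n0 by (intro mult_left_mono) auto
    then have "t j * (norm H + 1) \<le> \<delta>" using n0 by (simp add: t_def field_simps)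
    then show "t j * norm H < \<delta>" using \<open>0 < t j\<close> by (simp add: distrib_left)
  qed
  have "t \<longlonglongrightarrow> \<delta> / (norm H + 1) * 0"
    unfolding t_def by (intro tendsto_intros LIMSEQ_Suc[OF LIMSEQ_Suc[OF lim_1_over_n]])
  then have "(\<lambda>j. H \<bullet> (mat 1 - moment G (Phi_hat G \<Psi> \<Lambda>)) + M * t j) \<longlonglongrightarrow>
      H \<bullet> (mat 1 - moment G (Phi_hat G \<Psi> \<Lambda>)) + M * (\<delta> / (norm H + 1) * 0)"
    by (intro tendsto_intros)
  then have "0 \<le> H \<bullet> (mat 1 - moment G (Phi_hat G \<Psi> \<Lambda>)) + M * (\<delta> / (norm H + 1) * 0)"
    by (rule LIMSEQ_le_const) (use step tpos in auto)
  then show ?thesis by simp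
qed

theorem dual_solution_exists:
  obtains \<Lambda> where "\<Lambda> \<in> L_Gamma_H G" "moment G (Phi_hat G \<Psi> \<Lambda>) = mat 1"
proof -
  obtain \<Lambda> where \<Lambda>: "\<Lambda> \<in> L_Gamma_H G" "\<And>\<Lambda>'. \<Lambda>' \<in> L_Gamma_H G \<Longrightarrow> dual_fun \<Lambda> \<le> dual_fun \<Lambda>'"
    by (rule dual_minimiser_exists) blast
  let ?R = "mat 1 - moment G (Phi_hat G \<Psi> \<Lambda>)"
  have R: "?R \<in> Range_Gamma G"
    by (intro subspace_diff subspace_Range_Gamma mat_1_in_Range moment_in_Range_Gamma
        circle_bounded_Phi_hat hermitian_Phi_hat L_Gamma_HD(1)[OF \<Lambda>(1)])
  have "0 \<le> (- ?R) \<bullet> ?R"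
    by (rule directional_derivative_nonneg[OF \<Lambda>]) (use subspace_neg[OF subspace_Range_Gamma R] in auto)
  then have "?R \<bullet> ?R \<le> 0" by (simp only: inner_minus_left neg_0_le_iff_le)
  then have "?R = 0" by (simp add: inner_gt_zero_iff not_less[symmetric])
  then show thesis using that[OF \<Lambda>(1)] by simp
qed

end

section \<open>Uniqueness of the multiplier\<close>

text \<open>Monotonicity of \<open>Q \<mapsto> - Q\<^sup>-\<^sup>1 M Q\<^sup>-\<^sup>1\<close>, the gradient of the convex function \<open>tr (Q\<^sup>-\<^sup>1 M)\<close>. In the
  product on the right the mixed terms reduce by \<open>X P = 1\<close> and \<open>Y Q = 1\<close>, which leaves the terms
  of the pairing.\<close>

lemma pairing_increments:
  assumes P: "posdef P" and Q: "posdef Q"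
  defines "X \<equiv> matrix_inv P" and "Y \<equiv> matrix_inv Q"
  shows "(P - Q) \<bullet> (X ** M ** X - Y ** M ** Y) = - (M \<bullet> ((X - Y) ** (P + Q) ** (X - Y)))"
proof -
  have hX: "hermitian X" and hY: "hermitian Y" unfolding X_def Y_def by (intro hermitian_inv P Q)+
  have XP: "X ** P = mat 1" "P ** X = mat 1" and YQ: "Y ** Q = mat 1" "Q ** Y = mat 1"
    unfolding X_def Y_def
    by (simp_all add: posdef_inv_left posdef_inv_right P Q)
  have "(P - Q) \<bullet> (X ** M ** X - Y ** M ** Y) =
      M \<bullet> (X ** (P - Q) ** X) - M \<bullet> (Y ** (P - Q) ** Y)"
    by (simp only: inner_diff_right inner_congr_hermitian[OF hX hX] inner_congr_hermitian[OF hY hY])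
  also have "\<dots> = M \<bullet> (X ** (P - Q) ** X - Y ** (P - Q) ** Y)" by (simp only: inner_diff_right)
  also have "X ** (P - Q) ** X - Y ** (P - Q) ** Y = X - X ** Q ** X - (Y ** P ** Y - Y)"
    by (simp add: matrix_diff_ldistrib matrix_diff_rdistrib XP YQ)
  also have "\<dots> = - ((X - Y) ** (P + Q) ** (X - Y))"
  proof -
    have "(X - Y) ** (P + Q) ** (X - Y) =
        (X ** P) ** X - (X ** P) ** Y - Y ** (P ** X) + Y ** P ** Y
        + (X ** Q ** X - X ** (Q ** Y) - (Y ** Q) ** X + (Y ** Q) ** Y)"
      by (simp add: matrix_ring algebra_simps)
    then show ?thesis by (simp add: XP YQ)
  qed
  finally show ?thesis by simp
qed

lemma inner_congr_posdef:
  assumes M: "posdef M" and S: "posdef S" and T: "hermitian T"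
  shows "0 \<le> M \<bullet> (T ** S ** T)" and "M \<bullet> (T ** S ** T) = 0 \<Longrightarrow> T = 0"
proof -
  obtain W where W: "hermitian W" "W ** W = M" using M by (rule posdef_sqrt_exists)
  obtain c where c: "0 < c" "coercive c S" using S by (rule posdef_imp_coercive)
  have "M \<bullet> (T ** S ** T) = S \<bullet> (T ** (W ** W) ** T)"
    using inner_congr_hermitian[OF T T] W(2) by simp
  also have "T ** (W ** W) ** T = (T ** W) ** ctransp (T ** W)"
    by (simp add: ctransp_mult hermitianD[OF T] hermitianD[OF W(1)] matrix_mul_assoc)
  also have "S \<bullet> \<dots> = (T ** W) \<bullet> (S ** (T ** W))"
    unfolding inner_matrix_right'[of S "T ** W" "ctransp (T ** W)"] ctransp_ctransp
    by (rule inner_commute)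
  finally have e: "M \<bullet> (T ** S ** T) = (T ** W) \<bullet> (S ** (T ** W))" .
  have le: "c * (norm (T ** W))\<^sup>2 \<le> M \<bullet> (T ** S ** T)"
    unfolding e using c(2) by (intro inner_congr_ge) (simp add: coercive_def)
  have "0 \<le> c * (norm (T ** W))\<^sup>2" using c(1) by simp
  then show "0 \<le> M \<bullet> (T ** S ** T)" using le by linarith
  assume "M \<bullet> (T ** S ** T) = 0"
  then have "(norm (T ** W))\<^sup>2 \<le> 0" using le c(1) by (simp add: mult_le_0_iff)
  then have "T ** W = 0" by simp
  then have "T ** M = 0" by (simp add: W(2)[symmetric] matrix_mul_assoc)
  then have "T ** (M ** matrix_inv M) = 0" by (simp add: matrix_mul_assoc)
  then show "T = 0" by (simp add: posdef_inv_right[OF M])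
qed

lemma posdef_add: "posdef P \<Longrightarrow> posdef Q \<Longrightarrow> posdef (P + Q)"
  unfolding posdef_iff
  by (auto intro: hermitian_add add_pos_pos simp: matrix_vector_mult_add_rdistrib inner_add_right)

context hellinger_problem
begin

text \<open>Two solutions have the same moments, so the pairing of the increments integrates to zero.
  Its integrand has a sign, hence the two pencils agree.\<close>

theorem dual_solution_unique:
  assumes \<Lambda>1: "\<Lambda>1 \<in> L_Gamma_H G" "moment G (Phi_hat G \<Psi> \<Lambda>1) = mat 1"
    and \<Lambda>2: "\<Lambda>2 \<in> L_Gamma_H G" "moment G (Phi_hat G \<Psi> \<Lambda>2) = mat 1"
  shows "\<Lambda>1 = \<Lambda>2"
proof -
  note LH1 = L_Gamma_HD(1)[OF \<Lambda>1(1)] and LH2 = L_Gamma_HD(1)[OF \<Lambda>2(1)]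
  let ?P = "dual_pencil G \<Lambda>1" and ?Q = "dual_pencil G \<Lambda>2"
  define T where "T z = inv_pencil \<Lambda>1 z - inv_pencil \<Lambda>2 z" for z
  define f where "f z = \<Psi> z \<bullet> (T z ** (?P z + ?Q z) ** T z)" for z
  have bT: "circle_bounded T"
    unfolding T_def by (intro circle_bounded_diff circle_bounded_inv_pencil LH1 LH2)
  have bf: "circle_bounded f"
    unfolding f_def by (intro circle_bounded_intros bT circle_bounded_\<Psi> circle_bounded_dual_pencil)
  have b12: "circle_bounded (Phi_hat G \<Psi> \<Lambda>1)" "circle_bounded (Phi_hat G \<Psi> \<Lambda>2)"
    by (intro circle_bounded_Phi_hat LH1 LH2)+
  let ?g = "\<lambda>z. congr_fun G (\<Lambda>1 - \<Lambda>2) z \<bullet> Phi_hat G \<Psi> \<Lambda>1 z - congr_fun G (\<Lambda>1 - \<Lambda>2) z \<bullet> Phi_hat G \<Psi> \<Lambda>2 z"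
  have "circle_integral ?g = (\<Lambda>1 - \<Lambda>2) \<bullet> moment G (Phi_hat G \<Psi> \<Lambda>1) - (\<Lambda>1 - \<Lambda>2) \<bullet> moment G (Phi_hat G \<Psi> \<Lambda>2)"
    unfolding inner_moment[OF b12(1)] inner_moment[OF b12(2)]
    by (intro circle_integral_diff circle_bounded_inner circle_bounded_congr_fun b12)
  also have "\<dots> = 0" by (simp add: \<Lambda>1 \<Lambda>2)
  finally have g0: "circle_integral ?g = 0" .
  have "?g z = - f z" if z: "cmod z = 1" for z
    using pairing_increments[OF L_H_posdef[OF LH1 z] L_H_posdef[OF LH2 z], of "\<Psi> z"]
    by (simp only: f_def T_def Phi_hat_def dual_pencil_diff inner_diff_right)
  then have "circle_integral ?g = circle_integral (\<lambda>z. - f z)" by (rule circle_integral_cong)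
  also have "\<dots> = - circle_integral f"
    by (rule circle_integral_linear[OF bounded_linear_minus[OF bounded_linear_ident] bf])
  finally have f0: "circle_integral f = 0" using g0 by simp
  obtain c where c: "0 < c" "AE \<theta> in circle_measure. coercive c (\<Psi> (cis \<theta>))"
    by (rule coercive_\<Psi>)
  have hT: "hermitian (T z)" if "cmod z = 1" for z
    unfolding T_def by (intro hermitian_diff hermitian_inv_pencil LH1 LH2 that)
  have pPQ: "posdef (?P z + ?Q z)" if "cmod z = 1" for z
    by (intro posdef_add L_H_posdef LH1 LH2 that)
  have "AE \<theta> in circle_measure. 0 \<le> f (cis \<theta>)"
    using c(2) by (rule eventually_mono)
      (simp add: f_def inner_congr_posdef(1)[OF coercive_imp_posdef[OF _ c(1)] pPQ hT])
  then have "AE \<theta> in circle_measure. f (cis \<theta>) = 0"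
    by (rule circle_integral_zero_imp_AE[OF bf _ f0])
  then have "AE \<theta> in circle_measure. congr_fun G (\<Lambda>1 - \<Lambda>2) (cis \<theta>) = 0"
    using c(2)
  proof eventually_elim
    fix \<theta> assume f: "f (cis \<theta>) = 0" and co: "coercive c (\<Psi> (cis \<theta>))"
    let ?z = "cis \<theta>"
    have z: "cmod ?z = 1" by simp
    have "T ?z = 0"
      using inner_congr_posdef(2)[OF coercive_imp_posdef[OF co c(1)] pPQ[OF z] hT[OF z]] f
      by (simp add: f_def)
    then have "?P ?z ** (T ?z ** ?Q ?z) = 0" by simp
    then have "(?P ?z ** inv_pencil \<Lambda>1 ?z) ** ?Q ?z - ?P ?z ** (inv_pencil \<Lambda>2 ?z ** ?Q ?z) = 0"
      by (simp only: T_def matrix_diff_ldistrib matrix_diff_rdistrib matrix_mul_assoc)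
    then have "?Q ?z - ?P ?z = 0"
      by (simp add: posdef_inv_left[OF L_H_posdef[OF LH2 z]] posdef_inv_right[OF L_H_posdef[OF LH1 z]])
    then show "congr_fun G (\<Lambda>1 - \<Lambda>2) ?z = 0"
      using dual_pencil_diff[of \<Lambda>1 ?z \<Lambda>2] by simp
  qed
  then have "\<And>z. cmod z = 1 \<Longrightarrow> congr_fun G (\<Lambda>1 - \<Lambda>2) z = 0"
    by (rule AE_circle_continuous[OF continuous_congr_fun])
  moreover have "\<Lambda>1 - \<Lambda>2 \<in> Range_Gamma G"
    using subspace_Range_Gamma L_Gamma_HD(2)[OF \<Lambda>1(1)] L_Gamma_HD(2)[OF \<Lambda>2(1)]
    by (rule subspace_diff)
  ultimately show ?thesis using Range_Gamma_eq_0[of "\<Lambda>1 - \<Lambda>2"] by simp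
qed

end

section \<open>Optimality\<close>

lemma factor_norm: "(norm W)\<^sup>2 = mat 1 \<bullet> (W ** ctransp W)" for W :: "complex^'a^'a"
  by (simp add: inner_matrix_right' power2_norm_eq_inner)

lemma L2_norm_eq: "(L2_norm F)\<^sup>2 = circle_integral (\<lambda>z. (norm (F z))\<^sup>2)"
proof -
  have "0 \<le> circle_integral (\<lambda>z. (norm (F z))\<^sup>2)"
    unfolding circle_integral_def by (rule Bochner_Integration.integral_nonneg) simp
  then show ?thesis by (simp add: L2_norm_def Re_trace_mult_ctransp)
qed

text \<open>A factor of a bounded density is bounded wherever the factorisation holds, since
  \<open>\<parallel>W\<parallel>\<^sup>2 = tr (W W\<^sup>*)\<close>. The norms of all factors of one density thus have a common bound.\<close>

lemma factor_norm_bound: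
  assumes "circle_bounded \<Phi>"
  obtains b where "0 < b" "\<And>(W :: complex^'m^'m) \<theta>. W ** ctransp W = \<Phi> (cis \<theta>) \<Longrightarrow> norm W \<le> b"
proof -
  obtain a where a: "0 < a" "\<And>z. cmod z = 1 \<Longrightarrow> norm (\<Phi> z) \<le> a"
    using assms by (rule circle_boundedE) blast
  define u where "u = norm (mat 1 :: complex^'m^'m)"
  have "norm W \<le> sqrt (u * a + 1)" if "W ** ctransp W = \<Phi> (cis \<theta>)" for W :: "complex^'m^'m" and \<theta>
  proof -
    have "(norm W)\<^sup>2 = mat 1 \<bullet> \<Phi> (cis \<theta>)" using that by (simp add: factor_norm)
    also have "\<dots> \<le> u * norm (\<Phi> (cis \<theta>))" unfolding u_def by (rule norm_cauchy_schwarz)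
    also have "\<dots> \<le> u * a + 1" using mult_left_mono[OF a(2)[of "cis \<theta>"], of u] by (simp add: u_def)
    finally show ?thesis by (rule real_le_rsqrt)
  qed
  moreover have "0 < sqrt (u * a + 1)"
    using a(1) by (simp add: u_def add_nonneg_pos)
  ultimately show thesis using that by blast
qed

lemma L2_matrixI:
  fixes W \<Phi> :: "complex \<Rightarrow> complex^'m^'m"
  assumes W: "circle_measurable W" and \<Phi>: "circle_bounded \<Phi>"
    and ae: "ae_equal (\<lambda>z. W z ** ctransp (W z)) \<Phi>"
  shows "W \<in> L2_matrix"
proof -
  obtain b where b: "0 < b" "\<And>(W :: complex^'m^'m) \<theta>. W ** ctransp W = \<Phi> (cis \<theta>) \<Longrightarrow> norm W \<le> b"
    using \<Phi> by (rule factor_norm_bound) blast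
  have [measurable]: "(\<lambda>\<theta>. W (cis \<theta>)) \<in> borel_measurable circle_measure"
    using W by (simp add: circle_measurable_def)
  have "AE \<theta> in circle_measure. norm ((norm (W (cis \<theta>)))\<^sup>2) \<le> b\<^sup>2"
    using ae unfolding ae_equal_def
  proof (rule eventually_mono)
    fix \<theta> assume "W (cis \<theta>) ** ctransp (W (cis \<theta>)) = \<Phi> (cis \<theta>)"
    then have "norm (W (cis \<theta>)) \<le> b" by (rule b(2))
    then show "norm ((norm (W (cis \<theta>)))\<^sup>2) \<le> b\<^sup>2" by (simp add: power_mono)
  qed
  then have "integrable circle_measure (\<lambda>\<theta>. (norm (W (cis \<theta>)))\<^sup>2)"
    by (rule finite_measure.integrable_const_bound[OF finite_measure_circle]) measurable
  then show ?thesis using W by (simp add: L2_matrix_def Re_trace_mult_ctransp)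
qed

text \<open>The Hermitian root is taken with one norm bound for all points of the circle, so that it
  depends measurably on the point. This makes the sets defining the distance non-empty.\<close>

lemma spectral_factor_exists:
  assumes "\<Phi> \<in> spectral_densities"
  obtains W where "W \<in> L2_matrix" "ae_equal (\<lambda>z. W z ** ctransp (W z)) \<Phi>"
proof -
  note \<Phi> = spectral_densities_bounded[OF assms]
  obtain c where c: "0 < c" "AE \<theta> in circle_measure. coercive c (\<Phi> (cis \<theta>))"
    using assms by (rule spectral_densities_coercive)
  obtain b where b: "0 < b" "\<And>z. cmod z = 1 \<Longrightarrow> norm (\<Phi> z) \<le> b"
    using \<Phi> by (rule circle_boundedE) blast
  define W where "W z = herm_sqrt b (\<Phi> z)" for z
  have m: "circle_measurable W"
    using \<Phi> unfolding W_def circle_bounded_def circle_measurable_def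
    by (intro borel_measurable_herm_sqrt) simp
  have e: "ae_equal (\<lambda>z. W z ** ctransp (W z)) \<Phi>"
    unfolding ae_equal_def using c(2)
  proof (rule eventually_mono)
    fix \<theta> assume "coercive c (\<Phi> (cis \<theta>))"
    then show "W (cis \<theta>) ** ctransp (W (cis \<theta>)) = \<Phi> (cis \<theta>)"
      using herm_sqrt[OF _ c(1) b(2), of "cis \<theta>"] by (simp add: W_def hermitianD)
  qed
  show thesis using L2_matrixI[OF m \<Phi> e] e by (rule that)
qed

definition factor_gaps :: "(complex \<Rightarrow> complex^'m^'m) \<Rightarrow> (complex \<Rightarrow> complex^'m^'m) \<Rightarrow> real set" where
  "factor_gaps \<Phi> \<Psi> = {(L2_norm (\<lambda>z. W\<^sub>\<Psi> z - W\<^sub>\<Phi> z))\<^sup>2 | W\<^sub>\<Psi> W\<^sub>\<Phi>.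
     W\<^sub>\<Psi> \<in> L2_matrix \<and> W\<^sub>\<Phi> \<in> L2_matrix \<and>
     ae_equal (\<lambda>z. W\<^sub>\<Psi> z ** ctransp (W\<^sub>\<Psi> z)) \<Psi> \<and>
     ae_equal (\<lambda>z. W\<^sub>\<Phi> z ** ctransp (W\<^sub>\<Phi> z)) \<Phi>}"

lemma hellinger_dist_sq:
  assumes "factor_gaps \<Phi> \<Psi> \<noteq> {}"
  shows "(hellinger_dist \<Phi> \<Psi>)\<^sup>2 = Inf (factor_gaps \<Phi> \<Psi>)"
proof -
  have "0 \<le> Inf (factor_gaps \<Phi> \<Psi>)"
    using assms by (rule cInf_greatest) (auto simp: factor_gaps_def)
  then show ?thesis by (simp add: hellinger_dist_def factor_gaps_def)
qed

lemma bdd_below_factor_gaps: "bdd_below (factor_gaps \<Phi> \<Psi>)"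
  by (rule bdd_belowI[of _ 0]) (auto simp: factor_gaps_def)

lemma factor_gaps_nonempty:
  assumes "\<Phi> \<in> spectral_densities" "\<Psi> \<in> spectral_densities"
  shows "factor_gaps \<Phi> \<Psi> \<noteq> {}"
proof -
  obtain W where W: "W \<in> L2_matrix" "ae_equal (\<lambda>z. W z ** ctransp (W z)) \<Psi>"
    using assms(2) by (rule spectral_factor_exists)
  obtain V where V: "V \<in> L2_matrix" "ae_equal (\<lambda>z. V z ** ctransp (V z)) \<Phi>"
    using assms(1) by (rule spectral_factor_exists)
  have "(L2_norm (\<lambda>z. W z - V z))\<^sup>2 \<in> factor_gaps \<Phi> \<Psi>"
    unfolding factor_gaps_def using W V by blast
  then show ?thesis by blast
qed

text \<open>Completing the square in \<open>V\<close>. The form is chosen so that outside the square the factors occur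
  only through \<open>W W\<^sup>*\<close> and \<open>V V\<^sup>*\<close>, the latter linearly: the constraint fixes its integral.\<close>

lemma complete_square:
  fixes W V Q :: "complex^'a^'a"
  assumes Q: "posdef Q"
  shows "(norm (W - V))\<^sup>2 =
    mat 1 \<bullet> (W ** ctransp W) - (W ** ctransp W) \<bullet> matrix_inv Q - (Q - mat 1) \<bullet> (V ** ctransp V)
    + (V - matrix_inv Q ** W) \<bullet> (Q ** (V - matrix_inv Q ** W))"
proof -
  let ?X = "matrix_inv Q"
  have hX: "ctransp ?X = ?X" using hermitian_inv[OF Q] by (rule hermitianD)
  have hQ: "ctransp Q = Q" using Q by (simp add: posdef_iff hermitianD)
  have "Q ** (V - ?X ** W) = Q ** V - W"
    by (simp add: matrix_diff_ldistrib matrix_mul_assoc posdef_inv_right[OF Q])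
  moreover have "(?X ** W) \<bullet> (Q ** V) = W \<bullet> V"
  proof -
    have "(?X ** W) \<bullet> (Q ** V) = (Q ** (?X ** W)) \<bullet> V"
      by (simp add: inner_matrix_left' hQ)
    then show ?thesis by (simp add: matrix_mul_assoc posdef_inv_right[OF Q])
  qed
  ultimately have 1: "(V - ?X ** W) \<bullet> (Q ** (V - ?X ** W)) =
      V \<bullet> (Q ** V) - V \<bullet> W - W \<bullet> V + (?X ** W) \<bullet> W"
    by (simp add: inner_diff_left inner_diff_right)
  have 2: "(Q - mat 1) \<bullet> (V ** ctransp V) = V \<bullet> (Q ** V) - V \<bullet> V"
  proof -
    have "(Q - mat 1) \<bullet> (V ** ctransp V) = ((Q - mat 1) ** V) \<bullet> V"
      by (subst inner_matrix_right') simp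
    then show ?thesis
      by (simp add: matrix_diff_rdistrib inner_diff_left inner_commute[of "Q ** V" V])
  qed
  have 3: "(W ** ctransp W) \<bullet> ?X = (?X ** W) \<bullet> W"
    by (subst inner_matrix_right) (simp add: inner_commute)
  have 4: "mat 1 \<bullet> (W ** ctransp W) = W \<bullet> W"
    by (simp add: inner_matrix_right')
  have "(norm (W - V))\<^sup>2 = W \<bullet> W - V \<bullet> W - W \<bullet> V + V \<bullet> V"
    by (simp add: power2_norm_eq_inner inner_diff_left inner_diff_right)
  then show ?thesis unfolding 1 2 3 4 by simp
qed

context hellinger_problem
begin

text \<open>The value at \<open>\<Lambda>\<close> of the Lagrange dual of the approximation problem.\<close>

definition dual_value :: "complex^'n^'n \<Rightarrow> real" where
  "dual_value \<Lambda> = circle_integral (\<lambda>z. mat 1 \<bullet> \<Psi> z) - dual_fun \<Lambda>"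

lemma Phi_hat_spectral_density:
  assumes \<Lambda>: "\<Lambda> \<in> L_H G" shows "Phi_hat G \<Psi> \<Lambda> \<in> spectral_densities"
proof -
  have form: "x \<bullet> (Phi_hat G \<Psi> \<Lambda> z *v x) = (inv_pencil \<Lambda> z *v x) \<bullet> (\<Psi> z *v (inv_pencil \<Lambda> z *v x))"
    if z: "cmod z = 1" for x z
    using inner_matrix_vector'[of x "inv_pencil \<Lambda> z" "\<Psi> z *v (inv_pencil \<Lambda> z *v x)"]
    by (simp add: Phi_hat_def matrix_vector_mul_assoc matrix_mul_assoc hermitianD[OF hermitian_inv_pencil[OF \<Lambda> z]])
  have psd: "psd (Phi_hat G \<Psi> \<Lambda> z)" if z: "cmod z = 1" for z
    using psd_\<Psi>[OF z] hermitian_Phi_hat[OF \<Lambda> z] by (simp add: psd_iff form[OF z])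
  obtain c where c: "0 < c" "AE \<theta> in circle_measure. coercive c (\<Psi> (cis \<theta>))"
    by (rule coercive_\<Psi>)
  obtain q where q: "0 < q" "\<And>z. cmod z = 1 \<Longrightarrow> norm (dual_pencil G \<Lambda> z) \<le> q"
    using circle_bounded_dual_pencil[of \<Lambda>] by (rule circle_boundedE) blast
  define d where "d = c / q\<^sup>2"
  have d: "0 < d" using c q by (simp add: d_def)
  have "AE \<theta> in circle_measure. posdef (Phi_hat G \<Psi> \<Lambda> (cis \<theta>) - mat (complex_of_real (d / 2)))"
    using c(2)
  proof (rule eventually_mono)
    fix \<theta> assume co: "coercive c (\<Psi> (cis \<theta>))"
    let ?z = "cis \<theta>"
    have z: "cmod ?z = 1" by simp
    have "coercive d (Phi_hat G \<Psi> \<Lambda> ?z)"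
      unfolding coercive_def
    proof (intro conjI allI hermitian_Phi_hat[OF \<Lambda> z])
      fix x :: "complex^'m"
      let ?y = "inv_pencil \<Lambda> ?z *v x"
      have "x = dual_pencil G \<Lambda> ?z *v ?y"
        by (simp add: matrix_vector_mul_assoc posdef_inv_right[OF L_H_posdef[OF \<Lambda> z]])
      then have "norm x \<le> norm (dual_pencil G \<Lambda> ?z) * norm ?y"
        by (metis norm_matrix_vector)
      also have "\<dots> \<le> q * norm ?y" using q(2)[OF z] by (intro mult_right_mono) auto
      finally have "(norm x)\<^sup>2 \<le> (q * norm ?y)\<^sup>2" by (intro power_mono) auto
      then have "d * (norm x)\<^sup>2 \<le> d * (q * norm ?y)\<^sup>2" using d by (intro mult_left_mono) auto
      also have "\<dots> = c * (norm ?y)\<^sup>2" using q(1) by (simp add: d_def power_mult_distrib)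
      also have "\<dots> \<le> ?y \<bullet> (\<Psi> ?z *v ?y)" using co by (simp add: coercive_def)
      finally show "d * (norm x)\<^sup>2 \<le> x \<bullet> (Phi_hat G \<Psi> \<Lambda> ?z *v x)" by (simp only: form[OF z])
    qed
    then show "posdef (Phi_hat G \<Psi> \<Lambda> ?z - mat (complex_of_real (d / 2)))"
      by (rule coercive_imp_posdef_diff) (use d in simp)
  qed
  moreover have "0 < d / 2" using d by simp
  ultimately have "\<exists>c>0. AE \<theta> in circle_measure. posdef (Phi_hat G \<Psi> \<Lambda> (cis \<theta>) - mat (complex_of_real c))"
    by blast
  then show ?thesis
    using circle_bounded_Phi_hat[OF \<Lambda>] psd
    unfolding spectral_densities_def circle_bounded_def by simp
qed

text \<open>The integrand consists of the terms of the completed square outside the quadratic form. The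
  feasible density enters only through \<open>\<integral> tr (G\<^sup>* \<Lambda> G \<Phi>)\<close>, which equals \<open>tr \<Lambda>\<close> by the constraint.\<close>

lemma integral_linear_terms:
  assumes \<Lambda>: "\<Lambda> \<in> L_H G" and \<Phi>: "circle_bounded \<Phi>" "moment G \<Phi> = mat 1"
  shows "circle_bounded (\<lambda>z. mat 1 \<bullet> \<Psi> z - \<Psi> z \<bullet> inv_pencil \<Lambda> z - congr_fun G \<Lambda> z \<bullet> \<Phi> z)"
    and "circle_integral (\<lambda>z. mat 1 \<bullet> \<Psi> z - \<Psi> z \<bullet> inv_pencil \<Lambda> z - congr_fun G \<Lambda> z \<bullet> \<Phi> z) = dual_value \<Lambda>"
proof -
  have b: "circle_bounded (\<lambda>z. mat 1 \<bullet> \<Psi> z)" "circle_bounded (\<lambda>z. \<Psi> z \<bullet> inv_pencil \<Lambda> z)"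
    "circle_bounded (\<lambda>z. congr_fun G \<Lambda> z \<bullet> \<Phi> z)"
    by (intro circle_bounded_inner circle_bounded_const circle_bounded_\<Psi> circle_bounded_inv_pencil
        circle_bounded_congr_fun \<Lambda> \<Phi>(1))+
  show "circle_bounded (\<lambda>z. mat 1 \<bullet> \<Psi> z - \<Psi> z \<bullet> inv_pencil \<Lambda> z - congr_fun G \<Lambda> z \<bullet> \<Phi> z)"
    by (intro circle_bounded_diff b)
  have "mat 1 \<bullet> \<Lambda> = circle_integral (\<lambda>z. congr_fun G \<Lambda> z \<bullet> \<Phi> z)"
    using inner_moment[OF \<Phi>(1), of \<Lambda>] \<Phi>(2) by (simp add: inner_commute)
  then show "circle_integral (\<lambda>z. mat 1 \<bullet> \<Psi> z - \<Psi> z \<bullet> inv_pencil \<Lambda> z - congr_fun G \<Lambda> z \<bullet> \<Phi> z) = dual_value \<Lambda>"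
    by (simp add: circle_integral_diff b circle_bounded_diff dual_value_def dual_fun_def)
qed

text \<open>Weak duality with an explicit remainder, obtained by integrating the completed square. The
  remainder measures how far \<open>V\<close> is from the pointwise best factor \<open>Q\<^sup>-\<^sup>1 W\<close>.\<close>

lemma factor_gap:
  assumes \<Lambda>: "\<Lambda> \<in> L_H G" and \<Phi>: "circle_bounded \<Phi>" "moment G \<Phi> = mat 1"
    and W: "circle_measurable W" "ae_equal (\<lambda>z. W z ** ctransp (W z)) \<Psi>"
    and V: "circle_measurable V" "ae_equal (\<lambda>z. V z ** ctransp (V z)) \<Phi>"
    and c: "0 < c" "\<And>z. cmod z = 1 \<Longrightarrow> coercive c (dual_pencil G \<Lambda> z)"
  defines "E \<equiv> \<lambda>z. V z - inv_pencil \<Lambda> z ** W z"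
  shows "integrable circle_measure (\<lambda>\<theta>. (norm (E (cis \<theta>)))\<^sup>2)"
    and "dual_value \<Lambda> + c * circle_integral (\<lambda>z. (norm (E z))\<^sup>2) \<le> (L2_norm (\<lambda>z. W z - V z))\<^sup>2"
    and "(AE \<theta> in circle_measure. E (cis \<theta>) = 0) \<Longrightarrow> (L2_norm (\<lambda>z. W z - V z))\<^sup>2 = dual_value \<Lambda>"
proof -
  define H where "H z = mat 1 \<bullet> \<Psi> z - \<Psi> z \<bullet> inv_pencil \<Lambda> z - congr_fun G \<Lambda> z \<bullet> \<Phi> z" for z
  note H = integral_linear_terms[OF \<Lambda> \<Phi>, folded H_def]
  have [measurable]: "(\<lambda>\<theta>. W (cis \<theta>)) \<in> borel_measurable circle_measure"
    "(\<lambda>\<theta>. V (cis \<theta>)) \<in> borel_measurable circle_measure"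
    using W(1) V(1) by (simp_all add: circle_measurable_def)
  have [measurable]: "(\<lambda>\<theta>. inv_pencil \<Lambda> (cis \<theta>)) \<in> borel_measurable circle_measure"
    using circle_bounded_inv_pencil[OF \<Lambda>] by (simp add: circle_bounded_def circle_measurable_def)
  obtain w where w: "0 < w" "\<And>(W :: complex^'m^'m) \<theta>. W ** ctransp W = \<Psi> (cis \<theta>) \<Longrightarrow> norm W \<le> w"
    using circle_bounded_\<Psi> by (rule factor_norm_bound) blast
  obtain v where v: "0 < v" "\<And>(W :: complex^'m^'m) \<theta>. W ** ctransp W = \<Phi> (cis \<theta>) \<Longrightarrow> norm W \<le> v"
    using \<Phi>(1) by (rule factor_norm_bound) blast
  obtain q where q: "0 < q" "\<And>z. cmod z = 1 \<Longrightarrow> norm (inv_pencil \<Lambda> z) \<le> q"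
    using circle_bounded_inv_pencil[OF \<Lambda>] by (rule circle_boundedE) blast
  have ae: "AE \<theta> in circle_measure. W (cis \<theta>) ** ctransp (W (cis \<theta>)) = \<Psi> (cis \<theta>) \<and>
      V (cis \<theta>) ** ctransp (V (cis \<theta>)) = \<Phi> (cis \<theta>)"
    using W(2) V(2) unfolding ae_equal_def by eventually_elim simp
  have "AE \<theta> in circle_measure. norm ((norm (E (cis \<theta>)))\<^sup>2) \<le> (v + q * w)\<^sup>2"
    using ae
  proof (rule eventually_mono)
    fix \<theta> assume "W (cis \<theta>) ** ctransp (W (cis \<theta>)) = \<Psi> (cis \<theta>) \<and>
      V (cis \<theta>) ** ctransp (V (cis \<theta>)) = \<Phi> (cis \<theta>)"
    then have n: "norm (W (cis \<theta>)) \<le> w" "norm (V (cis \<theta>)) \<le> v" by (blast intro: w(2) v(2))+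
    have "norm (E (cis \<theta>)) \<le> norm (V (cis \<theta>)) + norm (inv_pencil \<Lambda> (cis \<theta>)) * norm (W (cis \<theta>))"
      unfolding E_def by (intro order_trans[OF norm_triangle_ineq4] add_left_mono norm_matrix_mult)
    also have "\<dots> \<le> v + q * w" using n q by (intro add_mono mult_mono) auto
    finally show "norm ((norm (E (cis \<theta>)))\<^sup>2) \<le> (v + q * w)\<^sup>2" by (simp add: power_mono)
  qed
  then show intE: "integrable circle_measure (\<lambda>\<theta>. (norm (E (cis \<theta>)))\<^sup>2)"
    unfolding E_def
    by (rule finite_measure.integrable_const_bound[OF finite_measure_circle]) measurable
  have "AE \<theta> in circle_measure. norm ((norm (W (cis \<theta>) - V (cis \<theta>)))\<^sup>2) \<le> (w + v)\<^sup>2"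
    using ae
  proof (rule eventually_mono)
    fix \<theta> assume "W (cis \<theta>) ** ctransp (W (cis \<theta>)) = \<Psi> (cis \<theta>) \<and>
      V (cis \<theta>) ** ctransp (V (cis \<theta>)) = \<Phi> (cis \<theta>)"
    then have n: "norm (W (cis \<theta>)) \<le> w" "norm (V (cis \<theta>)) \<le> v" by (blast intro: w(2) v(2))+
    have "norm (W (cis \<theta>) - V (cis \<theta>)) \<le> w + v"
      using n by (intro order_trans[OF norm_triangle_ineq4] add_mono)
    then show "norm ((norm (W (cis \<theta>) - V (cis \<theta>)))\<^sup>2) \<le> (w + v)\<^sup>2" by (simp add: power_mono)
  qed
  then have intN: "integrable circle_measure (\<lambda>\<theta>. (norm (W (cis \<theta>) - V (cis \<theta>)))\<^sup>2)"
    by (rule finite_measure.integrable_const_bound[OF finite_measure_circle]) measurable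
  have intH: "integrable circle_measure (\<lambda>\<theta>. H (cis \<theta>))"
    using H(1) by (rule circle_bounded_integrable)
  have square: "AE \<theta> in circle_measure. (norm (W (cis \<theta>) - V (cis \<theta>)))\<^sup>2 =
      H (cis \<theta>) + E (cis \<theta>) \<bullet> (dual_pencil G \<Lambda> (cis \<theta>) ** E (cis \<theta>))"
    using ae
  proof (rule eventually_mono)
    fix \<theta> assume e: "W (cis \<theta>) ** ctransp (W (cis \<theta>)) = \<Psi> (cis \<theta>) \<and>
      V (cis \<theta>) ** ctransp (V (cis \<theta>)) = \<Phi> (cis \<theta>)"
    have "dual_pencil G \<Lambda> (cis \<theta>) - mat 1 = congr_fun G \<Lambda> (cis \<theta>)" by (simp add: dual_pencil_def)
    then show "(norm (W (cis \<theta>) - V (cis \<theta>)))\<^sup>2 =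
        H (cis \<theta>) + E (cis \<theta>) \<bullet> (dual_pencil G \<Lambda> (cis \<theta>) ** E (cis \<theta>))"
      using complete_square[OF L_H_posdef[OF \<Lambda>, of "cis \<theta>"], of "W (cis \<theta>)" "V (cis \<theta>)"] e
      by (simp add: H_def E_def)
  qed
  have "circle_integral H + c * circle_integral (\<lambda>z. (norm (E z))\<^sup>2) =
      integral\<^sup>L circle_measure (\<lambda>\<theta>. H (cis \<theta>) + c * (norm (E (cis \<theta>)))\<^sup>2)"
    unfolding circle_integral_def using intH intE by simp
  also have "\<dots> \<le> circle_integral (\<lambda>z. (norm (W z - V z))\<^sup>2)"
    unfolding circle_integral_def
  proof (rule integral_mono_AE)
    show "AE \<theta> in circle_measure. H (cis \<theta>) + c * (norm (E (cis \<theta>)))\<^sup>2 \<le> (norm (W (cis \<theta>) - V (cis \<theta>)))\<^sup>2"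
      using square
    proof (rule eventually_mono)
      fix \<theta> assume e: "(norm (W (cis \<theta>) - V (cis \<theta>)))\<^sup>2 =
        H (cis \<theta>) + E (cis \<theta>) \<bullet> (dual_pencil G \<Lambda> (cis \<theta>) ** E (cis \<theta>))"
      have "c * (norm (E (cis \<theta>)))\<^sup>2 \<le> E (cis \<theta>) \<bullet> (dual_pencil G \<Lambda> (cis \<theta>) ** E (cis \<theta>))"
        by (rule inner_congr_ge) (use c(2)[of "cis \<theta>"] in \<open>simp add: coercive_def\<close>)
      then show "H (cis \<theta>) + c * (norm (E (cis \<theta>)))\<^sup>2 \<le> (norm (W (cis \<theta>) - V (cis \<theta>)))\<^sup>2"
        unfolding e by simp
    qed
  qed (use intH intE intN in auto)
  finally show "dual_value \<Lambda> + c * circle_integral (\<lambda>z. (norm (E z))\<^sup>2) \<le> (L2_norm (\<lambda>z. W z - V z))\<^sup>2"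
    unfolding H(2) L2_norm_eq .
  assume "AE \<theta> in circle_measure. E (cis \<theta>) = 0"
  then have "AE \<theta> in circle_measure. (norm (W (cis \<theta>) - V (cis \<theta>)))\<^sup>2 = H (cis \<theta>)"
    using square by eventually_elim simp
  then have "circle_integral (\<lambda>z. (norm (W z - V z))\<^sup>2) = circle_integral H"
    unfolding circle_integral_def using intN intH by (intro integral_cong_AE) auto
  then show "(L2_norm (\<lambda>z. W z - V z))\<^sup>2 = dual_value \<Lambda>" unfolding L2_norm_eq H(2) .
qed

lemma dual_value_le_gap:
  assumes \<Lambda>: "\<Lambda> \<in> L_H G" and \<Phi>: "\<Phi> \<in> spectral_densities" "moment G \<Phi> = mat 1"
    and x: "x \<in> factor_gaps \<Phi> \<Psi>"
  shows "dual_value \<Lambda> \<le> x"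
proof -
  obtain W V where WV: "x = (L2_norm (\<lambda>z. W z - V z))\<^sup>2" "W \<in> L2_matrix" "V \<in> L2_matrix"
    "ae_equal (\<lambda>z. W z ** ctransp (W z)) \<Psi>" "ae_equal (\<lambda>z. V z ** ctransp (V z)) \<Phi>"
    using x unfolding factor_gaps_def by blast
  have m: "circle_measurable W" "circle_measurable V" using WV by (simp_all add: L2_matrix_def)
  obtain c where c: "0 < c" "\<And>z. cmod z = 1 \<Longrightarrow> coercive c (dual_pencil G \<Lambda> z)"
    using L_H_coercive[OF \<Lambda>] by blast
  note gap = factor_gap(2)[OF \<Lambda> spectral_densities_bounded[OF \<Phi>(1)] \<Phi>(2) m(1) WV(4) m(2) WV(5) c]
  have "0 \<le> circle_integral (\<lambda>z. (norm (V z - inv_pencil \<Lambda> z ** W z))\<^sup>2)"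
    unfolding circle_integral_def by (rule Bochner_Integration.integral_nonneg) simp
  then have "0 \<le> c * circle_integral (\<lambda>z. (norm (V z - inv_pencil \<Lambda> z ** W z))\<^sup>2)"
    using c(1) by simp
  then show ?thesis using gap WV(1) by linarith
qed

lemma dual_value_le_dist:
  assumes "\<Lambda> \<in> L_H G" "\<Phi> \<in> spectral_densities" "moment G \<Phi> = mat 1"
  shows "dual_value \<Lambda> \<le> (hellinger_dist \<Phi> \<Psi>)\<^sup>2"
  unfolding hellinger_dist_sq[OF factor_gaps_nonempty[OF assms(2) \<Psi>]]
  using factor_gaps_nonempty[OF assms(2) \<Psi>] dual_value_le_gap[OF assms] by (rule cInf_greatest)

text \<open>For the density attached to \<open>\<Lambda>\<close> the factors \<open>W\<close> and \<open>Q\<^sup>-\<^sup>1 W\<close> attain the bound.\<close>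

lemma dist_Phi_hat:
  assumes \<Lambda>: "\<Lambda> \<in> L_H G" and mom: "moment G (Phi_hat G \<Psi> \<Lambda>) = mat 1"
  shows "(hellinger_dist (Phi_hat G \<Psi> \<Lambda>) \<Psi>)\<^sup>2 = dual_value \<Lambda>"
proof -
  note dens = Phi_hat_spectral_density[OF \<Lambda>]
  note bd = circle_bounded_Phi_hat[OF \<Lambda>]
  obtain W where W: "W \<in> L2_matrix" "ae_equal (\<lambda>z. W z ** ctransp (W z)) \<Psi>"
    using \<Psi> by (rule spectral_factor_exists)
  have mW: "circle_measurable W" using W by (simp add: L2_matrix_def)
  define V where "V z = inv_pencil \<Lambda> z ** W z" for z
  have mV: "circle_measurable V"
    using mW circle_bounded_inv_pencil[OF \<Lambda>]
    unfolding V_def circle_bounded_def circle_measurable_def by (simp add: borel_measurable_matrix_mult)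
  have aV: "ae_equal (\<lambda>z. V z ** ctransp (V z)) (Phi_hat G \<Psi> \<Lambda>)"
    using W(2) unfolding ae_equal_def
  proof (rule eventually_mono)
    fix \<theta> assume e: "W (cis \<theta>) ** ctransp (W (cis \<theta>)) = \<Psi> (cis \<theta>)"
    have "V (cis \<theta>) ** ctransp (V (cis \<theta>)) =
        inv_pencil \<Lambda> (cis \<theta>) ** (W (cis \<theta>) ** ctransp (W (cis \<theta>))) ** inv_pencil \<Lambda> (cis \<theta>)"
      by (simp add: V_def ctransp_mult matrix_mul_assoc
          hermitianD[OF hermitian_inv_pencil[OF \<Lambda>, of "cis \<theta>"]])
    then show "V (cis \<theta>) ** ctransp (V (cis \<theta>)) = Phi_hat G \<Psi> \<Lambda> (cis \<theta>)"
      by (simp only: e Phi_hat_def)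
  qed
  have "V \<in> L2_matrix" using mV bd aV by (rule L2_matrixI)
  obtain c where c: "0 < c" "\<And>z. cmod z = 1 \<Longrightarrow> coercive c (dual_pencil G \<Lambda> z)"
    using L_H_coercive[OF \<Lambda>] by blast
  have "(L2_norm (\<lambda>z. W z - V z))\<^sup>2 = dual_value \<Lambda>"
    by (rule factor_gap(3)[OF \<Lambda> bd mom mW W(2) mV aV c]) (auto simp: V_def intro: AE_I2)
  moreover have "(L2_norm (\<lambda>z. W z - V z))\<^sup>2 \<in> factor_gaps (Phi_hat G \<Psi> \<Lambda>) \<Psi>"
    unfolding factor_gaps_def using W \<open>V \<in> L2_matrix\<close> aV by blast
  ultimately have "Inf (factor_gaps (Phi_hat G \<Psi> \<Lambda>) \<Psi>) \<le> dual_value \<Lambda>"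
    using bdd_below_factor_gaps by (metis cInf_lower)
  then show ?thesis
    using dual_value_le_dist[OF \<Lambda> dens mom] hellinger_dist_sq[OF factor_gaps_nonempty[OF dens \<Psi>]]
    by simp
qed

text \<open>The infimum defining the distance need not be attained. Along a minimising sequence of
  factors \<open>V - Q\<^sup>-\<^sup>1 W\<close> tends to zero in \<open>L\<^sup>2\<close>, and the factors are bounded, so
  \<open>V V\<^sup>*\<close> is arbitrarily close to the optimal density.\<close>

lemma optimal_density_unique:
  assumes \<Lambda>: "\<Lambda> \<in> L_H G"
    and \<Phi>: "\<Phi> \<in> spectral_densities" "moment G \<Phi> = mat 1"
    and opt: "(hellinger_dist \<Phi> \<Psi>)\<^sup>2 \<le> dual_value \<Lambda>"
  shows "ae_equal \<Phi> (Phi_hat G \<Psi> \<Lambda>)"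
proof -
  note b\<Phi> = spectral_densities_bounded[OF \<Phi>(1)]
  obtain c where c: "0 < c" "\<And>z. cmod z = 1 \<Longrightarrow> coercive c (dual_pencil G \<Lambda> z)"
    using L_H_coercive[OF \<Lambda>] by blast
  obtain w where w: "0 < w" "\<And>(W :: complex^'m^'m) \<theta>. W ** ctransp W = \<Psi> (cis \<theta>) \<Longrightarrow> norm W \<le> w"
    using circle_bounded_\<Psi> by (rule factor_norm_bound) blast
  obtain v where v: "0 < v" "\<And>(W :: complex^'m^'m) \<theta>. W ** ctransp W = \<Phi> (cis \<theta>) \<Longrightarrow> norm W \<le> v"
    using b\<Phi> by (rule factor_norm_bound) blast
  obtain q where q: "0 < q" "\<And>z. cmod z = 1 \<Longrightarrow> norm (inv_pencil \<Lambda> z) \<le> q"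
    using circle_bounded_inv_pencil[OF \<Lambda>] by (rule circle_boundedE) blast
  define M where "M = v + q * w"
  have M: "0 < M" using v w q by (simp add: M_def add_pos_pos)
  define N where "N z = (norm (\<Phi> z - Phi_hat G \<Psi> \<Lambda> z))\<^sup>2" for z
  have bN: "circle_bounded N"
  proof -
    have "circle_bounded (\<lambda>z. (\<Phi> z - Phi_hat G \<Psi> \<Lambda> z) \<bullet> (\<Phi> z - Phi_hat G \<Psi> \<Lambda> z))"
      by (intro circle_bounded_intros b\<Phi> circle_bounded_Phi_hat \<Lambda>)
    moreover have "N = (\<lambda>z. (\<Phi> z - Phi_hat G \<Psi> \<Lambda> z) \<bullet> (\<Phi> z - Phi_hat G \<Psi> \<Lambda> z))"
      unfolding N_def power2_norm_eq_inner by (rule ext) (rule refl)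
    ultimately show ?thesis by simp
  qed
  have small: "circle_integral N \<le> M\<^sup>2 * (\<epsilon> / c)" if \<epsilon>: "0 < \<epsilon>" for \<epsilon>
  proof -
    have "Inf (factor_gaps \<Phi> \<Psi>) < dual_value \<Lambda> + \<epsilon>"
      using opt \<epsilon> hellinger_dist_sq[OF factor_gaps_nonempty[OF \<Phi>(1) \<Psi>]] by simp
    then obtain x where x: "x \<in> factor_gaps \<Phi> \<Psi>" "x < dual_value \<Lambda> + \<epsilon>"
      using cInf_lessD[OF factor_gaps_nonempty[OF \<Phi>(1) \<Psi>]] by blast
    obtain W V where WV: "x = (L2_norm (\<lambda>z. W z - V z))\<^sup>2" "W \<in> L2_matrix" "V \<in> L2_matrix"
      "ae_equal (\<lambda>z. W z ** ctransp (W z)) \<Psi>" "ae_equal (\<lambda>z. V z ** ctransp (V z)) \<Phi>"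
      using x unfolding factor_gaps_def by blast
    have m: "circle_measurable W" "circle_measurable V" using WV by (simp_all add: L2_matrix_def)
    define E where "E z = V z - inv_pencil \<Lambda> z ** W z" for z
    note gap = factor_gap(1,2)[OF \<Lambda> b\<Phi> \<Phi>(2) m(1) WV(4) m(2) WV(5) c, folded E_def]
    have "c * circle_integral (\<lambda>z. (norm (E z))\<^sup>2) \<le> \<epsilon>" using gap(2) x(2) WV(1) by linarith
    then have Ele: "circle_integral (\<lambda>z. (norm (E z))\<^sup>2) \<le> \<epsilon> / c" using c(1) by (simp add: field_simps)
    have "circle_integral N \<le> circle_integral (\<lambda>z. M\<^sup>2 * (norm (E z))\<^sup>2)"
      unfolding circle_integral_def
    proof (rule integral_mono_AE)
      show "AE \<theta> in circle_measure. N (cis \<theta>) \<le> M\<^sup>2 * (norm (E (cis \<theta>)))\<^sup>2"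
        using WV(4,5) unfolding ae_equal_def
      proof eventually_elim
        fix \<theta>
        let ?z = "cis \<theta>"
        assume e: "W ?z ** ctransp (W ?z) = \<Psi> ?z" "V ?z ** ctransp (V ?z) = \<Phi> ?z"
        define U where "U = inv_pencil \<Lambda> ?z ** W ?z"
        have hU: "U ** ctransp U = Phi_hat G \<Psi> \<Lambda> ?z"
          by (simp add: U_def Phi_hat_def ctransp_mult matrix_mul_assoc e(1)[symmetric]
              hermitianD[OF hermitian_inv_pencil[OF \<Lambda>, of ?z]])
        have nV: "norm (V ?z) \<le> v" using e(2) by (rule v(2))
        have nU: "norm U \<le> q * w" unfolding U_def
          using w(2)[OF e(1)] q by (intro order_trans[OF norm_matrix_mult] mult_mono) auto
        have EU: "E ?z = V ?z - U" by (simp add: E_def U_def)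
        have "\<Phi> ?z - Phi_hat G \<Psi> \<Lambda> ?z = E ?z ** ctransp (V ?z) + U ** ctransp (E ?z)"
          by (simp add: EU e(2)[symmetric] hU[symmetric] matrix_diff_rdistrib matrix_diff_ldistrib
              ctransp_diff)
        also have "norm \<dots> \<le> norm (E ?z) * norm (V ?z) + norm U * norm (E ?z)"
          using norm_matrix_mult[of "E ?z" "ctransp (V ?z)"] norm_matrix_mult[of U "ctransp (E ?z)"]
          by (intro order_trans[OF norm_triangle_ineq] add_mono) auto
        also have "\<dots> \<le> norm (E ?z) * v + (q * w) * norm (E ?z)"
          using nV nU by (intro add_mono mult_left_mono mult_right_mono) auto
        also have "\<dots> = M * norm (E ?z)" by (simp add: M_def algebra_simps)
        finally have "(norm (\<Phi> ?z - Phi_hat G \<Psi> \<Lambda> ?z))\<^sup>2 \<le> (M * norm (E ?z))\<^sup>2"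
          by (intro power_mono) auto
        then show "N ?z \<le> M\<^sup>2 * (norm (E ?z))\<^sup>2" by (simp add: N_def power_mult_distrib)
      qed
    qed (use circle_bounded_integrable[OF bN] gap(1) in auto)
    also have "\<dots> = M\<^sup>2 * circle_integral (\<lambda>z. (norm (E z))\<^sup>2)"
      unfolding circle_integral_def by simp
    also have "\<dots> \<le> M\<^sup>2 * (\<epsilon> / c)" using Ele by (intro mult_left_mono) auto
    finally show ?thesis .
  qed
  have "circle_integral N \<le> 0"
  proof (rule field_le_epsilon)
    fix e :: real assume "0 < e"
    then show "circle_integral N \<le> 0 + e"
      using small[of "e * c / M\<^sup>2"] M c(1) by simp
  qed
  moreover have "0 \<le> circle_integral N"
    unfolding circle_integral_def N_def by (rule Bochner_Integration.integral_nonneg) simp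
  ultimately have N0: "circle_integral N = 0" by simp
  have "AE \<theta> in circle_measure. N (cis \<theta>) = 0"
    by (rule circle_integral_zero_imp_AE[OF bN _ N0]) (simp add: N_def)
  then show ?thesis unfolding ae_equal_def N_def by simp
qed

end

section \<open>Transfer functions of stable systems\<close>

lemma moment_map_transfer_fun:
  fixes A :: "complex^'n^'n" and B :: "complex^'m^'n"
  assumes A: "stable A"
  obtains L where "moment_map (transfer_fun A B) L"
proof -
  have "circle_bounded (resolvent A)" by (rule circle_bounded_continuous[OF continuous_on_resolvent[OF A]])
  then obtain r where r: "0 < r" "\<And>z. cmod z = 1 \<Longrightarrow> norm (resolvent A z) \<le> r"
    by (rule circle_boundedE) blast
  have mat_norm: "norm (mat c ** X) = cmod c * norm X" for c and X :: "complex^'m^'n"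
  proof -
    have "mat c ** X = (\<chi> i j. c * X $ i $ j)"
      by (simp add: vec_eq_iff matrix_matrix_mult_def mat_def if_distrib[of "\<lambda>y. y * _"] cong: if_cong)
    then show ?thesis by (simp add: norm_vec_def norm_mult L2_set_right_distrib)
  qed
  define L where "L = r * r * norm B + 1"
  have "moment_map (transfer_fun A B) L"
  proof
    show "0 < L" using r(1) by (simp add: L_def add_nonneg_pos)
    fix z w :: complex assume z: "cmod z = 1" and w: "cmod w = 1"
    have "transfer_fun A B z - transfer_fun A B w = mat (w - z) ** (resolvent A z ** resolvent A w ** B)"
      unfolding transfer_fun_resolvent matrix_diff_rdistrib[symmetric] resolvent_diff[OF A z w]
      by (simp add: matrix_mul_assoc)
    then have "norm (transfer_fun A B z - transfer_fun A B w) =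
        cmod (w - z) * norm (resolvent A z ** resolvent A w ** B)"
      by (simp only: mat_norm)
    also have "\<dots> \<le> cmod (w - z) * (r * r * norm B)"
      using r z w by (intro mult_left_mono order_trans[OF norm_matrix_mult] mult_mono
          order_trans[OF norm_matrix_mult[of "resolvent A z" "resolvent A w"]]) auto
    also have "\<dots> \<le> L * cmod (z - w)" by (simp add: L_def algebra_simps norm_minus_commute)
    finally show "norm (transfer_fun A B z - transfer_fun A B w) \<le> L * cmod (z - w)" .
  qed
  then show thesis by (rule that)
qed

theorem theorem7p2:
  fixes A :: "complex^'n^'n" and B :: "complex^'m^'n"
    and G :: "complex \<Rightarrow> complex^'m^'n"
    and \<Psi> :: "complex \<Rightarrow> complex^'m^'m"
  assumes "\<Psi> \<in> spectral_densities"
    and "G = transfer_fun A B"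
    and "\<And>k. is_eigenvalue A k \<Longrightarrow> cmod k < 1"
    and "rank B = CARD('m)"
    and "reachable A B"
  shows "(rank (block_matrix (mat 1 - A ** ctransp A) B (ctransp B) 0) = 2 * CARD('m) \<longleftrightarrow>
            (mat 1 - range_proj B) ** (mat 1 - A ** ctransp A) ** (mat 1 - range_proj B) = 0) \<and>
         (rank (block_matrix (mat 1 - A ** ctransp A) B (ctransp B) 0) = 2 * CARD('m) \<longrightarrow>
            (\<exists>!\<Lambda>. \<Lambda> \<in> L_Gamma_H G \<and> moment G (Phi_hat G \<Psi> \<Lambda>) = mat 1) \<and>
            (\<forall>\<Lambda>. \<Lambda> \<in> L_Gamma_H G \<and> moment G (Phi_hat G \<Psi> \<Lambda>) = mat 1 \<longrightarrow>
               is_arg_min (\<lambda>\<Phi>. (hellinger_dist \<Phi> \<Psi>)\<^sup>2)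
                 (\<lambda>\<Phi>. \<Phi> \<in> spectral_densities \<and> moment G \<Phi> = mat 1) (Phi_hat G \<Psi> \<Lambda>) \<and>
               (\<forall>\<Phi>. is_arg_min (\<lambda>\<Phi>. (hellinger_dist \<Phi> \<Psi>)\<^sup>2)
                  (\<lambda>\<Phi>. \<Phi> \<in> spectral_densities \<and> moment G \<Phi> = mat 1) \<Phi> \<longrightarrow>
                  ae_equal \<Phi> (Phi_hat G \<Psi> \<Lambda>))))"
    (is "?equiv \<and> (?rank \<longrightarrow> ?unique \<and> ?opt)")
proof (intro conjI impI)
  have "hermitian (mat 1 - A ** ctransp A)"
    by (intro hermitian_diff hermitian_mat1) (simp add: hermitian_def ctransp_mult)
  then show equiv: ?equiv by (rule rank_bordered_iff[OF assms(4)])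
  assume ?rank
  have A: "stable A" using assms(3) by (simp add: stable_def)
  obtain \<Phi>\<^sub>0 where \<Phi>\<^sub>0: "continuous_on (sphere 0 1) \<Phi>\<^sub>0" "\<And>z. cmod z = 1 \<Longrightarrow> posdef (\<Phi>\<^sub>0 z)"
    "moment G \<Phi>\<^sub>0 = mat 1"
  proof (rule feasible_density[OF A full_column_rank_inj[OF assms(4)] equiv[THEN iffD1, OF \<open>?rank\<close>]])
    fix \<Phi> assume \<Phi>: "continuous_on (sphere 0 1) \<Phi>" "\<And>z. cmod z = 1 \<Longrightarrow> posdef (\<Phi> z)"
      "moment (transfer_fun A B) \<Phi> = mat 1"
    show thesis by (rule that[OF \<Phi>(1,2)]) (simp_all add: assms(2) \<Phi>(3))
  qed
  obtain L where "moment_map G L"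
    unfolding assms(2) by (rule moment_map_transfer_fun[OF A])
  then interpret hellinger_problem G L \<Psi> \<Phi>\<^sub>0
    by (intro hellinger_problem.intro hellinger_problem_axioms.intro assms(1) \<Phi>\<^sub>0)
  show ?unique using dual_solution_exists dual_solution_unique by metis
  show ?opt
  proof (intro allI impI conjI; elim conjE)
    fix \<Lambda> assume "\<Lambda> \<in> L_Gamma_H G" and mom: "moment G (Phi_hat G \<Psi> \<Lambda>) = mat 1"
    from this(1) have \<Lambda>: "\<Lambda> \<in> L_H G" by (rule L_Gamma_HD(1))
    note dens = Phi_hat_spectral_density[OF \<Lambda>] and dist = dist_Phi_hat[OF \<Lambda> mom]
    show "is_arg_min (\<lambda>\<Phi>. (hellinger_dist \<Phi> \<Psi>)\<^sup>2)
        (\<lambda>\<Phi>. \<Phi> \<in> spectral_densities \<and> moment G \<Phi> = mat 1) (Phi_hat G \<Psi> \<Lambda>)"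
      unfolding is_arg_min_def dist using dens mom dual_value_le_dist[OF \<Lambda>] by (auto simp: not_less)
    fix \<Phi> assume min: "is_arg_min (\<lambda>\<Phi>. (hellinger_dist \<Phi> \<Psi>)\<^sup>2)
        (\<lambda>\<Phi>. \<Phi> \<in> spectral_densities \<and> moment G \<Phi> = mat 1) \<Phi>"
    then have "\<not> (hellinger_dist (Phi_hat G \<Psi> \<Lambda>) \<Psi>)\<^sup>2 < (hellinger_dist \<Phi> \<Psi>)\<^sup>2"
      using dens mom unfolding is_arg_min_def by blast
    then have "(hellinger_dist \<Phi> \<Psi>)\<^sup>2 \<le> dual_value \<Lambda>" by (simp add: dist)
    then show "ae_equal \<Phi> (Phi_hat G \<Psi> \<Lambda>)"
      using min unfolding is_arg_min_def by (intro optimal_density_unique[OF \<Lambda>]) auto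
  qed
qed

end
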